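(* For $n$ odd and sufficiently large, among all connected outerplanar graphs on $n=2q+1$ vertices, the graphs $G$ maximizing $\lambda_2$ have the following structure: $G$ has a unique cut vertex $u$ and $G\setminus\{u\}$ consists of two disjoint copies of the fan graph $K_1\vee P_{q-1}$. Moreover, for all of these graphs $G$, $\lambda_2(G)=\lambda_1(K_1\vee P_{q-1})$.
   Context: For a graph $G$, $\lambda_1(G)\ge\lambda_2(G)\ge\cdots$ denote the eigenvalues of its adjacency matrix in non-increasing order. A graph is outerplanar if it can be drawn in the plane without crossing edges such that each of its vertices lies on the outer face. $P_m$ is the path on $m$ vertices, and $K_1\vee P_{m}$ is the fan graph, obtained from $P_m$ by adding a new vertex adjacent to every vertex of $P_m$. A cut vertex of a connected graph is a vertex whose deletion disconnects the graph. $G\setminus\{u\}$ is the graph obtained from $G$ by deleting the vertex $u$; "two disjoint copies" means that $G\setminus\{u\}$ is isomorphic to the disjoint union of two copies of $K_1\vee P_{q-1}$.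
   Formalization: "Unique cut vertex u" is proved as: exactly one cut vertex u has G∖{u} equal to two disjoint fans; other cut vertices may exist. Literal uniqueness fails: if u is joined to a single vertex w of one fan, G is still a maximizer and w is also a cut vertex. *)

theory Defs
  imports
    "HOL-Analysis.Analysis"
    "Graph_Theory.Graph_Theory"
    "Jordan_Normal_Form.Char_Poly"
begin

text \<open>Finite simple graphs are symmetric loop-free pair digraphs (locale \<^locale>\<open>pair_graph\<close>),
  each edge \<open>uv\<close> being represented by the two arcs \<open>(u, v)\<close> and \<open>(v, u)\<close>.
  The name \<open>connected\<close> also denotes a topological notion, so the graph-theoretic one is
  written with its qualifier.\<close>

definition path_graph :: "nat \<Rightarrow> nat pair_pre_digraph" where
  "path_graph m = \<lparr> pverts = {0..<m}, parcs = {(i, j). i < m \<and> j < m \<and> (j = Suc i \<or> i = Suc j)} \<rparr>"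

text \<open>\<open>K\<^sub>1 \<or> P\<^sub>m\<close>; the added vertex is \<open>m\<close>, which is not a vertex of \<open>path_graph m\<close>.\<close>

definition fan_graph :: "nat \<Rightarrow> nat pair_pre_digraph" where
  "fan_graph m = \<lparr> pverts = insert m (pverts (path_graph m)),
     parcs = parcs (path_graph m) \<union> {m} \<times> pverts (path_graph m) \<union> pverts (path_graph m) \<times> {m} \<rparr>"

definition disjoint_union ::
  "'a pair_pre_digraph \<Rightarrow> 'b pair_pre_digraph \<Rightarrow> ('a + 'b) pair_pre_digraph" where
  "disjoint_union G H = \<lparr> pverts = Inl ` pverts G \<union> Inr ` pverts H,
     parcs = map_prod Inl Inl ` parcs G \<union> map_prod Inr Inr ` parcs H \<rparr>"

text \<open>The empty graph does not count as connected in the library; the condition that some vertex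
  remains keeps the vertex of \<open>K\<^sub>1\<close> from being a cut vertex.\<close>

definition cut_vertex :: "'a pair_pre_digraph \<Rightarrow> 'a \<Rightarrow> bool" where
  "cut_vertex G u \<longleftrightarrow> Digraph_Component.connected (with_proj G) \<and> u \<in> pverts G \<and>
     pverts G \<noteq> {u} \<and> \<not> Digraph_Component.connected (pre_digraph.del_vert (with_proj G) u)"

text \<open>The rows and columns of the adjacency matrix follow the order of the vertex type.\<close>

definition adjacency_matrix :: "'a::linorder pair_pre_digraph \<Rightarrow> real mat" where
  "adjacency_matrix G = (let vs = sorted_list_of_set (pverts G); n = card (pverts G) in
     mat n n (\<lambda>(i, j). if (vs ! i, vs ! j) \<in> parcs G then 1 else 0))"

text \<open>The \<open>k\<close>-th largest eigenvalue, \<open>1 \<le> k \<le> card (pverts G)\<close>, counted with multiplicity.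
  The adjacency matrix being real symmetric, all its eigenvalues are real.\<close>

definition graph_eigenvalue :: "nat \<Rightarrow> 'a::linorder pair_pre_digraph \<Rightarrow> real" where
  "graph_eigenvalue k G =
     rev (sorted_list_of_multiset (proots (char_poly (adjacency_matrix G)))) ! (k - 1)"

text \<open>In a drawing, \<open>p\<close> places the vertices in the plane and \<open>c {u, v}\<close> is the curve for the
  edge \<open>uv\<close>, in either direction. Curves of distinct edges meet in common endpoints only.\<close>

definition plane_drawing ::
  "'a pair_pre_digraph \<Rightarrow> ('a \<Rightarrow> complex) \<Rightarrow> ('a set \<Rightarrow> real \<Rightarrow> complex) \<Rightarrow> bool" where
  "plane_drawing G p c \<longleftrightarrow>
     inj_on p (pverts G) \<and>
     (\<forall>(u, v) \<in> parcs G. arc (c {u, v}) \<and>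
        {pathstart (c {u, v}), pathfinish (c {u, v})} = {p u, p v} \<and>
        path_image (c {u, v}) \<inter> p ` pverts G = {p u, p v}) \<and>
     (\<forall>(u, v) \<in> parcs G. \<forall>(x, y) \<in> parcs G. {u, v} \<noteq> {x, y} \<longrightarrow>
        path_image (c {u, v}) \<inter> path_image (c {x, y}) \<subseteq> p ` ({u, v} \<inter> {x, y}))"

definition drawing_points ::
  "'a pair_pre_digraph \<Rightarrow> ('a \<Rightarrow> complex) \<Rightarrow> ('a set \<Rightarrow> real \<Rightarrow> complex) \<Rightarrow> complex set" where
  "drawing_points G p c = p ` pverts G \<union> (\<Union>(u, v) \<in> parcs G. path_image (c {u, v}))"

text \<open>The outer face is the unbounded component of the complement of the (compact) drawing, that is
  \<^const>\<open>outside\<close>; a vertex lies on it if it belongs to its boundary.\<close>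

definition outerplanar :: "'a pair_pre_digraph \<Rightarrow> bool" where
  "outerplanar G \<longleftrightarrow>
     (\<exists>p c. plane_drawing G p c \<and> p ` pverts G \<subseteq> frontier (outside (drawing_points G p c)))"

definition connected_outerplanar_graph :: "nat \<Rightarrow> 'a pair_pre_digraph \<Rightarrow> bool" where
  "connected_outerplanar_graph n G \<longleftrightarrow> pair_graph G \<and> card (pverts G) = n \<and>
     Digraph_Component.connected (with_proj G) \<and> outerplanar G"

end

theory Submission
  imports Defs "Jordan_Normal_Form.Schur_Decomposition"
begin

text \<open>Let \<open>n = 2 q + 1\<close> and let \<open>\<mu>\<close> be the spectral radius of the fan \<open>F = K\<^sub>1 \<or> P\<^sub>q\<^sub>-\<^sub>1\<close>, which has \<open>q\<close> vertices.

Take an eigenvector \<open>x\<close> of a connected outerplanar graph for \<open>\<lambda>\<^sub>2 \<ge> \<mu>\<close>. It can be chosen orthogonal to a positive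
top eigenvector, so the sets \<open>P\<close> and \<open>N\<close> of vertices with positive and with negative entry are both
nonempty. At a vertex of \<open>P\<close> the eigenvalue equation restricted to \<open>P\<close> turns into
\<open>\<lambda>\<^sub>2 x \<le> A x\<close>, because the omitted terms are not positive; the same holds for \<open>- x\<close> on \<open>N\<close>.
One of the two sets, say \<open>P\<close>, has at most \<open>q\<close> vertices. The fan is spectrally extremal among
outerplanar graphs with at most \<open>q\<close> vertices when \<open>q\<close> is large (Tait and Tobin); in the form
\<open>fan_extremal\<close>, for vectors satisfying only the inequality, this yields \<open>\<lambda>\<^sub>2 = \<mu>\<close> and that \<open>P\<close>
induces a fan on exactly \<open>q\<close> vertices. Equality also rules out edges between \<open>P\<close> and \<open>N\<close>
(\<open>positive_part_is_fan\<close>). As the graph is connected, \<open>P\<close> and \<open>N\<close> cannot exhaust the vertices, so \<open>N\<close> has at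
most \<open>q\<close> vertices, is a fan by the same argument, and one vertex \<open>u\<close> is left over; it separates \<open>P\<close> from \<open>N\<close>.
Conversely, \<open>\<lambda>\<^sub>2 \<ge> \<mu>\<close> holds for a maximal graph because it holds for the graph \<open>double_fan\<close>, where two disjoint
fans without edges between them carry two test vectors (\<open>second_eigenvalue_ge\<close>).

Extremality of the fan: scale the vector so that its largest entry is \<open>1\<close>, at \<open>z\<close>. Counting walks of length
two from \<open>z\<close> shows that all but \<open>O(\<surd>q)\<close> vertices are neighbours of \<open>z\<close>. Then all other entries are
\<open>O(1/\<surd>q)\<close>, and a vertex that is not adjacent to \<open>z\<close> sees entries of total less than \<open>1\<close>. Replacing its edges
by the single edge to \<open>z\<close> therefore increases the quadratic form. Once \<open>z\<close> is adjacent to all other vertices,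
which induce a linear forest, the graph is a subgraph of the fan.

This needs three properties of outerplanar graphs: two vertices have at most two common neighbours, the
neighbourhood of a vertex contains no cycle, and the number of edges is linear in the number of vertices. They
follow from the absence of \<open>K\<^sub>2\<^sub>,\<^sub>3\<close> and of cycles with two crossing chords. These two configurations are
excluded with the theta curve theorem: some vertex would be enclosed by a closed curve of the drawing and
could not lie on the outer face.\<close>

text \<open>Without a qualifier, \<open>connected\<close> is the topological notion.\<close>

hide_const (open) Digraph_Component.connected

section \<open>Theta curves and crossing chords in the plane\<close>

lemma double_arc_Jordan:
  fixes c1 c2 :: "real \<Rightarrow> complex"
  assumes "arc c1" "arc c2" "pathstart c1 = a" "pathfinish c1 = b" "pathstart c2 = a" "pathfinish c2 = b"
    and "path_image c1 \<inter> path_image c2 = {a, b}"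
  defines "C \<equiv> path_image c1 \<union> path_image c2"
  shows "compact C" "inside C \<noteq> {}" "open (inside C)" "connected (inside C)" "bounded (inside C)"
    "open (outside C)" "connected (outside C)" "frontier (inside C) = C"
proof -
  let ?c = "c1 +++ reversepath c2"
  have sp: "simple_path ?c" "pathfinish ?c = pathstart ?c"
    using assms by (auto simp: simple_path_join_loop_eq arc_reversepath)
  have im: "path_image ?c = C"
    using assms by (simp add: path_image_join)
  show "compact C"
    unfolding C_def using assms by (simp add: compact_Un compact_arc_image)
  show "inside C \<noteq> {}" "open (inside C)" "connected (inside C)" "bounded (inside C)"
    "open (outside C)" "connected (outside C)" "frontier (inside C) = C"
    using Jordan_inside_outside[OF sp] unfolding im by auto
qed

lemma connected_inside_or_outside:
  fixes S E :: "complex set"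
  assumes "connected E" "E \<inter> S = {}" "open (inside S)" "open (outside S)"
  shows "E \<subseteq> inside S \<or> E \<subseteq> outside S"
proof -
  have "E \<subseteq> inside S \<union> outside S" using assms(2) by auto
  moreover have "inside S \<inter> outside S \<inter> E = {}" by auto
  ultimately show ?thesis
    using connectedD[OF assms(1,3,4)] by blast
qed

lemma closure_arc_endless:
  fixes c :: "real \<Rightarrow> complex"
  assumes "arc c"
  shows "path_image c \<subseteq> closure (path_image c - {pathstart c, pathfinish c})"
proof -
  have inj: "inj_on c {0..1}" and cont: "continuous_on {0..1} c"
    using assms by (auto simp: arc_def path_def)
  have "c ` {0<..<1} \<subseteq> path_image c - {pathstart c, pathfinish c}"
  proof
    fix y assume "y \<in> c ` {0<..<1}"
    then obtain t where t: "t \<in> {0<..<1}" "y = c t" by auto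
    have "c t \<noteq> c 0" "c t \<noteq> c 1"
      using inj_onD[OF inj, of t 0] inj_onD[OF inj, of t 1] t by auto
    then show "y \<in> path_image c - {pathstart c, pathfinish c}"
      using t by (auto simp: path_image_def pathstart_def pathfinish_def)
  qed
  moreover have "c ` closure {0<..<1} \<subseteq> closure (c ` {0<..<1})"
    by (rule image_closure_subset) (use cont in \<open>auto intro: closure_subset[THEN subsetD]\<close>)
  moreover have "closure {0<..<1::real} = {0..1}" by simp
  ultimately have "path_image c \<subseteq> closure (c ` {0<..<1})"
    by (simp add: path_image_def)
  also have "\<dots> \<subseteq> closure (path_image c - {pathstart c, pathfinish c})"
    by (rule closure_mono) fact
  finally show ?thesis .
qed

text \<open>If no arc lay inside the circle formed by the other two, a point inside the circle \<open>c2 \<union> c3\<close> would lie outside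
the other two circles. These meet in the arc \<open>c1\<close>, so by Janiszewski's theorem their union would not
separate the point from infinity; but this union contains \<open>c2 \<union> c3\<close>.\<close>

lemma theta_curve_inner_arc:
  fixes c1 c2 c3 :: "real \<Rightarrow> complex"
  assumes arc: "arc c1" "arc c2" "arc c3"
    and st: "pathstart c1 = a" "pathstart c2 = a" "pathstart c3 = a"
    and fi: "pathfinish c1 = b" "pathfinish c2 = b" "pathfinish c3 = b"
    and int: "path_image c1 \<inter> path_image c2 = {a, b}" "path_image c1 \<inter> path_image c3 = {a, b}"
      "path_image c2 \<inter> path_image c3 = {a, b}"
  shows "path_image c1 - {a, b} \<subseteq> inside (path_image c2 \<union> path_image c3) \<or>
    path_image c2 - {a, b} \<subseteq> inside (path_image c1 \<union> path_image c3) \<or>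
    path_image c3 - {a, b} \<subseteq> inside (path_image c1 \<union> path_image c2)"
proof (rule ccontr)
  assume neg: "\<not> ?thesis"
  define A B C where "A = path_image c1" and "B = path_image c2" and "C = path_image c3"
  note J12 = double_arc_Jordan[OF arc(1,2) st(1) fi(1) st(2) fi(2) int(1), folded A_def B_def]
  note J13 = double_arc_Jordan[OF arc(1,3) st(1) fi(1) st(3) fi(3) int(2), folded A_def C_def]
  note J23 = double_arc_Jordan[OF arc(2,3) st(2) fi(2) st(3) fi(3) int(3), folded B_def C_def]
  have conn: "connected (A - {a, b})" "connected (B - {a, b})" "connected (C - {a, b})"
    unfolding A_def B_def C_def
    using connected_simple_path_endless[OF arc_imp_simple_path] arc st fi by metis+
  have int': "A \<inter> B = {a, b}" "A \<inter> C = {a, b}" "B \<inter> C = {a, b}"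
    using int by (auto simp: A_def B_def C_def)
  have oA: "A - {a, b} \<subseteq> outside (B \<union> C)"
    using connected_inside_or_outside[OF conn(1) _ J23(3,6)] neg int'
    unfolding A_def[symmetric] B_def[symmetric] C_def[symmetric] by blast
  have oB: "B - {a, b} \<subseteq> outside (A \<union> C)"
    using connected_inside_or_outside[OF conn(2) _ J13(3,6)] neg int'
    unfolding A_def[symmetric] B_def[symmetric] C_def[symmetric] by blast
  have oC: "C - {a, b} \<subseteq> outside (A \<union> B)"
    using connected_inside_or_outside[OF conn(3) _ J12(3,6)] neg int'
    unfolding A_def[symmetric] B_def[symmetric] C_def[symmetric] by blast
  have ab: "a \<in> A" "b \<in> A" "a \<in> B" "b \<in> B" "a \<in> C" "b \<in> C" using int' by auto
  have nonempty: "B - {a, b} \<noteq> {}" "C - {a, b} \<noteq> {}"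
    using closure_arc_endless[OF arc(2)] closure_arc_endless[OF arc(3)] ab
    unfolding st fi B_def[symmetric] C_def[symmetric] by (metis closure_empty empty_iff subsetD)+
  have I23A: "inside (B \<union> C) \<inter> A = {}"
    using oA ab inside_Int_outside[of "B \<union> C"] inside_no_overlap[of "B \<union> C"] by blast
  have I23: "inside (B \<union> C) \<inter> (B \<union> C) = {}" by simp
  have apart: "inside (B \<union> C) \<subseteq> outside (A \<union> X)"
    if X: "X \<union> Y = B \<union> C" "compact (A \<union> X)" "open (inside (A \<union> X))" "open (outside (A \<union> X))"
      "Y - {a, b} \<subseteq> outside (A \<union> X)" "Y - {a, b} \<noteq> {}" for X Y
  proof (rule ccontr)
    assume "\<not> ?thesis"
    then have sub: "inside (B \<union> C) \<subseteq> inside (A \<union> X)"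
      using connected_inside_or_outside[OF J23(4) _ X(3,4)] I23A I23 X(1) by blast
    obtain e where e: "e \<in> Y - {a, b}" using X(6) by blast
    then have "e \<in> closure (inside (B \<union> C))"
      using J23(8) X(1) by (auto simp: frontier_def)
    then have "e \<in> (A \<union> X) \<union> inside (A \<union> X)"
      using closure_mono[OF sub] closure_inside_subset[OF compact_imp_closed[OF X(2)]] by blast
    then show False
      using e X(5) inside_Int_outside[of "A \<union> X"] outside_no_overlap[of "A \<union> X"] by blast
  qed
  have o12: "inside (B \<union> C) \<subseteq> outside (A \<union> B)"
    by (rule apart[OF _ J12(1,3,6) oC nonempty(2)]) blast
  have o13: "inside (B \<union> C) \<subseteq> outside (A \<union> C)"
    by (rule apart[OF _ J13(1,3,6) oB nonempty(1)]) blast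
  obtain p where p: "p \<in> inside (B \<union> C)" using J23(2) by auto
  have "compact ((A \<union> B) \<union> (A \<union> C))" using J12(1) J13(1) by (rule compact_Un)
  then have "outside ((A \<union> B) \<union> (A \<union> C)) \<noteq> {}"
    using outside_bounded_nonempty compact_imp_bounded by blast
  then obtain r where r: "r \<in> outside ((A \<union> B) \<union> (A \<union> C))" by auto
  have r': "r \<in> outside (A \<union> B)" "r \<in> outside (A \<union> C)" "r \<in> outside (B \<union> C)"
    using r outside_mono[of "A \<union> B" "(A \<union> B) \<union> (A \<union> C)"]
      outside_mono[of "A \<union> C" "(A \<union> B) \<union> (A \<union> C)"]
      outside_mono[of "B \<union> C" "(A \<union> B) \<union> (A \<union> C)"] by auto
  have cc: "connected_component (- (A \<union> B)) p r" "connected_component (- (A \<union> C)) p r"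
    unfolding connected_component_def
    using o12 o13 p r' J12(7) J13(7) outside_no_overlap by blast+
  have "(A \<union> B) \<inter> (A \<union> C) = A" using int' ab by blast
  then have "connected ((A \<union> B) \<inter> (A \<union> C))"
    using connected_arc_image[OF arc(1)] by (simp add: A_def)
  then have "connected_component (- ((A \<union> B) \<union> (A \<union> C))) p r"
    by (rule Janiszewski[OF J12(1) compact_imp_closed[OF J13(1)] _ cc])
  then have "connected_component (- (B \<union> C)) p r"
    by (rule connected_component_of_subset) auto
  then have "connected_component (- (B \<union> C)) r p" by (rule connected_component_sym)
  from outside_same_component[OF this r'(3)] p show False
    using inside_Int_outside[of "B \<union> C"] by blast
qed

text \<open>What a closed part \<open>S\<close> of a drawing \<open>D\<close> encloses is bounded away from the outer face.\<close>

lemma inside_misses_closure_outside: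
  fixes S D :: "complex set"
  assumes "closed S" "S \<subseteq> D" "v \<in> closure (outside D)"
  shows "v \<notin> inside S"
proof
  assume "v \<in> inside S"
  then have "inside S \<inter> outside D \<noteq> {}"
    using open_inside[OF assms(1)] assms(3) by (meson disjoint_iff open_Int_closure_eq_empty)
  then show False using outside_mono[OF assms(2)] inside_Int_outside[of S] by blast
qed

text \<open>The arcs \<open>A1\<close> to \<open>A4\<close> form a circle with chords \<open>X\<close> and \<open>Y\<close>. By the theta curve lemma both chords run inside the
circle, since otherwise an endpoint of the other chord would be enclosed. The chord \<open>X\<close> cuts the inside
in two halves and \<open>Y\<close> stays in one of them; the endpoint of \<open>Y\<close> that is not on the boundary of this half is
enclosed by it.\<close>

lemma crossing_chords_enclose_vertex:
  fixes A1 A2 A3 A4 X Y :: "real \<Rightarrow> complex"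
  assumes arc: "arc A1" "arc A2" "arc A3" "arc A4" "arc X" "arc Y"
    and st: "pathstart A1 = a" "pathstart A2 = b" "pathstart A3 = c" "pathstart A4 = d"
      "pathstart X = a" "pathstart Y = b"
    and fi: "pathfinish A1 = b" "pathfinish A2 = c" "pathfinish A3 = d" "pathfinish A4 = a"
      "pathfinish X = c" "pathfinish Y = d"
    and int: "path_image A1 \<inter> path_image A2 = {b}" "path_image A2 \<inter> path_image A3 = {c}"
      "path_image A3 \<inter> path_image A4 = {d}" "path_image A4 \<inter> path_image A1 = {a}"
      "path_image A1 \<inter> path_image A3 = {}" "path_image A2 \<inter> path_image A4 = {}"
      "path_image X \<inter> path_image A1 = {a}" "path_image X \<inter> path_image A2 = {c}"
      "path_image X \<inter> path_image A3 = {c}" "path_image X \<inter> path_image A4 = {a}"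
      "path_image Y \<inter> path_image A1 = {b}" "path_image Y \<inter> path_image A2 = {b}"
      "path_image Y \<inter> path_image A3 = {d}" "path_image Y \<inter> path_image A4 = {d}"
      "path_image X \<inter> path_image Y = {}"
    and D: "path_image A1 \<union> path_image A2 \<union> path_image A3 \<union> path_image A4 \<union> path_image X \<union>
      path_image Y \<subseteq> D"
    and outer: "{a, b, c, d} \<subseteq> closure (outside D)"
  shows False
proof -
  define P where "P = A1 +++ A2"
  define Q where "Q = reversepath (A3 +++ A4)"
  define R where "R = A2 +++ A3"
  define S where "S = reversepath (A4 +++ A1)"
  have arcs: "arc P" "arc Q" "arc R" "arc S"
    unfolding P_def Q_def R_def S_def
    using arc st fi int by (auto intro!: arc_join arc_reversepath)
  have ends: "pathstart P = a" "pathfinish P = c" "pathstart Q = a" "pathfinish Q = c"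
    "pathstart R = b" "pathfinish R = d" "pathstart S = b" "pathfinish S = d"
    unfolding P_def Q_def R_def S_def using st fi by auto
  have im: "path_image P = path_image A1 \<union> path_image A2" "path_image Q = path_image A3 \<union> path_image A4"
    "path_image R = path_image A2 \<union> path_image A3" "path_image S = path_image A4 \<union> path_image A1"
    unfolding P_def Q_def R_def S_def using st fi by (auto simp: path_image_join)
  define K where "K = path_image A1 \<union> path_image A2 \<union> path_image A3 \<union> path_image A4"
  have PQ: "path_image P \<union> path_image Q = K" "path_image R \<union> path_image S = K"
    unfolding im K_def by auto
  have abcd: "b \<in> path_image P" "d \<in> path_image Q" "c \<in> path_image R" "a \<in> path_image S"
    using im st pathstart_in_path_image[of A2] pathstart_in_path_image[of A4]
      pathstart_in_path_image[of A3] pathstart_in_path_image[of A1] by auto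
  have ne: "a \<noteq> b" "a \<noteq> c" "a \<noteq> d" "b \<noteq> c" "b \<noteq> d" "c \<noteq> d"
    using arc[THEN arc_distinct_ends] unfolding st fi by blast+
  note int' = int int[THEN trans[OF Int_commute]]
  have intX: "path_image P \<inter> path_image Q = {a, c}" "path_image X \<inter> path_image P = {a, c}"
    "path_image X \<inter> path_image Q = {a, c}"
    unfolding im by (simp_all add: Int_Un_distrib Int_Un_distrib2 int' insert_commute)
  have intY: "path_image R \<inter> path_image S = {b, d}" "path_image Y \<inter> path_image R = {b, d}"
    "path_image Y \<inter> path_image S = {b, d}"
    unfolding im by (simp_all add: Int_Un_distrib Int_Un_distrib2 int' insert_commute)
  have enclosed: "v \<notin> inside T" if "closed T" "T \<subseteq> D" "v \<in> {a, b, c, d}" for v T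
    using inside_misses_closure_outside[OF that(1,2)] that(3) outer by blast
  have closeds: "closed (path_image Z)" if "Z \<in> {P, Q, R, S, X, Y}" for Z
    using that arcs arc by (elim insertE emptyE) (simp_all add: closed_arc_image)
  have "path_image P \<subseteq> D" "path_image Q \<subseteq> D" "path_image R \<subseteq> D" "path_image S \<subseteq> D"
    "path_image X \<subseteq> D" "path_image Y \<subseteq> D"
    using D unfolding im by simp_all
  then have subD: "path_image Z \<subseteq> D" if "Z \<in> {P, Q, R, S, X, Y}" for Z
    using that by (elim insertE emptyE) simp_all
  have enclosed2: "v \<notin> inside (path_image Z \<union> path_image W)"
    if "Z \<in> {P, Q, R, S, X, Y}" "W \<in> {P, Q, R, S, X, Y}" "v \<in> {a, b, c, d}" for v Z W
    by (rule enclosed[OF closed_Un[OF closeds[OF that(1)] closeds[OF that(2)]] _ that(3)])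
      (use subD[OF that(1)] subD[OF that(2)] in blast)
  have X_in: "path_image X - {a, c} \<subseteq> inside K"
  proof -
    have out: "b \<notin> inside (path_image X \<union> path_image Q)" "d \<notin> inside (path_image X \<union> path_image P)"
      by (rule enclosed2; simp)+
    have mem: "b \<in> path_image P - {a, c}" "d \<in> path_image Q - {a, c}"
      using abcd(1,2) ne by simp_all
    from theta_curve_inner_arc[OF arc(5) arcs(1,2) st(5) ends(1,3) fi(5) ends(2,4) intX(2,3,1)]
    show ?thesis
      unfolding PQ by (elim disjE) (use out mem in \<open>auto dest: subsetD\<close>)
  qed
  have Y_in: "path_image Y - {b, d} \<subseteq> inside K"
  proof -
    have out: "c \<notin> inside (path_image Y \<union> path_image S)" "a \<notin> inside (path_image Y \<union> path_image R)"
      by (rule enclosed2; simp)+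
    have mem: "c \<in> path_image R - {b, d}" "a \<in> path_image S - {b, d}"
      using abcd(3,4) ne by auto
    from theta_curve_inner_arc[OF arc(6) arcs(3,4) st(6) ends(5,7) fi(6) ends(6,8) intY(2,3,1)]
    show ?thesis
      unfolding PQ by (elim disjE) (use out mem in \<open>auto dest: subsetD\<close>)
  qed
  have closX: "path_image X \<subseteq> closure (path_image X - {a, c})"
    and closY: "path_image Y \<subseteq> closure (path_image Y - {b, d})"
    using arc(5,6)[THEN closure_arc_endless] unfolding st fi .
  have "path_image X - {a, c} \<noteq> {}"
    using closX path_image_nonempty[of X] by (metis closure_empty subset_empty)
  then have ne12: "path_image X \<inter> inside (path_image P \<union> path_image Q) \<noteq> {}"
    using X_in unfolding PQ by blast
  obtain disj: "inside (path_image P \<union> path_image X) \<inter> inside (path_image Q \<union> path_image X) = {}"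
    and un: "inside (path_image P \<union> path_image X) \<union> inside (path_image Q \<union> path_image X) \<union>
      (path_image X - {a, c}) = inside (path_image P \<union> path_image Q)"
    using split_inside_simple_closed_curve[OF arc_imp_simple_path[OF arcs(1)] ends(1,2)
        arc_imp_simple_path[OF arcs(2)] ends(3,4) arc_imp_simple_path[OF arc(5)] st(5) fi(5) ne(2)
        intX(1) intX(2)[unfolded Int_commute[of "path_image X"]]
        intX(3)[unfolded Int_commute[of "path_image X"]] ne12] by blast
  have "connected (path_image Y - {b, d})"
    using connected_simple_path_endless[OF arc_imp_simple_path[OF arc(6)]] st fi by simp
  moreover have "path_image Y - {b, d} \<subseteq> inside (path_image P \<union> path_image X) \<union> inside (path_image Q \<union> path_image X)"
    using Y_in un int(15) unfolding PQ by blast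
  moreover have "open (inside (path_image P \<union> path_image X))" "open (inside (path_image Q \<union> path_image X))"
    by (intro open_inside closed_Un closeds; simp)+
  ultimately have "path_image Y - {b, d} \<subseteq> inside (path_image P \<union> path_image X) \<or>
    path_image Y - {b, d} \<subseteq> inside (path_image Q \<union> path_image X)"
    using connectedD[of "path_image Y - {b, d}" "inside (path_image P \<union> path_image X)"
        "inside (path_image Q \<union> path_image X)"] disj by blast
  moreover have "\<not> path_image Y - {b, d} \<subseteq> inside (path_image Z \<union> path_image X)"
    if Z: "Z \<in> {P, Q}" and v: "v \<in> {b, d}" "v \<notin> path_image Z" "v \<notin> path_image X" for Z v
  proof
    assume half: "path_image Y - {b, d} \<subseteq> inside (path_image Z \<union> path_image X)"
    have "v \<in> path_image Y"
      using v(1) pathstart_in_path_image[of Y] pathfinish_in_path_image[of Y] st(6) fi(6) by auto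
    then have "v \<in> closure (inside (path_image Z \<union> path_image X))"
      using closY closure_mono[OF half] by (meson subsetD)
    then have "v \<in> (path_image Z \<union> path_image X) \<union> inside (path_image Z \<union> path_image X)"
      using closure_inside_subset[OF closed_Un[OF closeds[of Z] closeds[of X]]] Z
      by (auto simp: subset_iff)
    moreover have "v \<notin> inside (path_image Z \<union> path_image X)"
      using v(1) Z by (intro enclosed2) auto
    ultimately show False using v(2,3) by blast
  qed
  moreover have "d \<notin> path_image P" "d \<notin> path_image X" "b \<notin> path_image Q" "b \<notin> path_image X"
    using abcd(1,2) intX ne by (auto dest: equalityD1)
  ultimately show False by (metis insertI1 insertI2)
qed

section \<open>Forbidden configurations in outerplanar graphs\<close>

abbreviation adj :: "'a pair_pre_digraph \<Rightarrow> 'a \<Rightarrow> 'a \<Rightarrow> bool" where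
  "adj G u v \<equiv> (u, v) \<in> parcs G"

fun path_edges :: "'a list \<Rightarrow> 'a set set" where
  "path_edges (u # v # l) = insert {u, v} (path_edges (v # l))"
| "path_edges _ = {}"

lemma path_edges_subset: "e \<in> path_edges l \<Longrightarrow> e \<subseteq> set l"
  by (induction l rule: path_edges.induct) auto

lemma path_edges_two: "e \<in> path_edges l \<Longrightarrow> distinct l \<Longrightarrow> card e = 2"
  by (induction l rule: path_edges.induct) auto

lemma path_edges_disjoint:
  assumes "distinct l" "set l \<inter> set m \<subseteq> {x}"
  shows "path_edges l \<inter> path_edges m = {}"
proof (rule ccontr)
  assume "\<not> ?thesis"
  then obtain e where e: "e \<in> path_edges l" "e \<in> path_edges m" by auto
  then have "e \<subseteq> {x}" using path_edges_subset[OF e(1)] path_edges_subset[OF e(2)] assms(2) by auto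
  then have "card e \<le> 1" using card_mono[of "{x}" e] by simp
  then show False using path_edges_two[OF e(1) assms(1)] by simp
qed

context
  fixes G :: "'a pair_pre_digraph" and p :: "'a \<Rightarrow> complex" and c :: "'a set \<Rightarrow> real \<Rightarrow> complex"
  assumes pair_graph: "pair_graph G" and drawing: "plane_drawing G p c"
begin

lemma adj_verts: "adj G u v \<Longrightarrow> u \<in> pverts G \<and> v \<in> pverts G"
  using pair_graph by (meson pair_graph.axioms(1) pair_digraph.axioms(1) pair_fin_digraph.axioms(1)
      pair_wf_digraph.in_arcsD1 pair_wf_digraph.in_arcsD2)

definition path_points :: "'a list \<Rightarrow> complex set" where
  "path_points l = (\<Union>e \<in> path_edges l. path_image (c e))"

lemma path_points_Cons: "path_points (u # v # l) = path_image (c {u, v}) \<union> path_points (v # l)"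
  by (auto simp: path_points_def)

lemma path_edges_arcs:
  "successively (adj G) l \<Longrightarrow> e \<in> path_edges l \<Longrightarrow> \<exists>u v. adj G u v \<and> e = {u, v} \<and> u \<in> set l \<and> v \<in> set l"
  by (induction l rule: path_edges.induct) fastforce+

lemma edge_ends: "adj G u v \<Longrightarrow> {p u, p v} \<subseteq> path_image (c {u, v})"
  using drawing unfolding plane_drawing_def by blast

lemma edges_meet:
  assumes "adj G u v" "adj G x y" "{u, v} \<noteq> {x, y}"
  shows "path_image (c {u, v}) \<inter> path_image (c {x, y}) \<subseteq> p ` ({u, v} \<inter> {x, y})"
  using drawing assms unfolding plane_drawing_def by blast

lemma path_points_verts:
  "successively (adj G) l \<Longrightarrow> 2 \<le> length l \<Longrightarrow> p ` set l \<subseteq> path_points l"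
proof (induction l rule: path_edges.induct)
  case (1 u v l)
  have "p u \<in> path_image (c {u, v})" "p v \<in> path_image (c {u, v})"
    using 1(2) edge_ends[of u v] by auto
  then show ?case
    using 1 by (cases l) (auto simp: path_points_Cons)
qed auto

lemma path_points_subset: "successively (adj G) l \<Longrightarrow> path_points l \<subseteq> drawing_points G p c"
  unfolding path_points_def drawing_points_def by (fastforce dest: path_edges_arcs)

lemma path_points_inter:
  assumes "successively (adj G) l" "successively (adj G) m" "path_edges l \<inter> path_edges m = {}"
    "2 \<le> length l" "2 \<le> length m"
  shows "path_points l \<inter> path_points m = p ` (set l \<inter> set m)"
proof
  show "path_points l \<inter> path_points m \<subseteq> p ` (set l \<inter> set m)"
  proof
    fix z assume "z \<in> path_points l \<inter> path_points m"
    then obtain e f where e: "e \<in> path_edges l" "z \<in> path_image (c e)"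
      and f: "f \<in> path_edges m" "z \<in> path_image (c f)"
      by (auto simp: path_points_def)
    obtain u v where uv: "adj G u v" "e = {u, v}" "u \<in> set l" "v \<in> set l"
      using path_edges_arcs[OF assms(1) e(1)] by blast
    obtain x y where xy: "adj G x y" "f = {x, y}" "x \<in> set m" "y \<in> set m"
      using path_edges_arcs[OF assms(2) f(1)] by blast
    have "{u, v} \<noteq> {x, y}" using e(1) f(1) assms(3) uv(2) xy(2) by auto
    then have "z \<in> p ` ({u, v} \<inter> {x, y})"
      using edges_meet[OF uv(1) xy(1)] e(2) f(2) uv(2) xy(2) by blast
    then show "z \<in> p ` (set l \<inter> set m)" using uv xy by auto
  qed
  show "p ` (set l \<inter> set m) \<subseteq> path_points l \<inter> path_points m"
    using path_points_verts[OF assms(1,4)] path_points_verts[OF assms(2,5)] by auto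
qed

lemma edge_arc:
  assumes "adj G u v"
  obtains g where "arc g" "pathstart g = p u" "pathfinish g = p v" "path_image g = path_image (c {u, v})"
proof -
  have a: "arc (c {u, v})" "{pathstart (c {u, v}), pathfinish (c {u, v})} = {p u, p v}"
    using drawing assms unfolding plane_drawing_def by blast+
  from a(2) consider "pathstart (c {u, v}) = p u" "pathfinish (c {u, v}) = p v"
    | "pathstart (c {u, v}) = p v" "pathfinish (c {u, v}) = p u"
    by (auto simp: doubleton_eq_iff)
  then show thesis
  proof cases
    case 1
    then show ?thesis using that a(1) by blast
  next
    case 2
    then show ?thesis using that[of "reversepath (c {u, v})"] a(1) by (simp add: arc_reversepath)
  qed
qed

lemma path_arc:
  "successively (adj G) l \<Longrightarrow> distinct l \<Longrightarrow> 2 \<le> length l \<Longrightarrow>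
    \<exists>g. arc g \<and> pathstart g = p (hd l) \<and> pathfinish g = p (last l) \<and> path_image g = path_points l"
proof (induction l rule: path_edges.induct)
  case (1 u v l)
  have uv: "adj G u v" using 1(2) by simp
  obtain g where g: "arc g" "pathstart g = p u" "pathfinish g = p v"
    "path_image g = path_image (c {u, v})" using edge_arc[OF uv] .
  show ?case
  proof (cases "l = []")
    case True
    then show ?thesis using g by (intro exI[of _ g]) (simp add: path_points_def)
  next
    case False
    then have len: "2 \<le> length (v # l)" by (cases l) auto
    have succ: "successively (adj G) (v # l)" "distinct (v # l)" using 1(2,3) by (auto simp: successively_Cons)
    obtain h where h: "arc h" "pathstart h = p v" "pathfinish h = p (last (v # l))"
      "path_image h = path_points (v # l)" using 1(1)[OF succ len] by auto
    have "path_edges [u, v] \<inter> path_edges (v # l) = {}"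
      using 1(3) by (intro path_edges_disjoint[where x = v]) auto
    then have "path_points [u, v] \<inter> path_points (v # l) = p ` (set [u, v] \<inter> set (v # l))"
      using path_points_inter[of "[u, v]" "v # l"] succ uv len by simp
    then have "path_image g \<inter> path_image h \<subseteq> {pathstart h}"
      using g(4) h 1(3) by (auto simp: path_points_def)
    then have "arc (g +++ h)" using g h by (intro arc_join) auto
    then show ?thesis
      using g h by (intro exI[of _ "g +++ h"]) (simp add: path_image_join path_points_Cons)
  qed
qed auto

lemma inj_drawing: "inj_on p (pverts G)"
  using drawing unfolding plane_drawing_def by blast

context
  assumes outer: "p ` pverts G \<subseteq> frontier (outside (drawing_points G p c))"
begin

lemma vertex_in_closure: "v \<in> pverts G \<Longrightarrow> p v \<in> closure (outside (drawing_points G p c))"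
  using outer by (auto simp: frontier_def)

text \<open>Three paths of length two from \<open>a\<close> to \<open>b\<close> form a theta curve; the middle vertex of its inner arc is enclosed.\<close>

lemma drawing_no_K23:
  assumes "distinct [a, b, x, y, z]"
    and "\<forall>w \<in> {x, y, z}. adj G a w \<and> adj G w b"
  shows False
proof -
  have V: "{a, b, x, y, z} \<subseteq> pverts G" using assms(2) adj_verts by blast
  let ?l = "\<lambda>w. [a, w, b]"
  have ne: "x \<noteq> y" "x \<noteq> z" "y \<noteq> z" "a \<noteq> b" using assms(1) by auto
  have w: "adj G a w" "adj G w b" "w \<noteq> a" "w \<noteq> b" "w \<in> pverts G" if "w \<in> {x, y, z}" for w
    using that assms V by auto
  have "\<exists>g. arc g \<and> pathstart g = p a \<and> pathfinish g = p b \<and> path_image g = path_points (?l w)"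
    if "w \<in> {x, y, z}" for w
    using path_arc[of "?l w"] w[OF that] ne by auto
  from this[of x] this[of y] this[of z] obtain g1 g2 g3 where g: "arc g1" "arc g2" "arc g3"
    "pathstart g1 = p a" "pathstart g2 = p a" "pathstart g3 = p a"
    "pathfinish g1 = p b" "pathfinish g2 = p b" "pathfinish g3 = p b"
    and im: "path_image g1 = path_points (?l x)" "path_image g2 = path_points (?l y)"
      "path_image g3 = path_points (?l z)" by auto
  have int: "path_points (?l w) \<inter> path_points (?l w') = {p a, p b}"
    if "w \<in> {x, y, z}" "w' \<in> {x, y, z}" "w \<noteq> w'" for w w'
  proof -
    have "path_edges (?l w) \<inter> path_edges (?l w') = {}"
      using w[OF that(1)] w[OF that(2)] that(3) ne by (auto simp: doubleton_eq_iff)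
    moreover have "set (?l w) \<inter> set (?l w') = {a, b}"
      using w[OF that(1)] w[OF that(2)] that(3) ne by auto
    ultimately show ?thesis
      using path_points_inter[of "?l w" "?l w'"] w[OF that(1)] w[OF that(2)] by simp
  qed
  have mid: "p w \<in> path_points (?l w) - {p a, p b}" if "w \<in> {x, y, z}" for w
  proof -
    have "p w \<in> path_points (?l w)"
      using path_points_verts[of "?l w"] w[OF that] by auto
    moreover have "p w \<noteq> p a" "p w \<noteq> p b"
      using inj_onD[OF inj_drawing, of w] V w[OF that] by auto
    ultimately show ?thesis by simp
  qed
  have out: "p w \<notin> inside (path_points (?l w1) \<union> path_points (?l w2))"
    if "w \<in> {x, y, z}" "w1 \<in> {x, y, z}" "w2 \<in> {x, y, z}" for w w1 w2
  proof (rule inside_misses_closure_outside)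
    show "path_points (?l w1) \<union> path_points (?l w2) \<subseteq> drawing_points G p c"
      using path_points_subset w[OF that(2)] w[OF that(3)] by (intro Un_least) simp_all
    show "p w \<in> closure (outside (drawing_points G p c))"
      using vertex_in_closure w[OF that(1)] by simp
    have "closed (path_points (?l w))" if "w \<in> {x, y, z}" for w
      using that im closed_arc_image[OF g(1)] closed_arc_image[OF g(2)] closed_arc_image[OF g(3)] by auto
    then show "closed (path_points (?l w1) \<union> path_points (?l w2))" using that by blast
  qed
  note theta = theta_curve_inner_arc[OF g, unfolded im,
    OF int[OF _ _ ne(1)] int[OF _ _ ne(2)] int[OF _ _ ne(3)], simplified]
  from theta mid[of x] mid[of y] mid[of z] out[of x y z] out[of y x z] out[of z x y]
  show False by blast
qed

lemma drawing_no_crossing_chords: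
  assumes "distinct ([v1] @ l1 @ [v2] @ l2 @ [v3] @ l3 @ [v4])"
    and "successively (adj G) ([v1] @ l1 @ [v2] @ l2 @ [v3] @ l3 @ [v4])"
    and "adj G v4 v1" "adj G v1 v3" "adj G v2 v4"
  shows False
proof -
  define m1 m2 m3 m4 mX mY where m: "m1 = [v1] @ l1 @ [v2]" "m2 = [v2] @ l2 @ [v3]"
    "m3 = [v3] @ l3 @ [v4]" "m4 = [v4, v1]" "mX = [v1, v3]" "mY = [v2, v4]"
  have "successively (adj G) m1"
    using assms(2) successively_append_iff[of "adj G" m1 "l2 @ [v3] @ l3 @ [v4]"] by (simp add: m)
  moreover have rest: "successively (adj G) ([v2] @ l2 @ [v3] @ l3 @ [v4])"
    using assms(2) successively_append_iff[of "adj G" "[v1] @ l1" "[v2] @ l2 @ [v3] @ l3 @ [v4]"] by simp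
  moreover have "successively (adj G) m2"
    using rest successively_append_iff[of "adj G" m2 "l3 @ [v4]"] by (simp add: m)
  moreover have "successively (adj G) m3"
    using rest successively_append_iff[of "adj G" "[v2] @ l2" m3] by (simp add: m)
  ultimately have succ: "successively (adj G) m1" "successively (adj G) m2" "successively (adj G) m3"
    "successively (adj G) m4" "successively (adj G) mX" "successively (adj G) mY"
    using assms(3-5) by (simp_all add: m)
  have dist: "distinct m1" "distinct m2" "distinct m3" "distinct m4" "distinct mX" "distinct mY"
    using assms(1) unfolding m by auto
  have len: "2 \<le> length m1" "2 \<le> length m2" "2 \<le> length m3" "2 \<le> length m4" "2 \<le> length mX"
    "2 \<le> length mY" unfolding m by auto
  note arcs = path_arc[OF succ(1) dist(1) len(1)] path_arc[OF succ(2) dist(2) len(2)]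
    path_arc[OF succ(3) dist(3) len(3)] path_arc[OF succ(4) dist(4) len(4)]
    path_arc[OF succ(5) dist(5) len(5)] path_arc[OF succ(6) dist(6) len(6)]
  obtain A1 A2 A3 A4 X Y where
    A: "arc A1" "arc A2" "arc A3" "arc A4" "arc X" "arc Y"
    and st: "pathstart A1 = p (hd m1)" "pathstart A2 = p (hd m2)" "pathstart A3 = p (hd m3)"
      "pathstart A4 = p (hd m4)" "pathstart X = p (hd mX)" "pathstart Y = p (hd mY)"
    and fi: "pathfinish A1 = p (last m1)" "pathfinish A2 = p (last m2)" "pathfinish A3 = p (last m3)"
      "pathfinish A4 = p (last m4)" "pathfinish X = p (last mX)" "pathfinish Y = p (last mY)"
    and im: "path_image A1 = path_points m1" "path_image A2 = path_points m2"
      "path_image A3 = path_points m3" "path_image A4 = path_points m4"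
      "path_image X = path_points mX" "path_image Y = path_points mY"
    using arcs by blast
  have ends: "hd m1 = v1" "hd m2 = v2" "hd m3 = v3" "hd m4 = v4" "hd mX = v1" "hd mY = v2"
    "last m1 = v2" "last m2 = v3" "last m3 = v4" "last m4 = v1" "last mX = v3" "last mY = v4"
    unfolding m by simp_all
  have sets: "set m1 \<inter> set m2 = {v2}" "set m2 \<inter> set m3 = {v3}" "set m3 \<inter> set m4 = {v4}"
    "set m4 \<inter> set m1 = {v1}" "set m1 \<inter> set m3 = {}" "set m2 \<inter> set m4 = {}"
    "set mX \<inter> set m1 = {v1}" "set mX \<inter> set m2 = {v3}" "set mX \<inter> set m3 = {v3}"
    "set mX \<inter> set m4 = {v1}" "set mY \<inter> set m1 = {v2}" "set mY \<inter> set m2 = {v2}"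
    "set mY \<inter> set m3 = {v4}" "set mY \<inter> set m4 = {v4}" "set mX \<inter> set mY = {}"
    using assms(1) unfolding m by auto
  have single: "path_points l \<inter> path_points l' = {p v}"
    if "successively (adj G) l" "successively (adj G) l'" "distinct l" "set l \<inter> set l' = {v}"
      "2 \<le> length l" "2 \<le> length l'" for l l' v
    using path_points_inter[OF that(1,2) path_edges_disjoint[OF that(3)] that(5,6), of v] that(4) by auto
  have empty: "path_points l \<inter> path_points l' = {}"
    if "successively (adj G) l" "successively (adj G) l'" "distinct l" "set l \<inter> set l' = {}"
      "2 \<le> length l" "2 \<le> length l'" for l l'
    using path_points_inter[OF that(1,2) path_edges_disjoint[OF that(3)] that(5,6)] that(4) by auto
  have "{v1, v2, v3, v4} \<subseteq> pverts G" using assms(3-5) adj_verts by blast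
  then have outs: "{p v1, p v2, p v3, p v4} \<subseteq> closure (outside (drawing_points G p c))"
    using vertex_in_closure by auto
  have sub: "path_points m1 \<union> path_points m2 \<union> path_points m3 \<union> path_points m4 \<union> path_points mX \<union>
    path_points mY \<subseteq> drawing_points G p c"
    using succ by (intro Un_least path_points_subset)
  show False
    by (rule crossing_chords_enclose_vertex[OF A st[unfolded ends] fi[unfolded ends], unfolded im])
      (rule single empty outs sub succ dist sets len)+
qed

end

end

lemma outerplanar_no_K23:
  assumes "pair_graph G" "outerplanar G" "distinct [a, b, x, y, z]"
    "adj G a x" "adj G a y" "adj G a z" "adj G x b" "adj G y b" "adj G z b"
  shows False
  using assms(2) drawing_no_K23[OF assms(1) _ _ assms(3)] assms(4-) unfolding outerplanar_def by blast

lemma outerplanar_no_crossing_chords: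
  assumes "pair_graph G" "outerplanar G"
    and "distinct ([v1] @ l1 @ [v2] @ l2 @ [v3] @ l3 @ [v4])"
    and "successively (adj G) ([v1] @ l1 @ [v2] @ l2 @ [v3] @ l3 @ [v4])"
    and "adj G v4 v1" "adj G v1 v3" "adj G v2 v4"
  shows False
  using assms(2) drawing_no_crossing_chords[OF assms(1) _ _ assms(3-)] unfolding outerplanar_def by blast

section \<open>Sparsity and neighbourhoods\<close>

text \<open>The two forbidden configurations are all that the spectral argument uses of a drawing. A cycle with two
crossing chords is a subdivision of \<open>K\<^sub>4\<close>.\<close>

locale outerplanar_relation =
  fixes E :: "'a \<Rightarrow> 'a \<Rightarrow> bool"
  assumes sym: "E u v \<Longrightarrow> E v u"
    and irrefl: "\<not> E v v"
    and no_K23: "distinct [a, b, x, y, z] \<Longrightarrow> E a x \<Longrightarrow> E a y \<Longrightarrow> E a z \<Longrightarrow>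
      E x b \<Longrightarrow> E y b \<Longrightarrow> E z b \<Longrightarrow> False"
    and no_crossing_chords: "distinct ([v1] @ l1 @ [v2] @ l2 @ [v3] @ l3 @ [v4]) \<Longrightarrow>
      successively E ([v1] @ l1 @ [v2] @ l2 @ [v3] @ l3 @ [v4]) \<Longrightarrow>
      E v4 v1 \<Longrightarrow> E v1 v3 \<Longrightarrow> E v2 v4 \<Longrightarrow> False"

definition path_in :: "('a \<Rightarrow> 'a \<Rightarrow> bool) \<Rightarrow> 'a set \<Rightarrow> 'a list \<Rightarrow> bool" where
  "path_in E S l \<longleftrightarrow> l \<noteq> [] \<and> distinct l \<and> set l \<subseteq> S \<and> successively E l"

definition longest_path_in :: "('a \<Rightarrow> 'a \<Rightarrow> bool) \<Rightarrow> 'a set \<Rightarrow> 'a list \<Rightarrow> bool" where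
  "longest_path_in E S l \<longleftrightarrow> path_in E S l \<and> (\<forall>l'. path_in E S l' \<longrightarrow> length l' \<le> length l)"

lemma path_in_length: "finite S \<Longrightarrow> path_in E S l \<Longrightarrow> length l \<le> card S"
  unfolding path_in_def by (metis card_mono distinct_card)

lemma longest_path_exists:
  assumes "finite S" "S \<noteq> {}"
  shows "\<exists>l. longest_path_in E S l"
proof -
  obtain v where "v \<in> S" using assms by auto
  then have "path_in E S [v]" by (simp add: path_in_def)
  then obtain l where "path_in E S l" "\<forall>l'. path_in E S l' \<longrightarrow> length l' \<le> length l"
    using ex_has_greatest_nat[of "path_in E S" "[v]" length "Suc (card S)"] path_in_length[OF assms(1)]
    by (auto simp: less_Suc_eq_le)
  then show ?thesis by (auto simp: longest_path_in_def)
qed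

lemma longest_path_hd_closed:
  assumes "longest_path_in E S l" "E w (hd l)" "w \<in> S"
  shows "w \<in> set l"
proof (rule ccontr)
  assume "w \<notin> set l"
  then have "path_in E S (w # l)"
    using assms unfolding longest_path_in_def path_in_def by (cases l) auto
  then show False using assms unfolding longest_path_in_def by fastforce
qed

lemma successively_nth: "successively E l \<Longrightarrow> Suc k < length l \<Longrightarrow> E (l ! k) (l ! Suc k)"
  by (simp add: successively_conv_nth)

lemma successively_map_upt:
  assumes "successively E l" "b \<le> length l"
  shows "successively E (map ((!) l) [a..<b])"
  using assms by (auto simp: successively_conv_nth)

context outerplanar_relation
begin

lemma sym_iff: "E u v \<longleftrightarrow> E v u"
  using sym by blast

lemma successively_rev_sym: "successively E (rev l) \<longleftrightarrow> successively E l"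
proof -
  have eq: "(\<lambda>x y. E y x) = E" by (intro ext) (rule sym_iff)
  show ?thesis by (rule trans[OF successively_rev arg_cong[OF eq, where f = "\<lambda>R. successively R l"]])
qed

text \<open>The initial segment up to \<open>i - 1\<close>, the edge to \<open>m\<close>, and the way back along the path down to \<open>i\<close> close up to
a cycle by the edge from \<open>i\<close> to \<open>0\<close>. In this cycle the chords \<open>0 j\<close> and \<open>(i - 1) i\<close> cross.\<close>

lemma path_no_crossing:
  assumes l: "distinct l" "successively E l"
    and ij: "2 \<le> i" "i < j" "j \<le> m" "m < length l"
    and E: "E (l ! 0) (l ! i)" "E (l ! 0) (l ! j)" "E (l ! (i - 1)) (l ! m)"
  shows False
proof -
  let ?f = "(!) l"
  define l1 where "l1 = map ?f [1..<i - 1]"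
  define l2 where "l2 = rev (map ?f [Suc j..<Suc m])"
  define l3 where "l3 = rev (map ?f [Suc i..<j])"
  let ?c = "[?f 0] @ l1 @ [?f (i - 1)] @ l2 @ [?f j] @ l3 @ [?f i]"
  obtain k where k: "i = Suc (Suc k)" using ij(1) by (metis Suc_le_D numeral_2_eq_2 Suc_le_mono)
  have 1: "[0..<i] = [0] @ [1..<i - 1] @ [i - 1]"
    using upt_conv_Cons[of 0 "Suc k"] by (simp add: k)
  have 2: "[i..<Suc m] = [i] @ [Suc i..<j] @ [j] @ [Suc j..<Suc m]"
    using upt_add_eq_append[of i j "Suc m - j"] ij upt_conv_Cons[of i j] upt_conv_Cons[of j "Suc m"]
    by (simp del: upt_Suc)
  have c: "?c = map ?f [0..<i] @ rev (map ?f [i..<Suc m])"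
    unfolding 1 2 l1_def l2_def l3_def by simp
  have inj: "inj_on ?f {0..<length l}" using l(1) by (auto simp: inj_on_def nth_eq_iff_index_eq)
  have "distinct ?c"
    unfolding c using ij
    by (auto simp: distinct_map dest: inj_onD[OF inj] simp del: upt_Suc intro!: inj_on_subset[OF inj])
  moreover have "successively E ?c"
    unfolding c successively_append_iff successively_rev_sym
    using ij E successively_map_upt[OF l(2)] by (auto simp: last_map hd_rev last_conv_nth simp del: upt_Suc)
  moreover have "E (?f (i - 1)) (?f i)"
    using successively_nth[OF l(2), of "i - 1"] ij by simp
  ultimately show False
    using no_crossing_chords[of "?f 0" l1 "?f (i - 1)" l2 "?f j" l3 "?f i"] E(1,2) sym by blast
qed

text \<open>Suppose that all degrees are at least three. All neighbours of the first vertex of a longest path lie on the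
path. Take a longest path and a chord from its first vertex to \<open>l ! i\<close> with \<open>i\<close> as small as possible.
Reversing the segment before \<open>l ! i\<close> gives another longest path, which starts at \<open>l ! (i - 1)\<close>. By minimality both starting vertices
have a further neighbour beyond \<open>i\<close>, which produces two crossing chords.\<close>

lemma degree_le_2_exists:
  assumes fin: "finite S" and ne: "S \<noteq> {}"
  shows "\<exists>v \<in> S. card {w \<in> S. E v w} \<le> 2"
proof (rule ccontr)
  assume "\<not> ?thesis"
  then have deg: "3 \<le> card {w \<in> S. E v w}" if "v \<in> S" for v
    using that by (auto simp: not_le)
  have third: "\<exists>j. 2 \<le> j \<and> j \<noteq> i \<and> j < length l \<and> E (l ! 0) (l ! j)" if "longest_path_in E S l" for l i
  proof (rule ccontr)
    assume neg: "\<not> ?thesis"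
    have l: "l \<noteq> []" "set l \<subseteq> S" using that by (auto simp: longest_path_in_def path_in_def)
    have "{w \<in> S. E (l ! 0) w} \<subseteq> {l ! 1, l ! i}"
    proof
      fix w assume w: "w \<in> {w \<in> S. E (l ! 0) w}"
      then have "w \<in> set l" using longest_path_hd_closed[OF that, of w] sym_iff l(1) by (simp add: hd_conv_nth)
      then obtain j where j: "j < length l" "w = l ! j" by (auto simp: in_set_conv_nth)
      then have "j \<noteq> 0" using w irrefl[of "l ! 0"] j by (intro notI) simp
      then have "j = 1 \<or> j = i" using neg j w by force
      then show "w \<in> {l ! 1, l ! i}" using j by auto
    qed
    then have "card {w \<in> S. E (l ! 0) w} \<le> card {l ! 1, l ! i}" by (intro card_mono) auto
    also have "\<dots> \<le> 2" by (simp add: card_insert_if)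
    finally have "card {w \<in> S. E (l ! 0) w} \<le> 2" .
    moreover have "l ! 0 \<in> S" using l by (simp add: subset_iff)
    ultimately show False using deg[of "l ! 0"] by simp
  qed
  define I where "I i \<longleftrightarrow> (\<exists>l. longest_path_in E S l \<and> 2 \<le> i \<and> i < length l \<and> E (l ! 0) (l ! i))" for i
  obtain l0 where "longest_path_in E S l0" using longest_path_exists[OF fin ne] by auto
  then have "\<exists>i. I i" using third[of l0] unfolding I_def by blast
  then obtain i where "I i" and least: "\<And>j. I j \<Longrightarrow> i \<le> j"
    by (metis LeastI Least_le)
  then obtain l where l: "longest_path_in E S l" "2 \<le> i" "i < length l" "E (l ! 0) (l ! i)"
    unfolding I_def by blast
  have path: "distinct l" "successively E l" "set l \<subseteq> S"
    using l(1) by (auto simp: longest_path_in_def path_in_def)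
  define l' where "l' = rev (take i l) @ drop i l"
  have len: "length l' = length l" using l(3) by (simp add: l'_def)
  have nth_lo: "l' ! k = l ! (i - 1 - k)" if "k < i" for k
    using that l(3) by (simp add: l'_def nth_append rev_nth)
  have nth_hi: "l' ! k = l ! k" if "i \<le> k" "k < length l" for k
    using that l(3) by (simp add: l'_def nth_append)
  have "set l' = set l" unfolding l'_def by (metis append_take_drop_id set_append set_rev)
  moreover have dist': "distinct l'"
    using path(1) unfolding l'_def by (metis append_take_drop_id distinct_append distinct_rev set_rev)
  moreover have succ': "successively E l'"
  proof -
    have "successively E (take i l @ drop i l)" using path(2) by simp
    then have "successively E (take i l)" "successively E (drop i l)"
      unfolding successively_append_iff by auto
    moreover have "last (rev (take i l)) = l ! 0" "hd (drop i l) = l ! i"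
      using l(2,3) hd_conv_nth[of l] by (cases l; simp add: last_rev hd_drop_conv_nth hd_take)+
    ultimately show ?thesis
      unfolding l'_def successively_append_iff successively_rev_sym using l(4) by simp
  qed
  ultimately have long': "longest_path_in E S l'"
    using l(1) len l(3) unfolding longest_path_in_def path_in_def by auto
  obtain j where j: "2 \<le> j" "j \<noteq> i" "j < length l" "E (l ! 0) (l ! j)"
    using third[OF l(1)] by blast
  have "i \<le> j" using j l(1) by (intro least) (auto simp: I_def)
  then have ij: "i < j" using j(2) by simp
  obtain m where m: "2 \<le> m" "m \<noteq> i" "m < length l" "E (l' ! 0) (l' ! m)"
    using third[OF long', of i] len by auto
  have "i \<le> m" using m long' len by (intro least) (auto simp: I_def)
  then have im: "i < m" using m(2) by simp
  have Em: "E (l ! (i - 1)) (l ! m)" using m im nth_lo[of 0] nth_hi[of m] l(2) by simp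
  show False
  proof (cases "j \<le> m")
    case True
    then show False using path_no_crossing[OF path(1,2) l(2) ij True m(3) l(4) j(4) Em] by simp
  next
    case False
    have "E (l' ! 0) (l' ! i)"
      using nth_lo[of 0] nth_hi[of i] l(2,3) successively_nth[OF path(2), of "i - 1"] by simp
    moreover have "E (l' ! 0) (l' ! m)" by fact
    moreover have "E (l' ! (i - 1)) (l' ! j)"
      using nth_lo[of "i - 1"] nth_hi[of j] l(2) ij j by simp
    ultimately show False
      using path_no_crossing[OF dist' succ' l(2) im, of j] False j(3) len by simp
  qed
qed

text \<open>Vertices of degree at most two are removed one by one; each removal destroys at most two edges, that is,
four ordered pairs.\<close>

lemma arcs_le:
  "finite S \<Longrightarrow> (\<Sum>v \<in> S. card {w \<in> S. E v w}) \<le> 4 * card S"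
proof (induction "card S" arbitrary: S)
  case (Suc n)
  then have "S \<noteq> {}" by auto
  then obtain v where v: "v \<in> S" "card {w \<in> S. E v w} \<le> 2"
    using degree_le_2_exists[OF Suc(3)] by auto
  let ?T = "S - {v}"
  have fin: "finite ?T" and card: "card ?T = n" using Suc v by auto
  have T: "(\<Sum>u \<in> ?T. card {w \<in> ?T. E u w}) \<le> 4 * n" using Suc(1)[of ?T] card fin by auto
  have "card {w \<in> S. E u w} = card {w \<in> ?T. E u w} + (if E u v then 1 else 0)" for u
  proof -
    have "{w \<in> S. E u w} = {w \<in> ?T. E u w} \<union> (if E u v then {v} else {})" using v(1) by auto
    then show ?thesis using fin by (simp add: card_insert_if)
  qed
  then have "(\<Sum>u \<in> ?T. card {w \<in> S. E u w}) = (\<Sum>u \<in> ?T. card {w \<in> ?T. E u w}) + (\<Sum>u \<in> ?T. if E u v then 1 else 0)"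
    by (simp add: sum.distrib)
  also have "(\<Sum>u \<in> ?T. if E u v then 1 else 0) = card {u \<in> ?T. E u v}"
    using fin by (simp add: sum.If_cases Int_def)
  also have "card {u \<in> ?T. E u v} \<le> card {w \<in> S. E v w}"
    using Suc(3) by (intro card_mono) (auto intro: sym)
  finally have "(\<Sum>u \<in> ?T. card {w \<in> S. E u w}) \<le> 4 * n + 2" using T v(2) by linarith
  moreover have "(\<Sum>u \<in> S. card {w \<in> S. E u w}) = card {w \<in> S. E v w} + (\<Sum>u \<in> ?T. card {w \<in> S. E u w})"
    using Suc(3) v(1) by (rule sum.remove)
  ultimately show ?case using v(2) Suc(2) by linarith
qed auto

lemma common_neighbours_le_2:
  assumes "finite S" "v \<noteq> z"
  shows "card {w \<in> S. E z w \<and> E v w} \<le> 2"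
proof (rule ccontr)
  assume "\<not> ?thesis"
  then have "3 \<le> card {w \<in> S. E z w \<and> E v w}" by simp
  then obtain T where T: "T \<subseteq> {w \<in> S. E z w \<and> E v w}" "card T = 3"
    by (meson obtain_subset_with_card_n)
  then obtain x y w where "T = {x, y, w}" "x \<noteq> y" "x \<noteq> w" "y \<noteq> w" by (auto simp: card_3_iff)
  then show False
    using T(1) assms(2) irrefl no_K23[of z v x y w] sym_iff by auto
qed

text \<open>Rerouting the cycle \<open>c0 c1 c2 \<dots>\<close> through \<open>z\<close> between \<open>c2\<close> and \<open>c1\<close> gives a cycle with the crossing
chords \<open>c1 c2\<close> and \<open>c0 z\<close>.\<close>

lemma no_wheel:
  assumes "distinct l" "3 \<le> length l" "successively E l" "E (last l) (hd l)" "\<forall>v \<in> set l. E z v"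
  shows False
proof -
  obtain c0 c1 c2 mid where l: "l = c0 # c1 # c2 # mid"
    using assms(2) by (metis (no_types) Suc_le_length_iff numeral_3_eq_3)
  have z: "z \<notin> set l" using assms(5) irrefl by auto
  let ?c = "[c1] @ [] @ [c0] @ rev mid @ [c2] @ [] @ [z]"
  have "distinct ?c" using assms(1) z l by auto
  moreover have "successively E ?c"
  proof (cases mid)
    case Nil
    then show ?thesis using assms(3-5) l sym_iff by (auto simp: successively_Cons)
  next
    case (Cons a t)
    have "successively E (c2 # mid)" using assms(3) l by simp
    then have "successively E (rev (c2 # mid))" unfolding successively_rev_sym .
    moreover have "E c1 c0" "E c0 (last mid)" "E c2 z" using assms(3-5) l sym_iff Cons by auto
    moreover have "hd (rev mid @ [c2]) = last mid" using Cons by (simp add: hd_append hd_rev)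
    moreover have "rev mid \<noteq> []" using Cons by simp
    ultimately show ?thesis
      unfolding append.simps successively_Cons
      by (auto simp: successively_append_iff hd_append successively_Cons)
  qed
  moreover have "E z c1" "E c1 c2" "E c0 z" using assms(3,5) l sym_iff by auto
  ultimately show False using no_crossing_chords by blast
qed

end

definition consecutive_in :: "'a list \<Rightarrow> 'a \<Rightarrow> 'a \<Rightarrow> bool" where
  "consecutive_in l u v \<longleftrightarrow> (\<exists>k. Suc k < length l \<and> (u = l ! k \<and> v = l ! Suc k \<or> v = l ! k \<and> u = l ! Suc k))"

lemma consecutive_in_appendI1: "consecutive_in l u v \<Longrightarrow> consecutive_in (l @ m) u v"
  unfolding consecutive_in_def by (force simp: nth_append)

lemma consecutive_in_appendI2: "consecutive_in m u v \<Longrightarrow> consecutive_in (l @ m) u v"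
  unfolding consecutive_in_def
  by (elim exE, rule_tac x = "length l + k" in exI) (auto simp: nth_append)

lemma consecutive_in_rev: "consecutive_in (rev l) u v \<Longrightarrow> consecutive_in l u v"
proof -
  assume "consecutive_in (rev l) u v"
  then obtain k where k: "Suc k < length l"
    "u = rev l ! k \<and> v = rev l ! Suc k \<or> v = rev l ! k \<and> u = rev l ! Suc k"
    by (auto simp: consecutive_in_def)
  define j where "j = length l - Suc (Suc k)"
  have "Suc j < length l" "rev l ! k = l ! Suc j" "rev l ! Suc k = l ! j"
    using k(1) by (auto simp: j_def rev_nth Suc_diff_Suc)
  then show ?thesis using k(2) unfolding consecutive_in_def by (intro exI[of _ j]) auto
qed

text \<open>A longest path is a whole component: the two edges along the path use up the degree of its inner
vertices, and its ends have no neighbours outside the path and none on it that would close a cycle. The rest is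
enumerated by induction.\<close>

lemma linear_forest_enumeration:
  assumes "finite U" "\<And>u v. L u v \<Longrightarrow> L v u" "\<And>v. \<not> L v v"
    and "\<And>v. v \<in> U \<Longrightarrow> card {w \<in> U. L v w} \<le> 2"
    and "\<And>l. distinct l \<Longrightarrow> set l \<subseteq> U \<Longrightarrow> 3 \<le> length l \<Longrightarrow> successively L l \<Longrightarrow> L (last l) (hd l) \<Longrightarrow> False"
  shows "\<exists>l. distinct l \<and> set l = U \<and> (\<forall>u \<in> U. \<forall>v \<in> U. L u v \<longrightarrow> consecutive_in l u v)"
  using assms
proof (induction "card U" arbitrary: U rule: less_induct)
  case less
  note sym = less.prems(2) and irrefl = less.prems(3) and deg = less.prems(4) and acyclic = less.prems(5)
  have symi: "L u v \<longleftrightarrow> L v u" for u v using sym by blast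
  show ?case
  proof (cases "U = {}")
    case False
    obtain p where p: "longest_path_in L U p" using longest_path_exists[OF less.prems(1) False] by blast
    then have path: "p \<noteq> []" "distinct p" "set p \<subseteq> U" "successively L p"
      by (auto simp: longest_path_in_def path_in_def)
    have prev: "longest_path_in L U (rev p)"
    proof -
      have "(\<lambda>x y. L y x) = L" by (intro ext) (rule symi)
      then have "successively L (rev p)" using path(4) successively_rev[of L p] by metis
      then show ?thesis using p path by (auto simp: longest_path_in_def path_in_def)
    qed
    have two: False if "v \<in> U" "a \<in> U" "b \<in> U" "c \<in> U" "L v a" "L v b" "L v c" "a \<noteq> b" "a \<noteq> c" "b \<noteq> c" for v a b c
    proof -
      have "card {a, b, c} \<le> card {w \<in> U. L v w}" using that less.prems(1) by (intro card_mono) auto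
      then show False using deg[OF that(1)] that by simp
    qed
    have first: "consecutive_in r (r ! 0) v" if r: "longest_path_in L U r" and v: "v \<in> U" "L (r ! 0) v" for r v
    proof -
      have path: "r \<noteq> []" "distinct r" "set r \<subseteq> U" "successively L r"
        using r by (auto simp: longest_path_in_def path_in_def)
      have "v \<in> set r" using longest_path_hd_closed[OF r, of v] v symi path(1) by (simp add: hd_conv_nth)
      then obtain j where j: "j < length r" "v = r ! j" by (auto simp: in_set_conv_nth)
      have "j \<noteq> 0" using j v(2) irrefl[of "r ! 0"] by (intro notI) simp
      then consider "j = 1" | "2 \<le> j" by linarith
      then show ?thesis
      proof cases
        case 1
        then show ?thesis unfolding consecutive_in_def using j by (intro exI[of _ 0]) auto
      next
        case 2
        have "Suc j \<noteq> length r"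
        proof
          assume last: "Suc j = length r"
          then have "L (last r) (hd r)"
            using j v(2) path(1) sym by (metis diff_Suc_1 hd_conv_nth last_conv_nth)
          moreover have "3 \<le> length r" using last 2 by simp
          ultimately show False using acyclic[OF path(2,3) _ path(4)] by blast
        qed
        then have j': "Suc j < length r" using j by simp
        have "L (r ! j) (r ! (j - 1))" "L (r ! j) (r ! Suc j)" "L (r ! j) (r ! 0)"
          using successively_nth[OF path(4), of "j - 1"] successively_nth[OF path(4), of j] 2 j' symi j v(2)
          by auto
        moreover have "r ! (j - 1) \<noteq> r ! Suc j" "r ! (j - 1) \<noteq> r ! 0" "r ! Suc j \<noteq> r ! 0"
          using path(1,2) j' 2 by (simp_all add: nth_eq_iff_index_eq)
        moreover have "r ! (j - 1) \<in> U" "r ! Suc j \<in> U" "r ! 0 \<in> U" "r ! j \<in> U"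
          using path(1,3) j' by (auto simp: subset_iff)
        ultimately show ?thesis using two by blast
      qed
    qed
    have comp: "consecutive_in p u v" if uv: "u \<in> set p" "v \<in> U" "L u v" for u v
    proof -
      obtain k where k: "k < length p" "u = p ! k" using uv(1) by (auto simp: in_set_conv_nth)
      consider "k = 0" | "Suc k = length p" | "0 < k" "Suc k < length p" using k(1) by linarith
      then show ?thesis
      proof cases
        case 1
        then show ?thesis using first[OF p uv(2)] uv(3) k(2) by simp
      next
        case 2
        then have "rev p ! 0 = u" using k path(1) by (simp add: rev_nth flip: 2)
        then show ?thesis using first[OF prev uv(2)] uv(3) consecutive_in_rev by simp
      next
        case 3
        have a: "L (p ! k) (p ! (k - 1))" "L (p ! k) (p ! Suc k)"
          using successively_nth[OF path(4), of "k - 1"] successively_nth[OF path(4), of k] 3 symi by auto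
        have ne: "p ! (k - 1) \<noteq> p ! Suc k" using path(2) 3 by (simp add: nth_eq_iff_index_eq)
        have "p ! (k - 1) \<in> U" "p ! Suc k \<in> U" "p ! k \<in> U" using path(3) 3 k(1) by (auto simp: subset_iff)
        then have "v = p ! (k - 1) \<or> v = p ! Suc k"
          using two[of "p ! k" "p ! (k - 1)" "p ! Suc k" v] a ne uv(2,3) k(2) by metis
        then show ?thesis
          unfolding consecutive_in_def using 3 k by (cases k) (auto intro: exI[of _ "k - 1"] exI[of _ k])
      qed
    qed
    have sub: "card (U - set p) < card U"
      using path(1,3) less.prems(1) by (intro psubset_card_mono) (auto simp: neq_Nil_conv)
    have "\<exists>l. distinct l \<and> set l = U - set p \<and> (\<forall>u \<in> U - set p. \<forall>v \<in> U - set p. L u v \<longrightarrow> consecutive_in l u v)"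
    proof (rule less.hyps[OF sub])
      show "card {w \<in> U - set p. L v w} \<le> 2" if "v \<in> U - set p" for v
      proof -
        have "card {w \<in> U - set p. L v w} \<le> card {w \<in> U. L v w}"
          using less.prems(1) by (intro card_mono) auto
        then show ?thesis using deg[of v] that by simp
      qed
      show False if "distinct l" "set l \<subseteq> U - set p" "3 \<le> length l" "successively L l" "L (last l) (hd l)" for l
        using acyclic[of l] that by auto
    qed (use less.prems(1) sym irrefl in auto)
    then obtain l where l: "distinct l" "set l = U - set p"
      "\<forall>u \<in> U - set p. \<forall>v \<in> U - set p. L u v \<longrightarrow> consecutive_in l u v" by blast
    have cs: "consecutive_in m u v \<Longrightarrow> consecutive_in m v u" for m u v
      unfolding consecutive_in_def by blast
    have "consecutive_in (p @ l) u v" if uv: "u \<in> U" "v \<in> U" "L u v" for u v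
    proof -
      consider "u \<in> set p" | "v \<in> set p" | "u \<in> U - set p" "v \<in> U - set p" using uv by auto
      then show ?thesis
      proof cases
        case 1
        then show ?thesis using comp[OF _ uv(2,3)] consecutive_in_appendI1 by metis
      next
        case 2
        then show ?thesis using comp[OF _ uv(1) sym[OF uv(3)]] consecutive_in_appendI1 cs by metis
      next
        case 3
        then show ?thesis using l(3) uv(3) consecutive_in_appendI2 by metis
      qed
    qed
    moreover have "distinct (p @ l)" "set (p @ l) = U" using path l by auto
    ultimately show ?thesis by blast
  qed (auto intro: exI[of _ "[]"])
qed

section \<open>Outerplanar graphs of large spectral radius are fans\<close>

lemma fan_graph_arcs:
  "(i, j) \<in> parcs (fan_graph m) \<longleftrightarrow> i \<le> m \<and> j \<le> m \<and>
    (i < m \<and> j < m \<and> (j = Suc i \<or> i = Suc j) \<or> i = m \<and> j < m \<or> i < m \<and> j = m)"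
  by (auto simp: fan_graph_def path_graph_def)

abbreviation fan_form :: "nat \<Rightarrow> (nat \<Rightarrow> real) \<Rightarrow> real" where
  "fan_form m y \<equiv> \<Sum>(i, j) \<in> parcs (fan_graph m). y i * y j"

lemma sum_neighbours_swap:
  fixes x :: "'a \<Rightarrow> real"
  assumes "finite S" "finite V" "\<And>u v. E u v \<longleftrightarrow> E v u"
  shows "(\<Sum>w \<in> S. \<Sum>y | y \<in> V \<and> E w y. x y) = (\<Sum>y \<in> V. real (card {w \<in> S. E y w}) * x y)"
proof -
  have "(\<Sum>w \<in> S. \<Sum>y | y \<in> V \<and> E w y. x y) = (\<Sum>y \<in> V. \<Sum>w | w \<in> S \<and> E w y. x y)"
    using sum.swap_restrict[OF assms(1,2), of "\<lambda>w y. x y" E] .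
  also have "\<dots> = (\<Sum>y \<in> V. real (card {w \<in> S. E y w}) * x y)"
    using assms(3) by (simp add: Collect_conj_eq)
  finally show ?thesis .
qed

text \<open>The largest entry \<open>1\<close> is attained at \<open>z\<close>; \<open>N\<close> are the neighbours of \<open>z\<close> and \<open>R\<close> the remaining vertices. The
number \<open>137\<close> exceeds \<open>2 \<sqdot> 68\<close>, where \<open>68\<close> is the constant in \<open>neighbour_sum_le\<close>.\<close>

locale sub_eigenvector = outerplanar_relation E for E :: "'a \<Rightarrow> 'a \<Rightarrow> bool" +
  fixes V :: "'a set" and x :: "'a \<Rightarrow> real" and lam :: real and m :: nat and z :: 'a
  assumes finite_V: "finite V" and z_in: "z \<in> V" and x_z: "x z = 1"
    and nonneg: "v \<in> V \<Longrightarrow> 0 \<le> x v" and le_1: "v \<in> V \<Longrightarrow> x v \<le> 1"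
    and sub_eigen: "v \<in> V \<Longrightarrow> lam * x v \<le> (\<Sum>w | w \<in> V \<and> E v w. x w)"
    and card_V: "card V \<le> Suc m"
    and lam_large: "137 \<le> lam" "real m \<le> lam\<^sup>2"
begin

definition N where "N = {w \<in> V. E z w}"
definition R where "R = V - insert z N"

lemma finite_N: "finite N" and finite_R: "finite R"
  using finite_V by (auto simp: N_def R_def)

lemma z_notin_N: "z \<notin> N" using irrefl by (auto simp: N_def)

lemma V_split: "V = insert z (N \<union> R)" "z \<notin> N \<union> R" "N \<inter> R = {}"
  using z_in z_notin_N by (auto simp: N_def R_def)

lemma sum_V: "(\<Sum>v \<in> V. f v) = f z + (\<Sum>v \<in> N. f v) + (\<Sum>v \<in> R. f v)" for f :: "'a \<Rightarrow> real"
proof -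
  have "(\<Sum>v \<in> V. f v) = (\<Sum>v \<in> insert z (N \<union> R). f v)"
    by (rule arg_cong[OF V_split(1)])
  also have "\<dots> = f z + (\<Sum>v \<in> N \<union> R. f v)"
    using V_split(2) finite_N finite_R by simp
  finally show ?thesis using V_split(3) finite_N finite_R by (simp add: sum.union_disjoint)
qed

lemma nbr_in_N_le_2: "v \<noteq> z \<Longrightarrow> card {w \<in> N. E v w} \<le> 2"
  using common_neighbours_le_2[OF finite_V, of v z] by (auto simp: N_def conj_ac)

text \<open>Summing the eigenvalue inequality over all vertices counts each entry with its degree, and the number of
edges is linear.\<close>

lemma sum_x_le: "lam * (\<Sum>v \<in> V. x v) \<le> 4 * real (Suc m)"
proof -
  have "lam * (\<Sum>v \<in> V. x v) \<le> (\<Sum>v \<in> V. \<Sum>w | w \<in> V \<and> E v w. x w)"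
    unfolding sum_distrib_left by (intro sum_mono sub_eigen)
  also have "\<dots> = (\<Sum>v \<in> V. real (card {w \<in> V. E v w}) * x v)"
    by (intro sum_neighbours_swap finite_V sym_iff)
  also have "\<dots> \<le> (\<Sum>v \<in> V. real (card {w \<in> V. E v w}))"
    using le_1 nonneg by (intro sum_mono mult_left_le) auto
  also have "\<dots> = real (\<Sum>v \<in> V. card {w \<in> V. E v w})" by simp
  also have "\<dots> \<le> real (4 * card V)" using arcs_le[OF finite_V] by (intro of_nat_mono)
  also have "\<dots> \<le> 4 * real (Suc m)" using card_V by simp
  finally show ?thesis .
qed

text \<open>Each vertex except \<open>z\<close> ends at most two walks of length two from \<open>z\<close>, by the bound on common neighbours. With
\<open>s\<close> the sum over \<open>N\<close>, the walks ending in \<open>N\<close> weigh at most \<open>2 s\<close>, which \<open>lam s\<close> absorbs, and those ending in \<open>R\<close> weigh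
\<open>O(lam)\<close> by \<open>sum_x_le\<close>. The remaining weight must come from the walks that return to \<open>z\<close>, whose number is \<open>card N\<close>.\<close>

lemma card_R_le: "real (card R) \<le> 11 * lam"
proof -
  define s where "s = (\<Sum>w \<in> N. x w)"
  define r where "r = (\<Sum>w \<in> R. x w)"
  have s: "lam \<le> s" using sub_eigen[OF z_in] x_z by (simp add: s_def N_def)
  have r0: "r \<le> (\<Sum>v \<in> V. x v)"
    unfolding r_def using finite_V nonneg by (intro sum_mono2) (auto simp: R_def)
  have "lam * s \<le> (\<Sum>w \<in> N. \<Sum>y | y \<in> V \<and> E w y. x y)"
    unfolding s_def sum_distrib_left by (intro sum_mono sub_eigen) (simp add: N_def)
  also have "\<dots> = (\<Sum>y \<in> V. real (card {w \<in> N. E y w}) * x y)"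
    by (intro sum_neighbours_swap finite_N finite_V sym_iff)
  also have "\<dots> = real (card {w \<in> N. E z w}) * x z + (\<Sum>y \<in> N. real (card {w \<in> N. E y w}) * x y)
      + (\<Sum>y \<in> R. real (card {w \<in> N. E y w}) * x y)" by (rule sum_V)
  also have "\<dots> \<le> real (card N) + (\<Sum>y \<in> N. 2 * x y) + (\<Sum>y \<in> R. 2 * x y)"
  proof (intro add_mono sum_mono mult_right_mono)
    show "real (card {w \<in> N. E z w}) * x z \<le> real (card N)" using x_z by (simp add: N_def)
    have le2: "real (card {w \<in> N. E y w}) \<le> 2" if "y \<noteq> z" for y
      using nbr_in_N_le_2[OF that] by simp
    show "real (card {w \<in> N. E y w}) \<le> 2" if "y \<in> N" for y
      using le2[of y] that V_split(2) by auto
    show "real (card {w \<in> N. E y w}) \<le> 2" if "y \<in> R" for y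
      using le2[of y] that V_split(2) by auto
  qed (use nonneg in \<open>auto simp: N_def R_def\<close>)
  also have "\<dots> = real (card N) + 2 * s + 2 * r" by (simp add: s_def r_def sum_distrib_left)
  finally have 1: "(lam - 2) * s \<le> real (card N) + 2 * r" by (simp add: algebra_simps)
  have "(lam - 2) * lam \<le> (lam - 2) * s" using s lam_large(1) by (intro mult_left_mono) auto
  then have 2: "(lam - 2) * lam \<le> real (card N) + 2 * r" using 1 by linarith
  have "card V = card (insert z (N \<union> R))" by (rule arg_cong[OF V_split(1)])
  also have "\<dots> = Suc (card N + card R)"
    using V_split(2,3) finite_N finite_R by (simp add: card_Un_disjoint)
  finally have "card V = Suc (card N + card R)" .
  then have 3: "real (card N) + real (card R) \<le> lam\<^sup>2" using card_V lam_large(2) by linarith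
  have 4: "real (card R) \<le> 2 * lam + 2 * r"
    using 2 3 by (simp add: algebra_simps power2_eq_square)
  have "lam * r \<le> 4 * (lam\<^sup>2 + 1)"
  proof -
    have "lam * r \<le> lam * (\<Sum>v \<in> V. x v)" using r0 lam_large(1) by (intro mult_left_mono) auto
    then show ?thesis using sum_x_le lam_large(2) by simp
  qed
  also have "\<dots> \<le> lam * (4.5 * lam)"
  proof -
    have "8 \<le> lam * lam" using lam_large(1) mult_mono[of 137 lam 137 lam] by simp
    then show ?thesis by (simp add: power2_eq_square)
  qed
  finally have "r \<le> 4.5 * lam" using lam_large(1) by simp
  then show ?thesis using 4 by linarith
qed

text \<open>Vertices of \<open>R\<close> are not adjacent to \<open>z\<close>, so the edges at \<open>R\<close> only see entries bounded by \<open>M\<close>. There are \<open>O(card R)\<close> of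
them, which \<open>card_R_le\<close> compares with \<open>lam\<close>.\<close>

lemma sum_R_le:
  assumes "0 \<le> M" "\<And>v. v \<in> V \<Longrightarrow> v \<noteq> z \<Longrightarrow> x v \<le> M"
  shows "(\<Sum>w \<in> R. x w) \<le> 66 * M"
proof -
  have nz: "y \<noteq> z" if "w \<in> R" "E w y" "y \<in> V" for w y
    using that sym by (auto simp: R_def N_def)
  have "lam * (\<Sum>w \<in> R. x w) \<le> (\<Sum>w \<in> R. \<Sum>y | y \<in> V \<and> E w y. x y)"
    unfolding sum_distrib_left by (intro sum_mono sub_eigen) (simp add: R_def)
  also have "\<dots> \<le> (\<Sum>w \<in> R. real (card {y \<in> V. E w y}) * M)"
    using assms(2) nz by (intro sum_mono sum_bounded_above) auto
  also have "\<dots> = real (\<Sum>w \<in> R. card {y \<in> V. E w y}) * M" by (simp add: sum_distrib_right)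
  also have "\<dots> \<le> real (6 * card R) * M"
  proof (intro mult_right_mono of_nat_mono assms(1))
    have "card {y \<in> V. E w y} \<le> 2 + card {y \<in> R. E w y}" if "w \<in> R" for w
    proof -
      have "{y \<in> V. E w y} \<subseteq> {y \<in> N. E w y} \<union> {y \<in> R. E w y}" using V_split nz[OF that] by auto
      then have "card {y \<in> V. E w y} \<le> card ({y \<in> N. E w y} \<union> {y \<in> R. E w y})"
        using finite_N finite_R by (intro card_mono) auto
      also have "\<dots> \<le> card {y \<in> N. E w y} + card {y \<in> R. E w y}" by (rule card_Un_le)
      finally show ?thesis using nbr_in_N_le_2[of w] that V_split(2) by fastforce
    qed
    then have "(\<Sum>w \<in> R. card {y \<in> V. E w y}) \<le> (\<Sum>w \<in> R. 2 + card {y \<in> R. E w y})"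
      by (intro sum_mono) auto
    also have "\<dots> \<le> 6 * card R" unfolding sum.distrib using arcs_le[OF finite_R] by simp
    finally show "(\<Sum>w \<in> R. card {y \<in> V. E w y}) \<le> 6 * card R" .
  qed
  also have "\<dots> \<le> lam * (66 * M)" 
    using mult_right_mono[OF card_R_le assms(1)] by (simp add: algebra_simps)
  finally show ?thesis using lam_large(1) by simp
qed

lemma neighbour_sum_le:
  assumes "0 \<le> M" "\<And>v. v \<in> V \<Longrightarrow> v \<noteq> z \<Longrightarrow> x v \<le> M" "v \<in> V" "v \<noteq> z"
  shows "(\<Sum>w | w \<in> V \<and> E v w. x w) \<le> (if v \<in> N then 1 else 0) + 68 * M"
proof -
  have "(\<Sum>w | w \<in> V \<and> E v w. x w) = (\<Sum>w \<in> V. if E v w then x w else 0)"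
    using finite_V by (simp add: sum.inter_filter)
  also have "\<dots> = (if E v z then 1 else 0) + (\<Sum>w \<in> N. if E v w then x w else 0) + (\<Sum>w \<in> R. if E v w then x w else 0)"
    by (simp add: sum_V x_z)
  also have "\<dots> \<le> (if v \<in> N then 1 else 0) + 2 * M + 66 * M"
  proof (intro add_mono)
    show "(if E v z then 1 else 0) \<le> (if v \<in> N then 1 else 0 :: real)"
      using assms(3) sym by (auto simp: N_def)
    have "(\<Sum>w \<in> N. if E v w then x w else 0) = (\<Sum>w | w \<in> N \<and> E v w. x w)"
      using finite_N by (simp add: sum.inter_filter)
    also have "\<dots> \<le> real (card {w \<in> N. E v w}) * M"
      using assms(2) z_notin_N by (intro sum_bounded_above) (auto simp: N_def)
    also have "\<dots> \<le> 2 * M"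
      using nbr_in_N_le_2[OF assms(4)] assms(1) by (intro mult_right_mono) auto
    finally show "(\<Sum>w \<in> N. if E v w then x w else 0) \<le> 2 * M" .
    have "(\<Sum>w \<in> R. if E v w then x w else 0) \<le> (\<Sum>w \<in> R. x w)"
      using nonneg by (intro sum_mono) (auto simp: R_def)
    then show "(\<Sum>w \<in> R. if E v w then x w else 0) \<le> 66 * M"
      using sum_R_le[OF assms(1,2)] by linarith
  qed
  finally show ?thesis by simp
qed

text \<open>With \<open>M\<close> the second largest entry, the eigenvalue inequality gives \<open>lam M \<le> 1 + 68 M\<close>, hence \<open>68 M < 1\<close>.\<close>

lemma R_neighbour_sum_less_1:
  assumes "v \<in> R"
  shows "(\<Sum>w | w \<in> V \<and> E v w. x w) < 1"
proof -
  have v: "v \<in> V" "v \<noteq> z" "v \<notin> N" using assms by (auto simp: R_def)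
  define M where "M = Max (x ` (V - {z}))"
  have "M \<in> x ` (V - {z})" unfolding M_def using finite_V v by (intro Max_in) auto
  then obtain u where u: "u \<in> V" "u \<noteq> z" "M = x u" by auto
  have le: "x v \<le> M" if "v \<in> V" "v \<noteq> z" for v
    unfolding M_def using finite_V that by (intro Max_ge) auto
  have M0: "0 \<le> M" using u nonneg by auto
  have "lam * M \<le> 1 + 68 * M"
    using sub_eigen[OF u(1)] neighbour_sum_le[OF M0 le u(1,2)] u(3) by (auto split: if_splits)
  then have "137 * M \<le> 1 + 68 * M"
    using mult_right_mono[OF lam_large(1) M0] by linarith
  then have "68 * M < 1" using M0 by linarith
  then show ?thesis using neighbour_sum_le[OF M0 le v(1,2)] v(3) by simp
qed

lemma neighbourhood_enumeration:
  "\<exists>l. distinct l \<and> set l = V - {z} \<and> (\<forall>u \<in> N. \<forall>v \<in> N. E u v \<longrightarrow> consecutive_in l u v)"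
proof -
  let ?L = "\<lambda>u v. E u v \<and> u \<in> N \<and> v \<in> N"
  have "\<exists>l. distinct l \<and> set l = V - {z} \<and> (\<forall>u \<in> V - {z}. \<forall>v \<in> V - {z}. ?L u v \<longrightarrow> consecutive_in l u v)"
  proof (rule linear_forest_enumeration)
    show "finite (V - {z})" using finite_V by simp
    show "?L v u" if "?L u v" for u v using that sym by blast
    show "\<not> ?L v v" for v using irrefl by blast
    show "card {w \<in> V - {z}. ?L v w} \<le> 2" if "v \<in> V - {z}" for v
    proof -
      have "card {w \<in> V - {z}. ?L v w} \<le> card {w \<in> N. E v w}"
        using finite_N by (intro card_mono) auto
      then show ?thesis using nbr_in_N_le_2[of v] that by simp
    qed
    show False if l: "distinct l" "set l \<subseteq> V - {z}" "3 \<le> length l" "successively ?L l" "?L (last l) (hd l)" for l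
    proof (rule no_wheel[of l z])
      show "successively E l" using l(4) by (rule successively_mono) auto
      show "\<forall>v \<in> set l. E z v"
      proof
        fix v assume "v \<in> set l"
        then obtain k where k: "k < length l" "v = l ! k" by (auto simp: in_set_conv_nth)
        have "v \<in> N"
        proof (cases "Suc k < length l")
          case True
          then show ?thesis using successively_nth[OF l(4)] k by auto
        next
          case False
          then have "v = last l" using k by (metis Suc_lessI diff_Suc_1 last_conv_nth list.size(3) not_less_zero)
          then show ?thesis using l(5) by simp
        qed
        then show "E z v" by (simp add: N_def)
      qed
    qed (use l in auto)
  qed
  then obtain l where l: "distinct l" "set l = V - {z}"
    "\<forall>u \<in> V - {z}. \<forall>v \<in> V - {z}. ?L u v \<longrightarrow> consecutive_in l u v" by blast
  have "N \<subseteq> V - {z}" using z_notin_N by (auto simp: N_def)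
  then show ?thesis using l by (intro exI[of _ l]) (simp add: subset_iff)
qed

text \<open>Place \<open>z\<close> on the hub of the fan and the other vertices on its path such that the edges inside \<open>N\<close> become
path edges. Every vertex of \<open>R\<close> trades its edges for the edge to the hub. Since \<open>z\<close> has entry \<open>1\<close>, the
quadratic form does not decrease; the sum over \<open>R\<close> is a lower bound for the gain, an edge inside \<open>R\<close> being charged at both ends.\<close>

lemma compare_with_fan:
  obtains f y where "inj_on f V" "f ` V \<subseteq> {..m}" "f z = m"
    "\<And>v. v \<in> V \<Longrightarrow> y (f v) = x v" "\<And>i. i \<notin> f ` V \<Longrightarrow> y i = 0"
    "(\<Sum>u \<in> V. \<Sum>w | w \<in> V \<and> E u w. x u * x w) + 2 * (\<Sum>v \<in> R. x v * (1 - (\<Sum>w | w \<in> V \<and> E v w. x w)))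
      \<le> fan_form m y"
    "R = {} \<Longrightarrow> \<forall>u \<in> V. \<forall>w \<in> V. E u w \<longrightarrow> (f u, f w) \<in> parcs (fan_graph m)"
proof -
  obtain l where l: "distinct l" "set l = V - {z}" "\<forall>u \<in> N. \<forall>v \<in> N. E u v \<longrightarrow> consecutive_in l u v"
    using neighbourhood_enumeration by blast
  have len: "length l \<le> m"
    using distinct_card[OF l(1)] l(2) card_V finite_V z_in by simp
  define idx where "idx v = (THE k. k < length l \<and> l ! k = v)" for v
  have idx: "idx (l ! k) = k" if "k < length l" for k
    unfolding idx_def using l(1) that by (auto simp: nth_eq_iff_index_eq intro!: the_equality)
  have idx': "idx v < length l" "l ! idx v = v" if "v \<in> V" "v \<noteq> z" for v
  proof -
    have "v \<in> set l" using l(2) that by simp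
    then obtain k where k: "k < length l" "v = l ! k" by (auto simp: in_set_conv_nth)
    show "idx v < length l" "l ! idx v = v" unfolding k(2) idx[OF k(1)] by (fact k(1), rule refl)
  qed
  define f where "f v = (if v = z then m else idx v)" for v
  have f_lt: "f v < m" if "v \<in> V" "v \<noteq> z" for v
    using idx'[OF that] len that by (simp add: f_def)
  have inj: "inj_on f V"
  proof (rule inj_onI)
    fix u v assume uv: "u \<in> V" "v \<in> V" "f u = f v"
    show "u = v"
    proof (cases "u = z \<or> v = z")
      case True
      then show ?thesis using f_lt[of u] f_lt[of v] uv by (auto simp: f_def split: if_splits)
    next
      case False
      then have "idx u = idx v" using uv(3) by (simp add: f_def)
      then show ?thesis using idx'(2)[of u] idx'(2)[of v] uv(1,2) False by metis
    qed
  qed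
  have fz: "f z = m" by (simp add: f_def)
  have f_le: "f ` V \<subseteq> {..m}"
  proof
    fix i assume "i \<in> f ` V"
    then obtain v where "v \<in> V" "i = f v" by blast
    then show "i \<in> {..m}" using f_lt[of v] fz by (cases "v = z") auto
  qed
  define y where "y i = (if i \<in> f ` V then x (the_inv_into V f i) else 0)" for i
  have y_f: "y (f v) = x v" if "v \<in> V" for v
    using that inj by (simp add: y_def the_inv_into_f_f)
  have y_0: "y i = 0" if "i \<notin> f ` V" for i using that by (simp add: y_def)
  have y_nonneg: "0 \<le> y i" for i
    using y_0[of i] y_f nonneg by (cases "i \<in> f ` V") auto
  have N_arc: "(f u, f w) \<in> parcs (fan_graph m)" if "u \<in> N" "w \<in> N" "E u w" for u w
  proof -
    have "consecutive_in l u w" using l(3) that by blast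
    then obtain k where "Suc k < length l" "u = l ! k \<and> w = l ! Suc k \<or> w = l ! k \<and> u = l ! Suc k"
      unfolding consecutive_in_def by blast
    moreover have "u \<noteq> z" "w \<noteq> z" using that z_notin_N by auto
    ultimately show ?thesis using idx len by (auto simp: fan_graph_arcs f_def)
  qed
  have hub_arc: "(f z, f w) \<in> parcs (fan_graph m)" "(f w, f z) \<in> parcs (fan_graph m)" if "w \<in> N \<union> R" for w
  proof -
    have "w \<in> V" "w \<noteq> z" using that V_split(2) by (auto simp: N_def R_def)
    then have "f w < m" by (rule f_lt)
    then show "(f z, f w) \<in> parcs (fan_graph m)" "(f w, f z) \<in> parcs (fan_graph m)"
      by (simp_all add: fan_graph_arcs fz)
  qed
  \<comment> \<open>\<open>B\<close> consists of the ordered pairs that are edges after the trade.\<close>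
  define L where "L = {(u, w). u \<in> N \<and> w \<in> N \<and> E u w}"
  define B where "B = L \<union> {z} \<times> (N \<union> R) \<union> (N \<union> R) \<times> {z}"
  have fin: "finite L" "finite (parcs (fan_graph m))"
  proof -
    show "finite L" unfolding L_def by (rule finite_subset[of _ "N \<times> N"]) (use finite_N in auto)
    show "finite (parcs (fan_graph m))"
      by (rule finite_subset[of _ "{..m} \<times> {..m}"]) (auto simp: fan_graph_arcs)
  qed
  have BV: "B \<subseteq> V \<times> V" using V_split z_in by (auto simp: B_def L_def)
  have injB: "inj_on (map_prod f f) B"
    using inj BV by (auto simp: inj_on_def subset_iff)
  have "map_prod f f ` B \<subseteq> parcs (fan_graph m)"
    unfolding B_def L_def using N_arc hub_arc by auto
  then have "(\<Sum>(i, j) \<in> map_prod f f ` B. y i * y j) \<le> fan_form m y"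
    using fin(2) y_nonneg by (intro sum_mono2) auto
  moreover have "(\<Sum>(i, j) \<in> map_prod f f ` B. y i * y j) = (\<Sum>(u, w) \<in> B. x u * x w)"
    using BV y_f by (subst sum.reindex[OF injB]) (auto intro!: sum.cong)
  ultimately have fan: "(\<Sum>(u, w) \<in> B. x u * x w) \<le> fan_form m y" by simp
  have B_sum: "(\<Sum>(u, w) \<in> B. x u * x w) = (\<Sum>(u, w) \<in> L. x u * x w) + 2 * (\<Sum>w \<in> N. x w) + 2 * (\<Sum>w \<in> R. x w)"
  proof -
    have NR: "finite (N \<union> R)" using finite_N finite_R by simp
    have disj: "L \<inter> {z} \<times> (N \<union> R) = {}" "(L \<union> {z} \<times> (N \<union> R)) \<inter> (N \<union> R) \<times> {z} = {}"
      using V_split(2) by (auto simp: L_def)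
    have "(\<Sum>(u, w) \<in> {z} \<times> (N \<union> R). x u * x w) = (\<Sum>w \<in> N \<union> R. x w)"
      using sum.cartesian_product[of "\<lambda>u w. x u * x w" "N \<union> R" "{z}"] by (simp add: x_z)
    moreover have "(\<Sum>(u, w) \<in> (N \<union> R) \<times> {z}. x u * x w) = (\<Sum>w \<in> N \<union> R. x w)"
      using sum.cartesian_product[of "\<lambda>u w. x u * x w" "{z}" "N \<union> R"] by (simp add: x_z)
    moreover have "(\<Sum>w \<in> N \<union> R. x w) = (\<Sum>w \<in> N. x w) + (\<Sum>w \<in> R. x w)"
      using V_split(3) finite_N finite_R by (simp add: sum.union_disjoint)
    ultimately show ?thesis
      unfolding B_def using fin(1) NR disj
      by (simp add: sum.union_disjoint del: Un_Int_distrib2 Sigma_Un_distrib1)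
  qed
  have Q_le: "(\<Sum>u \<in> V. \<Sum>w | w \<in> V \<and> E u w. x u * x w) \<le>
      (\<Sum>(u, w) \<in> L. x u * x w) + 2 * (\<Sum>w \<in> N. x w) + 2 * (\<Sum>v \<in> R. x v * (\<Sum>w | w \<in> V \<and> E v w. x w))"
  proof -
    let ?e = "\<lambda>u w. if E u w then x u * x w else 0"
    have e_sym: "?e u w = ?e w u" for u w using sym_iff[of u w] by (simp add: mult.commute)
    have e_nonneg: "0 \<le> ?e u w" if "u \<in> V" "w \<in> V" for u w using nonneg that by simp
    have rest: "x v * (\<Sum>w | w \<in> V \<and> E v w. x w) = (\<Sum>w \<in> V. ?e v w)" for v
      using finite_V by (simp add: sum.inter_filter sum_distrib_left if_distrib cong: if_cong)
    have "(\<Sum>u \<in> V. \<Sum>w | w \<in> V \<and> E u w. x u * x w) = (\<Sum>u \<in> V. \<Sum>w \<in> V. ?e u w)"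
      using finite_V by (simp add: sum.inter_filter)
    also have "\<dots> = (\<Sum>w \<in> V. ?e z w) + (\<Sum>u \<in> N. \<Sum>w \<in> V. ?e u w) + (\<Sum>u \<in> R. \<Sum>w \<in> V. ?e u w)"
      by (rule sum_V)
    also have "(\<Sum>w \<in> V. ?e z w) = (\<Sum>w \<in> N. x w)"
    proof -
      have "(\<Sum>w \<in> V. ?e z w) = (\<Sum>w | w \<in> V \<and> E z w. x w)"
        using finite_V by (simp add: sum.inter_filter x_z cong: if_cong)
      then show ?thesis by (simp add: N_def)
    qed
    also have "(\<Sum>u \<in> N. \<Sum>w \<in> V. ?e u w) = (\<Sum>u \<in> N. x u) + (\<Sum>u \<in> N. \<Sum>w \<in> N. ?e u w) + (\<Sum>u \<in> N. \<Sum>w \<in> R. ?e u w)"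
    proof -
      have "E u z" if "u \<in> N" for u using that sym by (simp add: N_def)
      then have "(\<Sum>w \<in> V. ?e u w) = x u + (\<Sum>w \<in> N. ?e u w) + (\<Sum>w \<in> R. ?e u w)" if "u \<in> N" for u
        using that by (simp add: sum_V x_z)
      then show ?thesis by (simp add: sum.distrib)
    qed
    also have "(\<Sum>u \<in> N. \<Sum>w \<in> N. ?e u w) = (\<Sum>(u, w) \<in> L. x u * x w)"
    proof -
      have "(\<Sum>u \<in> N. \<Sum>w \<in> N. ?e u w) = (\<Sum>(u, w) \<in> N \<times> N. ?e u w)" by (rule sum.cartesian_product)
      also have "\<dots> = (\<Sum>(u, w) \<in> L. x u * x w)"
        using finite_N by (intro sum.mono_neutral_cong_right) (auto simp: L_def split: if_splits)
      finally show ?thesis .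
    qed
    also have "(\<Sum>u \<in> N. \<Sum>w \<in> R. ?e u w) = (\<Sum>w \<in> R. \<Sum>u \<in> N. ?e w u)"
    proof -
      have "(\<Sum>u \<in> N. \<Sum>w \<in> R. ?e u w) = (\<Sum>w \<in> R. \<Sum>u \<in> N. ?e u w)" by (rule sum.swap)
      also have "\<dots> = (\<Sum>w \<in> R. \<Sum>u \<in> N. ?e w u)" by (intro sum.cong refl e_sym)
      finally show ?thesis .
    qed
    finally have eq: "(\<Sum>u \<in> V. \<Sum>w | w \<in> V \<and> E u w. x u * x w) = 2 * (\<Sum>w \<in> N. x w) + (\<Sum>(u, w) \<in> L. x u * x w) +
       (\<Sum>w \<in> R. \<Sum>u \<in> N. ?e w u) + (\<Sum>u \<in> R. \<Sum>w \<in> V. ?e u w)" by simp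
    have "(\<Sum>w \<in> R. \<Sum>u \<in> N. ?e w u) \<le> (\<Sum>w \<in> R. \<Sum>u \<in> V. ?e w u)"
      using finite_V e_nonneg by (intro sum_mono sum_mono2) (auto simp: N_def R_def)
    then show ?thesis using eq rest by simp
  qed
  show thesis
  proof (rule that[of f y])
    show "(\<Sum>u \<in> V. \<Sum>w | w \<in> V \<and> E u w. x u * x w) + 2 * (\<Sum>v \<in> R. x v * (1 - (\<Sum>w | w \<in> V \<and> E v w. x w)))
      \<le> fan_form m y"
      using fan B_sum Q_le by (simp add: right_diff_distrib sum_subtractf)
    show "\<forall>u \<in> V. \<forall>w \<in> V. E u w \<longrightarrow> (f u, f w) \<in> parcs (fan_graph m)" if "R = {}"
    proof (intro ballI impI)
      fix u w assume uw: "u \<in> V" "w \<in> V" "E u w"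
      then have "u = z \<or> u \<in> N" "w = z \<or> w \<in> N" using that by (auto simp: R_def)
      then show "(f u, f w) \<in> parcs (fan_graph m)" using N_arc hub_arc uw(3) irrefl by auto
    qed
  qed (fact inj f_le fz y_f y_0)+
qed

end

text \<open>If \<open>y\<close> is the vector moved to the fan as in \<open>compare_with_fan\<close>, then
\<open>lam \<parallel>x\<parallel>\<^sup>2 \<le> x\<^sup>T A x \<le> y\<^sup>T A\<^sub>F y \<le> mu \<parallel>y\<parallel>\<^sup>2 = mu \<parallel>x\<parallel>\<^sup>2\<close>, and \<open>mu \<le> lam\<close> makes these
equalities. Then \<open>y\<close> maximises the Rayleigh quotient of
the fan and is positive everywhere, whence the embedding is onto, \<open>R\<close> is empty and no edge of the
fan is missing.\<close>

theorem (in outerplanar_relation) fan_extremal: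
  fixes x :: "'a \<Rightarrow> real" and lam mu :: real and m :: nat
  assumes fin: "finite V" and card: "card V \<le> Suc m"
    and nonneg: "\<And>v. v \<in> V \<Longrightarrow> 0 \<le> x v" and nonzero: "\<exists>v \<in> V. x v \<noteq> 0"
    and sub: "\<And>v. v \<in> V \<Longrightarrow> lam * x v \<le> (\<Sum>w | w \<in> V \<and> E v w. x w)"
    and large: "137 \<le> mu" "real m \<le> mu\<^sup>2" "mu \<le> lam"
    and fan_le: "\<And>y. fan_form m y \<le> mu * (\<Sum>i \<le> m. (y i)\<^sup>2)"
    and fan_pos: "\<And>y. (\<And>i. 0 \<le> y i) \<Longrightarrow> (\<exists>i \<le> m. y i \<noteq> 0) \<Longrightarrow>
      fan_form m y = mu * (\<Sum>i \<le> m. (y i)\<^sup>2) \<Longrightarrow> \<forall>i \<le> m. 0 < y i"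
  shows "lam = mu" "\<forall>v \<in> V. 0 < x v"
    "\<exists>f. bij_betw f V {..m} \<and> (\<forall>u \<in> V. \<forall>w \<in> V. E u w \<longleftrightarrow> (f u, f w) \<in> parcs (fan_graph m))"
proof -
  define c where "c = Max (x ` V)"
  have ne: "V \<noteq> {}" using nonzero by auto
  have "c \<in> x ` V" unfolding c_def using fin ne by (intro Max_in) auto
  then obtain z where z: "z \<in> V" "x z = c" by auto
  have le_c: "x v \<le> c" if "v \<in> V" for v unfolding c_def using fin that by (intro Max_ge) auto
  have c: "0 < c" using nonzero nonneg le_c by (metis less_eq_real_def order_trans not_less)
  define x' where "x' v = x v / c" for v
  interpret sub_eigenvector E V x' lam m z
  proof
    show "lam * x' v \<le> (\<Sum>w | w \<in> V \<and> E v w. x' w)" if "v \<in> V" for v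
      using sub[OF that] c by (simp add: x'_def divide_right_mono flip: sum_divide_distrib)
    show "real m \<le> lam\<^sup>2" using large power_mono[of mu lam 2] by linarith
  qed (use fin card z c nonneg le_c large in \<open>auto simp: x'_def\<close>)
  obtain f y where f: "inj_on f V" "f ` V \<subseteq> {..m}" "f z = m"
    and y: "\<And>v. v \<in> V \<Longrightarrow> y (f v) = x' v" "\<And>i. i \<notin> f ` V \<Longrightarrow> y i = 0"
    and le: "(\<Sum>u \<in> V. \<Sum>w | w \<in> V \<and> E u w. x' u * x' w) + 2 * (\<Sum>v \<in> R. x' v * (1 - (\<Sum>w | w \<in> V \<and> E v w. x' w)))
      \<le> fan_form m y"
    and emb: "R = {} \<Longrightarrow> \<forall>u \<in> V. \<forall>w \<in> V. E u w \<longrightarrow> (f u, f w) \<in> parcs (fan_graph m)"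
    using compare_with_fan by blast
  define n2 where "n2 = (\<Sum>v \<in> V. (x' v)\<^sup>2)"
  have n2_pos: "0 < n2" unfolding n2_def using fin z_in x_z by (intro sum_pos2[of V z]) auto
  have y_n2: "(\<Sum>i \<le> m. (y i)\<^sup>2) = n2"
  proof -
    have "(\<Sum>i \<le> m. (y i)\<^sup>2) = (\<Sum>i \<in> f ` V. (y i)\<^sup>2)"
      using f(2) y(2) by (intro sum.mono_neutral_right) auto
    also have "\<dots> = n2" using y(1) by (simp add: sum.reindex[OF f(1)] n2_def)
    finally show ?thesis .
  qed
  have Q_ge: "lam * n2 \<le> (\<Sum>u \<in> V. \<Sum>w | w \<in> V \<and> E u w. x' u * x' w)"
  proof -
    have "lam * n2 = (\<Sum>v \<in> V. x' v * (lam * x' v))"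
      by (simp add: n2_def sum_distrib_left power2_eq_square algebra_simps)
    also have "\<dots> \<le> (\<Sum>v \<in> V. x' v * (\<Sum>w | w \<in> V \<and> E v w. x' w))"
      using sub_eigen sub_eigenvector_axioms by (intro sum_mono mult_left_mono) (auto simp: sub_eigenvector.nonneg)
    finally show ?thesis by (simp add: sum_distrib_left)
  qed
  have gain: "0 \<le> x' v * (1 - (\<Sum>w | w \<in> V \<and> E v w. x' w))" if "v \<in> R" for v
    using R_neighbour_sum_less_1[OF that] sub_eigenvector.nonneg[OF sub_eigenvector_axioms, of v] that
    by (auto simp: R_def)
  have gains: "0 \<le> (\<Sum>v \<in> R. x' v * (1 - (\<Sum>w | w \<in> V \<and> E v w. x' w)))" using gain by (rule sum_nonneg)
  have Q_fan: "fan_form m y \<le> mu * n2" using fan_le[of y] y_n2 by simp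
  have "lam * n2 \<le> mu * n2" using Q_ge le gains Q_fan by linarith
  then show eq: "lam = mu" using n2_pos large(3) by simp
  have Q_eq: "fan_form m y = mu * n2"
    and gain_eq: "(\<Sum>v \<in> R. x' v * (1 - (\<Sum>w | w \<in> V \<and> E v w. x' w))) = 0"
    and QV_eq: "(\<Sum>u \<in> V. \<Sum>w | w \<in> V \<and> E u w. x' u * x' w) = mu * n2"
    using Q_ge[unfolded eq] le gains Q_fan by (linarith, linarith, linarith)
  have x'_nonneg: "0 \<le> x' v" if "v \<in> V" for v using sub_eigenvector.nonneg[OF sub_eigenvector_axioms that] .
  have pos: "\<forall>i \<le> m. 0 < y i"
  proof (rule fan_pos)
    show "0 \<le> y i" for i using y x'_nonneg by (cases "i \<in> f ` V") auto
    show "\<exists>i \<le> m. y i \<noteq> 0" using y(1)[OF z_in] x_z f(3) by (intro exI[of _ m]) auto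
    show "fan_form m y = mu * (\<Sum>i \<le> m. (y i)\<^sup>2)"
      using Q_eq y_n2 by simp
  qed
  have onto: "f ` V = {..m}"
    using f(2) pos y(2) by (auto) (metis less_irrefl)
  have x'_pos: "0 < x' v" if "v \<in> V" for v using pos y(1)[OF that] f(2) that by (metis atMost_iff image_subset_iff)
  then show "\<forall>v \<in> V. 0 < x v" using c by (auto simp: x'_def zero_less_divide_iff)
  have R_empty: "R = {}"
  proof (rule ccontr)
    assume "R \<noteq> {}"
    moreover have "0 < x' v * (1 - (\<Sum>w | w \<in> V \<and> E v w. x' w))" if "v \<in> R" for v
      using R_neighbour_sum_less_1[OF that] x'_pos[of v] that by (simp add: R_def)
    ultimately have "0 < (\<Sum>v \<in> R. x' v * (1 - (\<Sum>w | w \<in> V \<and> E v w. x' w)))"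
      using finite_R by (intro sum_pos) auto
    then show False using gain_eq by simp
  qed
  define A where "A = {(u, w). u \<in> V \<and> w \<in> V \<and> E u w}"
  have A_V: "A \<subseteq> V \<times> V" by (auto simp: A_def)
  have injA: "inj_on (map_prod f f) A"
    using f(1) A_V by (auto simp: inj_on_def subset_iff)
  have A_sub: "map_prod f f ` A \<subseteq> parcs (fan_graph m)" using emb[OF R_empty] by (auto simp: A_def)
  have fin_fan: "finite (parcs (fan_graph m))"
    by (rule finite_subset[of _ "{..m} \<times> {..m}"]) (auto simp: fan_graph_arcs)
  have A_sum: "(\<Sum>(i, j) \<in> map_prod f f ` A. y i * y j) = fan_form m y"
  proof -
    have "(\<Sum>(i, j) \<in> map_prod f f ` A. y i * y j) = (\<Sum>(u, w) \<in> A. x' u * x' w)"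
      using A_V y(1) by (subst sum.reindex[OF injA]) (auto intro!: sum.cong)
    also have "\<dots> = (\<Sum>u \<in> V. \<Sum>w | w \<in> V \<and> E u w. x' u * x' w)"
      using fin by (simp add: sum.Sigma A_def Sigma_def) (intro sum.cong; auto)
    finally show ?thesis using QV_eq Q_eq by simp
  qed
  have A_eq: "map_prod f f ` A = parcs (fan_graph m)"
  proof (rule ccontr)
    assume "\<not> ?thesis"
    then obtain e where e: "e \<in> parcs (fan_graph m)" "e \<notin> map_prod f f ` A" using A_sub by auto
    have arc_pos: "0 < (\<lambda>(i, j). y i * y j) e" if "e \<in> parcs (fan_graph m)" for e
      using that pos by (cases e) (auto simp: fan_graph_arcs)
    have "(\<Sum>(i, j) \<in> map_prod f f ` A. y i * y j) < fan_form m y"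
      using arc_pos e A_sub fin_fan by (intro sum_strict_mono2[of _ _ e]) (auto simp: less_imp_le)
    then show False using A_sum by simp
  qed
  have "E u w \<longleftrightarrow> (f u, f w) \<in> parcs (fan_graph m)" if "u \<in> V" "w \<in> V" for u w
  proof
    assume "(f u, f w) \<in> parcs (fan_graph m)"
    then obtain u' w' where "(u', w') \<in> A" "f u' = f u" "f w' = f w" using A_eq by force
    then show "E u w" using inj_onD[OF f(1)] that by (auto simp: A_def)
  qed (use emb[OF R_empty] that in auto)
  then show "\<exists>f. bij_betw f V {..m} \<and> (\<forall>u \<in> V. \<forall>w \<in> V. E u w \<longleftrightarrow> (f u, f w) \<in> parcs (fan_graph m))"
    using f(1) onto by (auto simp: bij_betw_def)
qed

section \<open>Eigenvectors of a real symmetric matrix\<close>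

definition dot :: "nat \<Rightarrow> (nat \<Rightarrow> real) \<Rightarrow> (nat \<Rightarrow> real) \<Rightarrow> real" where
  "dot n x y = (\<Sum>i<n. x i * y i)"

text \<open>Vectors of length \<open>n\<close> are functions of which only the arguments below \<open>n\<close> count.\<close>

definition in_span :: "nat \<Rightarrow> nat \<Rightarrow> (nat \<Rightarrow> nat \<Rightarrow> real) \<Rightarrow> (nat \<Rightarrow> real) \<Rightarrow> bool" where
  "in_span n k p y \<longleftrightarrow> (\<exists>c. \<forall>i<n. y i = (\<Sum>l<k. c l * p l i))"

lemma in_span_add: "in_span n k p y \<Longrightarrow> in_span n k p z \<Longrightarrow> in_span n k p (\<lambda>i. y i + z i)"
  unfolding in_span_def
  by (elim exE, rule_tac x = "\<lambda>l. c l + ca l" in exI) (simp add: sum.distrib distrib_right)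

lemma in_span_scale: "in_span n k p y \<Longrightarrow> in_span n k p (\<lambda>i. s * y i)"
  unfolding in_span_def
  by (elim exE, rule_tac x = "\<lambda>l. s * c l" in exI) (simp add: sum_distrib_left mult.assoc)

lemma in_span_zero: "in_span n k p (\<lambda>i. 0)"
  unfolding in_span_def by (rule exI[of _ "\<lambda>_. 0"]) simp

lemma in_span_sum:
  fixes m :: nat
  shows "(\<And>l. l < m \<Longrightarrow> in_span n k p (y l)) \<Longrightarrow> in_span n k p (\<lambda>i. \<Sum>l<m. s l * y l i)"
proof (induction m)
  case 0
  then show ?case by (simp add: in_span_zero)
next
  case (Suc m)
  have "in_span n k p (\<lambda>i. (\<Sum>l<m. s l * y l i) + s m * y m i)"
    using Suc by (intro in_span_add in_span_scale) auto
  then show ?case by simp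
qed

lemma in_span_member: "l < k \<Longrightarrow> in_span n k p (p l)"
  unfolding in_span_def
  by (rule exI[of _ "\<lambda>j. if j = l then 1 else 0"]) (simp add: if_distrib[of "\<lambda>x. x * _"] cong: if_cong)

lemma in_span_cong: "in_span n k p y \<Longrightarrow> (\<And>i. i < n \<Longrightarrow> y i = z i) \<Longrightarrow> in_span n k p z"
  unfolding in_span_def by metis

lemma in_span_trans:
  assumes "in_span n k q y" "\<And>l. l < k \<Longrightarrow> in_span n k' p (q l)"
  shows "in_span n k' p y"
proof -
  obtain c where "\<forall>i<n. y i = (\<Sum>l<k. c l * q l i)" using assms(1) by (auto simp: in_span_def)
  then show ?thesis using in_span_cong[OF in_span_sum[of k n k' p q c, OF assms(2)]] by simp
qed

lemma in_span_mono:
  assumes "in_span n k p y" "k \<le> k'"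
  shows "in_span n k' p y"
  using assms(1) by (rule in_span_trans) (use assms(2) in \<open>auto intro: in_span_member\<close>)

lemma in_span_sub_swap: "in_span n k p (\<lambda>i. y i - z i) \<Longrightarrow> in_span n k p (\<lambda>i. z i - y i)"
  by (rule in_span_cong[OF in_span_scale[of _ _ _ _ "-1"]]) auto

lemma in_span_of_sub: "in_span n k p (\<lambda>i. y i - z i) \<Longrightarrow> in_span n k p z \<Longrightarrow> in_span n k p y"
  by (rule in_span_cong[OF in_span_add[of n k p "\<lambda>i. y i - z i" z]]) auto

text \<open>The vectors \<open>p j\<close> span a flag of invariant subspaces, as the columns of a Schur decomposition do. Their
Gram-Schmidt orthogonalisation \<open>q\<close> spans the same flag. By symmetry the image of \<open>q j\<close> is orthogonal to the earlier
eigenvectors, so its component in their span vanishes and \<open>q j\<close> is an eigenvector itself.\<close>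

lemma orthogonal_eigenvectors_of_flag:
  fixes a :: "nat \<Rightarrow> nat \<Rightarrow> real"
  assumes sym: "\<And>i j. i < n \<Longrightarrow> j < n \<Longrightarrow> a i j = a j i"
    and flag: "\<And>j i. j < n \<Longrightarrow> i < n \<Longrightarrow> (\<Sum>l<n. a i l * p j l) = e j * p j i + (\<Sum>l<j. b l j * p l i)"
    and indep: "\<And>c. (\<And>i. i < n \<Longrightarrow> (\<Sum>j<n. c j * p j i) = 0) \<Longrightarrow> \<forall>j<n. c j = 0"
    and "k \<le> n"
  shows "\<exists>q. (\<forall>j<k. \<forall>i<n. (\<Sum>l<n. a i l * q j l) = e j * q j i) \<and>
    (\<forall>i<k. \<forall>j<k. i \<noteq> j \<longrightarrow> dot n (q i) (q j) = 0) \<and> (\<forall>j<k. 0 < dot n (q j) (q j)) \<and>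
    (\<forall>j<k. in_span n j p (\<lambda>i. q j i - p j i)) \<and> (\<forall>j<k. in_span n j q (\<lambda>i. p j i - q j i))"
  using \<open>k \<le> n\<close>
proof (induction k)
  case (Suc k)
  then have "k \<le> n" by simp
  from Suc.IH[OF this] obtain q where Q: "\<forall>j<k. \<forall>i<n. (\<Sum>l<n. a i l * q j l) = e j * q j i"
    "\<forall>i<k. \<forall>j<k. i \<noteq> j \<longrightarrow> dot n (q i) (q j) = 0" "\<forall>j<k. 0 < dot n (q j) (q j)"
    "\<forall>j<k. in_span n j p (\<lambda>i. q j i - p j i)" "\<forall>j<k. in_span n j q (\<lambda>i. p j i - q j i)"
    by (elim exE conjE)
  have eig: "\<And>j i. j < k \<Longrightarrow> i < n \<Longrightarrow> (\<Sum>l<n. a i l * q j l) = e j * q j i" using Q(1) by blast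
  have orth: "\<And>i j. i < k \<Longrightarrow> j < k \<Longrightarrow> i \<noteq> j \<Longrightarrow> dot n (q i) (q j) = 0" using Q(2) by blast
  have pos: "\<And>j. j < k \<Longrightarrow> 0 < dot n (q j) (q j)" using Q(3) by blast
  have qp: "\<And>j. j < k \<Longrightarrow> in_span n j p (\<lambda>i. q j i - p j i)" using Q(4) by blast
  have pq: "\<And>j. j < k \<Longrightarrow> in_span n j q (\<lambda>i. p j i - q j i)" using Q(5) by blast
  have kn: "k < n" using Suc.prems by simp
  have comm: "dot n x y = dot n y x" for x y by (simp add: dot_def mult.commute)
  have dot_lin: "dot n x (\<lambda>i. y i + (\<Sum>l<m. s l * z l i)) = dot n x y + (\<Sum>l<m. s l * dot n x (z l))" for x y s z m
  proof -
    have "(\<Sum>i<n. x i * (\<Sum>l<m. s l * z l i)) = (\<Sum>l<m. s l * (\<Sum>i<n. x i * z l i))"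
      unfolding sum_distrib_left by (subst sum.swap) (simp add: mult_ac)
    then show ?thesis by (simp add: dot_def distrib_left sum.distrib)
  qed
  have dot_cong: "dot n x y = dot n x z" if "\<And>i. i < n \<Longrightarrow> y i = z i" for x y z
    using that by (simp add: dot_def)
  have qp': "in_span n k p (q l)" if "l < k" for l
    by (rule in_span_of_sub[OF in_span_mono[OF qp[OF that]] in_span_member[OF that]]) (use that in simp)
  have pq': "in_span n k q (p l)" if "l < k" for l
    by (rule in_span_of_sub[OF in_span_mono[OF pq[OF that]] in_span_member[OF that]]) (use that in simp)
  \<comment> \<open>the Gram-Schmidt step\<close>
  define t where "t l = - (dot n (p k) (q l) / dot n (q l) (q l))" for l
  define r where "r i = p k i + (\<Sum>l<k. t l * q l i)" for i
  have r_orth: "dot n (q m) r = 0" if "m < k" for m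
  proof -
    have "dot n (q m) r = dot n (q m) (p k) + (\<Sum>l<k. t l * dot n (q m) (q l))"
      unfolding r_def by (rule dot_lin)
    also have "(\<Sum>l<k. t l * dot n (q m) (q l)) = (\<Sum>l<k. if l = m then t m * dot n (q m) (q m) else 0)"
      using orth[OF that] by (intro sum.cong) auto
    also have "\<dots> = t m * dot n (q m) (q m)" using that by simp
    also have "\<dots> = - dot n (q m) (p k)" using pos[OF that] by (simp add: t_def comm)
    finally show ?thesis by simp
  qed
  have rp: "in_span n k p (\<lambda>i. r i - p k i)"
    by (rule in_span_cong[OF in_span_sum[of k n k p q t, OF qp']]) (auto simp: r_def)
  have pr: "in_span n k q (\<lambda>i. p k i - r i)"
    by (rule in_span_sub_swap, rule in_span_cong[OF in_span_sum[of k n k q q t, OF in_span_member]]) (auto simp: r_def)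
  have r_pos: "0 < dot n r r"
  proof (rule ccontr)
    assume "\<not> 0 < dot n r r"
    moreover have "0 \<le> dot n r r" unfolding dot_def by (intro sum_nonneg) simp
    ultimately have "(\<Sum>i<n. r i * r i) = 0" by (simp add: dot_def)
    then have r0: "r i = 0" if "i < n" for i
      using that by (subst (asm) sum_nonneg_eq_0_iff) auto
    obtain c where c: "\<forall>i<n. r i - p k i = (\<Sum>l<k. c l * p l i)" using rp by (auto simp: in_span_def)
    let ?c = "\<lambda>j. if j < k then c j else if j = k then 1 else 0"
    have "(\<Sum>j<n. ?c j * p j i) = 0" if "i < n" for i
    proof -
      have "(\<Sum>j<n. ?c j * p j i) = (\<Sum>j<Suc k. ?c j * p j i)"
        using kn by (intro sum.mono_neutral_right) auto
      also have "\<dots> = (\<Sum>j<k. c j * p j i) + p k i" by simp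
      also have "\<dots> = r i" using c that by (metis diff_add_cancel)
      finally show ?thesis using r0[OF that] by simp
    qed
    then have "?c k = 0" using indep[of ?c] kn by blast
    then show False by simp
  qed
  have "in_span n k q (\<lambda>i. (\<Sum>l<n. a i l * r l) - e k * r i)"
  proof (rule in_span_cong)
    show "in_span n k q (\<lambda>i. (\<Sum>l<k. b l k * p l i) + (\<Sum>l<k. (t l * (e l - e k)) * q l i))"
      by (intro in_span_add in_span_sum pq' in_span_member)
    fix i assume i: "i < n"
    have "(\<Sum>l<n. a i l * r l) = (\<Sum>l<n. a i l * p k l) + (\<Sum>l<n. a i l * (\<Sum>m<k. t m * q m l))"
      by (simp add: r_def distrib_left sum.distrib)
    also have "(\<Sum>l<n. a i l * (\<Sum>m<k. t m * q m l)) = (\<Sum>m<k. t m * (\<Sum>l<n. a i l * q m l))"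
      unfolding sum_distrib_left by (subst sum.swap) (simp add: mult_ac)
    also have "\<dots> = (\<Sum>m<k. t m * (e m * q m i))" using eig i by simp
    finally show "(\<Sum>l<k. b l k * p l i) + (\<Sum>l<k. (t l * (e l - e k)) * q l i) = (\<Sum>l<n. a i l * r l) - e k * r i"
      using flag[OF kn i]
      by (simp add: r_def algebra_simps sum_distrib_left sum_subtractf)
  qed
  then obtain g where g: "\<forall>i<n. (\<Sum>l<n. a i l * r l) - e k * r i = (\<Sum>l<k. g l * q l i)"
    unfolding in_span_def by blast
  \<comment> \<open>Pairing with \<open>q m\<close> and moving the matrix to the other side isolates \<open>g m\<close>.\<close>
  have g0: "g m = 0" if m: "m < k" for m
  proof -
    have "dot n (q m) (\<lambda>i. \<Sum>l<n. a i l * r l) = (\<Sum>i<n. \<Sum>l<n. q m i * (a i l * r l))"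
      by (simp add: dot_def sum_distrib_left)
    also have "\<dots> = (\<Sum>l<n. \<Sum>i<n. r l * (a l i * q m i))"
      by (subst sum.swap) (use sym in \<open>simp add: mult_ac\<close>)
    also have "\<dots> = (\<Sum>l<n. r l * (e m * q m l))"
      using eig[OF m] by (simp add: flip: sum_distrib_left)
    also have "\<dots> = e m * dot n (q m) r" by (simp add: dot_def sum_distrib_left mult_ac)
    finally have 1: "dot n (q m) (\<lambda>i. \<Sum>l<n. a i l * r l) = 0" using r_orth[OF m] by simp
    have "dot n (q m) (\<lambda>i. \<Sum>l<n. a i l * r l) = dot n (q m) (\<lambda>i. e k * r i + (\<Sum>l<k. g l * q l i))"
    proof (rule dot_cong)
      fix i assume "i < n"
      then have "(\<Sum>l<n. a i l * r l) - e k * r i = (\<Sum>l<k. g l * q l i)" using g by blast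
      then show "(\<Sum>l<n. a i l * r l) = e k * r i + (\<Sum>l<k. g l * q l i)" by linarith
    qed
    also have "\<dots> = dot n (q m) (\<lambda>i. e k * r i) + (\<Sum>l<k. g l * dot n (q m) (q l))" by (rule dot_lin)
    also have "dot n (q m) (\<lambda>i. e k * r i) = e k * dot n (q m) r" by (simp add: dot_def sum_distrib_left mult_ac)
    also have "(\<Sum>l<k. g l * dot n (q m) (q l)) = (\<Sum>l<k. if l = m then g m * dot n (q m) (q m) else 0)"
      using orth[OF m] by (intro sum.cong) auto
    also have "\<dots> = g m * dot n (q m) (q m)" using m by simp
    finally show ?thesis using 1 r_orth[OF m] pos[OF m] by simp
  qed
  have r_eig: "(\<Sum>l<n. a i l * r l) = e k * r i" if "i < n" for i
    using g g0 that by simp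
  define q' where "q' = q(k := r)"
  have q'_lt: "q' j = q j" if "j < k" for j using that by (simp add: q'_def)
  have q'_k: "q' k = r" by (simp add: q'_def)
  have in_span_q': "in_span n j q' y \<longleftrightarrow> in_span n j q y" if "j \<le> k" for j y
    using that q'_lt by (simp add: in_span_def)
  show ?case
  proof (intro exI[of _ q'] conjI allI impI)
    fix j assume "j < Suc k"
    then consider "j < k" | "j = k" by linarith
    note j = this
    show "(\<Sum>l<n. a i l * q' j l) = e j * q' j i" if "i < n" for i
      using j by cases (simp_all add: q'_lt q'_k eig r_eig that)
    show "0 < dot n (q' j) (q' j)" using j by cases (simp_all add: q'_lt q'_k pos r_pos)
    show "in_span n j p (\<lambda>i. q' j i - p j i)" using j by cases (simp_all add: q'_lt q'_k qp rp)
    show "in_span n j q' (\<lambda>i. p j i - q' j i)" using j by cases (simp_all add: q'_lt q'_k in_span_q' pq pr)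
  next
    fix i j assume ij: "i < Suc k" "j < Suc k" "i \<noteq> j"
    then consider "i < k" "j < k" | "i < k" "j = k" | "i = k" "j < k" by linarith
    then show "dot n (q' i) (q' j) = 0"
      by cases (use ij(3) in \<open>simp_all add: q'_lt q'_k orth r_orth comm[of r]\<close>)
  qed
qed auto

lemma of_real_char_poly:
  fixes A :: "real mat"
  assumes "A \<in> carrier_mat n n"
  shows "char_poly (map_mat complex_of_real A) = map_poly complex_of_real (char_poly A)"
  using of_real_hom.char_poly_hom[OF assms] .

lemma symmetric_eigenvalue_real:
  fixes A :: "real mat"
  assumes A: "A \<in> carrier_mat n n" and sym: "\<And>i j. i < n \<Longrightarrow> j < n \<Longrightarrow> A $$ (i, j) = A $$ (j, i)"
    and root: "poly (char_poly (map_mat complex_of_real A)) z = 0"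
  shows "z \<in> \<real>"
proof -
  let ?A = "map_mat complex_of_real A"
  have cA: "?A \<in> carrier_mat n n" using A by simp
  have "eigenvalue ?A z" using root eigenvalue_root_char_poly[OF cA] by simp
  then obtain v where v: "v \<in> carrier_vec n" "v \<noteq> 0\<^sub>v n" "?A *\<^sub>v v = z \<cdot>\<^sub>v v"
    using cA by (auto simp: eigenvalue_def eigenvector_def)
  have eq: "(\<Sum>j<n. complex_of_real (A $$ (i, j)) * v $ j) = z * v $ i" if "i < n" for i
  proof -
    have "(?A *\<^sub>v v) $ i = (\<Sum>j<n. complex_of_real (A $$ (i, j)) * v $ j)"
      using that v(1) A by (simp add: scalar_prod_def atLeast0LessThan)
    then show ?thesis using that v by simp
  qed
  define s where "s = (\<Sum>i<n. \<Sum>j<n. cnj (v $ i) * (complex_of_real (A $$ (i, j)) * v $ j))"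
  have "s = (\<Sum>i<n. z * (cnj (v $ i) * v $ i))"
    unfolding s_def
  proof (intro sum.cong refl)
    fix i assume "i \<in> {..<n}"
    then have "cnj (v $ i) * (\<Sum>j<n. complex_of_real (A $$ (i, j)) * v $ j) = z * (cnj (v $ i) * v $ i)"
      using eq[of i] by simp
    then show "(\<Sum>j<n. cnj (v $ i) * (complex_of_real (A $$ (i, j)) * v $ j)) = z * (cnj (v $ i) * v $ i)"
      by (simp only: sum_distrib_left)
  qed
  also have "\<dots> = z * of_real (\<Sum>i<n. (cmod (v $ i))\<^sup>2)"
  proof -
    have "cnj w * w = of_real ((cmod w)\<^sup>2)" for w by (simp only: complex_norm_square mult.commute)
    then show ?thesis by (simp only: of_real_sum sum_distrib_left)
  qed
  finally have "s = z * of_real (\<Sum>i<n. (cmod (v $ i))\<^sup>2)" .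
  then obtain w :: real where s1: "s = z * of_real w" and w: "w = (\<Sum>i<n. (cmod (v $ i))\<^sup>2)" by blast
  have "cnj s = (\<Sum>i<n. \<Sum>j<n. cnj (v $ j) * (complex_of_real (A $$ (j, i)) * v $ i))"
    unfolding s_def using sym by (simp add: mult_ac)
  also have "\<dots> = s" unfolding s_def by (rule sum.swap)
  finally have "cnj s = s" .
  moreover have "0 < (\<Sum>i<n. (cmod (v $ i))\<^sup>2)"
  proof -
    obtain i where "i < n" "v $ i \<noteq> 0" using v(1,2) by (metis carrier_vecD eq_vecI index_zero_vec)
    then show ?thesis by (intro sum_pos2[of _ i]) auto
  qed
  ultimately have "cnj z = z" unfolding s1 w[symmetric] by simp
  then show ?thesis by (simp add: Reals_cnj_iff)
qed

lemma symmetric_char_poly_splits: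
  fixes A :: "real mat"
  assumes A: "A \<in> carrier_mat n n" and sym: "\<And>i j. i < n \<Longrightarrow> j < n \<Longrightarrow> A $$ (i, j) = A $$ (j, i)"
  shows "\<exists>es. char_poly A = (\<Prod>e \<leftarrow> es. [:- e, 1:])"
proof -
  have cA: "map_mat complex_of_real A \<in> carrier_mat n n" using A by simp
  obtain as where as: "char_poly (map_mat complex_of_real A) = (\<Prod>a \<leftarrow> as. [:- a, 1:])"
    using char_poly_factorized[OF cA] by blast
  have real: "a \<in> \<real>" if "a \<in> set as" for a
  proof (rule symmetric_eigenvalue_real[OF A sym])
    show "poly (char_poly (map_mat complex_of_real A)) a = 0"
      unfolding as using that by (auto simp: poly_prod_list prod_list_zero_iff o_def)
  qed auto
  have "map_poly complex_of_real (char_poly A) = (\<Prod>a \<leftarrow> as. [:- a, 1:])"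
    using as of_real_char_poly[OF A] by simp
  also have "\<dots> = map_poly complex_of_real (\<Prod>e \<leftarrow> map Re as. [:- e, 1:])"
    using real
  proof (induction as)
    case (Cons a as)
    interpret h: map_poly_comm_ring_hom complex_of_real ..
    have 1: "[:- a, 1:] = map_poly complex_of_real [:- Re a, 1:]"
    proof -
      have "a \<in> \<real>" by (rule Cons.prems) simp
      then obtain r where "a = of_real r" by (rule Reals_cases)
      then show ?thesis by (simp add: map_poly_pCons)
    qed
    have 2: "(\<Prod>a \<leftarrow> as. [:- a, 1:]) = map_poly complex_of_real (\<Prod>e \<leftarrow> map Re as. [:- e, 1:])"
      by (rule Cons.IH) (rule Cons.prems, simp)
    show ?case by (simp only: list.map prod_list.Cons h.hom_mult 1 2)
  qed simp
  finally have eq: "map_poly complex_of_real (char_poly A) = map_poly complex_of_real (\<Prod>e \<leftarrow> map Re as. [:- e, 1:])" .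
  have "char_poly A = (\<Prod>e \<leftarrow> map Re as. [:- e, 1:])"
  proof (rule poly_eqI)
    fix i
    show "coeff (char_poly A) i = coeff (\<Prod>e \<leftarrow> map Re as. [:- e, 1:]) i"
      using arg_cong[OF eq, of "\<lambda>p. coeff p i"] unfolding coeff_map_poly[of complex_of_real, OF of_real_0] of_real_eq_iff .
  qed
  then show ?thesis by blast
qed

text \<open>A Schur decomposition exists for every ordering of the eigenvalues. Choosing the decreasing one matches
the orthogonal eigenvectors with the sorted roots of the characteristic polynomial.\<close>

theorem symmetric_matrix_spectrum:
  fixes A :: "real mat"
  assumes A: "A \<in> carrier_mat n n" and symmetric: "\<forall>i<n. \<forall>j<n. A $$ (i, j) = A $$ (j, i)"
  defines "es \<equiv> rev (sorted_list_of_multiset (proots (char_poly A)))"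
  shows "length es = n" and
    "\<exists>q. (\<forall>j<n. \<forall>i<n. (\<Sum>l<n. A $$ (i, l) * q j l) = es ! j * q j i) \<and>
      (\<forall>i<n. \<forall>j<n. i \<noteq> j \<longrightarrow> dot n (q i) (q j) = 0) \<and> (\<forall>j<n. 0 < dot n (q j) (q j)) \<and>
      (\<forall>y. in_span n n q y)"
proof -
  have sym: "A $$ (i, j) = A $$ (j, i)" if "i < n" "j < n" for i j using symmetric that by blast
  obtain es' where es': "char_poly A = (\<Prod>e \<leftarrow> es'. [:- e, 1:])"
    using symmetric_char_poly_splits[OF A sym] by blast
  have "proots (\<Prod>e \<leftarrow> es'. [:- e, 1::real:]) = mset es'"
  proof (induction es')
    case (Cons a l)
    have "(\<Prod>e \<leftarrow> l. [:- e, 1::real:]) \<noteq> 0" by (auto simp: prod_list_zero_iff)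
    then have "proots ([:- a, 1:] * (\<Prod>e \<leftarrow> l. [:- e, 1::real:])) = proots [:- a, 1:] + mset l"
      using proots_mult[of "[:- a, 1:]" "\<Prod>e \<leftarrow> l. [:- e, 1::real:]"] Cons.IH by simp
    then show ?case by (simp del: mult_pCons_left)
  qed simp
  then have "mset es = mset es'" unfolding es_def es' by simp
  then have "(\<Prod>e \<leftarrow> es. [:- e, 1:]) = (\<Prod>e \<leftarrow> es'. [:- e, 1::real:])"
    by (metis mset_map prod_mset_prod_list)
  then have es: "char_poly A = (\<Prod>e \<leftarrow> es. [:- e, 1:])" using es' by simp
  obtain B P Q where schur: "schur_decomposition A es = (B, P, Q)" by (cases "schur_decomposition A es") auto
  have wit: "similar_mat_wit A B P Q" and ut: "upper_triangular B" and diag: "diag_mat B = es"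
    using schur_decomposition[OF A es schur] by auto
  note D = similar_mat_witD2[OF A wit]
  note [simp] = D(4-7)
  have dims[simp]: "dim_row A = n" "dim_col A = n" "dim_row B = n" "dim_col B = n" "dim_row P = n" "dim_col P = n"
    "dim_row Q = n" "dim_col Q = n" using D(4-7)[THEN carrier_matD(1)] D(4-7)[THEN carrier_matD(2)] by simp_all
  show len: "length es = n" using diag by (auto simp: diag_mat_def)
  have e: "B $$ (j, j) = es ! j" if "j < n" for j
  proof -
    have "diag_mat B ! j = B $$ (j, j)" using that by (simp add: diag_mat_def)
    then show ?thesis unfolding diag by simp
  qed
  have AP: "A * P = P * B"
  proof -
    have "A * P = P * B * Q * P" using D(3) by simp
    also have "\<dots> = P * B * (Q * P)" by (rule assoc_mult_mat[of _ n n _ n _ n]) auto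
    also have "\<dots> = P * B" using D(2) right_mult_one_mat[of "P * B" n n] by simp
    finally show ?thesis .
  qed
  define p where "p j i = P $$ (i, j)" for j i
  have flag: "(\<Sum>l<n. A $$ (i, l) * p j l) = es ! j * p j i + (\<Sum>l<j. B $$ (l, j) * p l i)" if "j < n" "i < n" for i j
  proof -
    have "(\<Sum>l<n. A $$ (i, l) * p j l) = (A * P) $$ (i, j)"
      using that by (simp add: scalar_prod_def atLeast0LessThan p_def)
    also have "\<dots> = (\<Sum>l<n. P $$ (i, l) * B $$ (l, j))"
      unfolding AP using that by (simp add: scalar_prod_def atLeast0LessThan)
    also have "\<dots> = (\<Sum>l<Suc j. P $$ (i, l) * B $$ (l, j))"
      using that upper_triangularD[OF ut] by (intro sum.mono_neutral_right) auto
    also have "\<dots> = es ! j * p j i + (\<Sum>l<j. B $$ (l, j) * p l i)"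
      using e that by (simp add: p_def mult_ac)
    finally show ?thesis .
  qed
  have indep: "\<forall>j<n. c j = 0" if c: "\<And>i. i < n \<Longrightarrow> (\<Sum>j<n. c j * p j i) = 0" for c
  proof (intro allI impI)
    fix j assume j: "j < n"
    have P0: "P *\<^sub>v vec n c = 0\<^sub>v n"
    proof (rule eq_vecI)
      fix i assume "i < dim_vec (0\<^sub>v n :: real vec)"
      then show "(P *\<^sub>v vec n c) $ i = 0\<^sub>v n $ i"
        using c[of i] by (simp add: scalar_prod_def atLeast0LessThan p_def mult.commute)
    qed simp
    have "vec n c = (Q * P) *\<^sub>v vec n c" using D(2) by simp
    also have "\<dots> = Q *\<^sub>v (P *\<^sub>v vec n c)" by (rule assoc_mult_mat_vec[of _ n n _ n]) auto
    also have "\<dots> = 0\<^sub>v n" unfolding P0 by (rule eq_vecI) (auto simp: scalar_prod_def)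
    finally have "vec n c $ j = 0\<^sub>v n $ j" by simp
    then show "c j = 0" using j by simp
  qed
  have "\<exists>q. (\<forall>j<n. \<forall>i<n. (\<Sum>l<n. A $$ (i, l) * q j l) = es ! j * q j i) \<and>
    (\<forall>i<n. \<forall>j<n. i \<noteq> j \<longrightarrow> dot n (q i) (q j) = 0) \<and> (\<forall>j<n. 0 < dot n (q j) (q j)) \<and>
    (\<forall>j<n. in_span n j p (\<lambda>i. q j i - p j i)) \<and> (\<forall>j<n. in_span n j q (\<lambda>i. p j i - q j i))"
    by (rule orthogonal_eigenvectors_of_flag[where b = "\<lambda>l j. B $$ (l, j)"])
      (rule sym flag indep order_refl; assumption)+
  then obtain q where q: "\<forall>j<n. \<forall>i<n. (\<Sum>l<n. A $$ (i, l) * q j l) = es ! j * q j i"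
    "\<forall>i<n. \<forall>j<n. i \<noteq> j \<longrightarrow> dot n (q i) (q j) = 0" "\<forall>j<n. 0 < dot n (q j) (q j)"
    and pq: "\<forall>j<n. in_span n j q (\<lambda>i. p j i - q j i)"
    by (elim exE conjE)
  have "in_span n n q y" for y
  proof (rule in_span_trans)
    show "in_span n n p y"
      unfolding in_span_def
    proof (intro exI allI impI)
      fix i assume i: "i < n"
      have "vec n y = (P * Q) *\<^sub>v vec n y" using D(1) by simp
      also have "\<dots> = P *\<^sub>v (Q *\<^sub>v vec n y)" by (rule assoc_mult_mat_vec[of _ n n _ n]) auto
      finally have "vec n y $ i = (P *\<^sub>v (Q *\<^sub>v vec n y)) $ i" by simp
      then show "y i = (\<Sum>l<n. (Q *\<^sub>v vec n y) $ l * p l i)"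
        using i by (simp add: scalar_prod_def[of "row P i"] atLeast0LessThan p_def mult.commute)
    qed
    show "in_span n n q (p l)" if "l < n" for l
      by (rule in_span_of_sub[OF in_span_mono[of _ l] in_span_member]) (use pq that in auto)
  qed
  then show "\<exists>q. (\<forall>j<n. \<forall>i<n. (\<Sum>l<n. A $$ (i, l) * q j l) = es ! j * q j i) \<and>
      (\<forall>i<n. \<forall>j<n. i \<noteq> j \<longrightarrow> dot n (q i) (q j) = 0) \<and> (\<forall>j<n. 0 < dot n (q j) (q j)) \<and>
      (\<forall>y. in_span n n q y)"
    using q by blast
qed

section \<open>Eigenvalues and quadratic forms of graphs\<close>

lemma pair_graphD:
  assumes "pair_graph G"
  shows "finite (pverts G)" "(u, v) \<in> parcs G \<Longrightarrow> (v, u) \<in> parcs G" "(v, v) \<notin> parcs G"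
    "(u, v) \<in> parcs G \<Longrightarrow> u \<in> pverts G" "(u, v) \<in> parcs G \<Longrightarrow> v \<in> pverts G"
proof -
  interpret pair_graph G by fact
  show "finite (pverts G)" by (rule pair_finite_verts)
  show "(u, v) \<in> parcs G \<Longrightarrow> u \<in> pverts G" "(u, v) \<in> parcs G \<Longrightarrow> v \<in> pverts G"
    by (auto dest: arc_fst_in_verts arc_snd_in_verts)
  show "(u, v) \<in> parcs G \<Longrightarrow> (v, u) \<in> parcs G"
    using pair_sym_arcs by (auto simp: symmetric_def elim: symE)
  show "(v, v) \<notin> parcs G" using pair_no_loops by fastforce
qed

definition vertex_inner :: "'a pair_pre_digraph \<Rightarrow> ('a \<Rightarrow> real) \<Rightarrow> ('a \<Rightarrow> real) \<Rightarrow> real" where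
  "vertex_inner G x y = (\<Sum>v \<in> pverts G. x v * y v)"

text \<open>The bilinear form of the adjacency matrix.\<close>

definition adj_form :: "'a pair_pre_digraph \<Rightarrow> ('a \<Rightarrow> real) \<Rightarrow> ('a \<Rightarrow> real) \<Rightarrow> real" where
  "adj_form G x y = (\<Sum>v \<in> pverts G. \<Sum>w | w \<in> pverts G \<and> (v, w) \<in> parcs G. x v * y w)"

text \<open>The zero vector is admitted.\<close>

definition eigenvector_of :: "'a pair_pre_digraph \<Rightarrow> real \<Rightarrow> ('a \<Rightarrow> real) \<Rightarrow> bool" where
  "eigenvector_of G l x \<longleftrightarrow> (\<forall>v \<in> pverts G. (\<Sum>w | w \<in> pverts G \<and> (v, w) \<in> parcs G. x w) = l * x v)"

lemma graph_spectrum: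
  fixes G :: "'a::linorder pair_pre_digraph"
  assumes G: "pair_graph G"
  defines "n \<equiv> card (pverts G)" and "lam \<equiv> \<lambda>j. graph_eigenvalue (Suc j) G"
  obtains u where "\<And>j. j < n \<Longrightarrow> eigenvector_of G (lam j) (u j)"
    "\<And>i j. i < n \<Longrightarrow> j < n \<Longrightarrow> i \<noteq> j \<Longrightarrow> vertex_inner G (u i) (u j) = 0" "\<And>j. j < n \<Longrightarrow> 0 < vertex_inner G (u j) (u j)"
    "\<And>y. \<exists>c. \<forall>v \<in> pverts G. y v = (\<Sum>j<n. c j * u j v)"
    "\<And>i j. i \<le> j \<Longrightarrow> j < n \<Longrightarrow> lam j \<le> lam i"
proof -
  let ?V = "pverts G"
  define vs where "vs = sorted_list_of_set ?V"
  have fin: "finite ?V" using pair_graphD(1)[OF G] .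
  have vs: "distinct vs" "set vs = ?V" "length vs = n" using fin by (auto simp: vs_def n_def)
  have bij: "bij_betw ((!) vs) {..<n} ?V" using bij_betw_nth[OF vs(1)] vs(2,3) by simp
  define idx where "idx = the_inv_into {..<n} ((!) vs)"
  have idx_nth: "idx (vs ! i) = i" if "i < n" for i
    unfolding idx_def using the_inv_into_f_f[of "(!) vs" "{..<n}" i] bij that by (simp add: bij_betw_def)
  have nth_idx: "vs ! idx v = v" "idx v < n" if "v \<in> ?V" for v
    unfolding idx_def using f_the_inv_into_f_bij_betw[OF bij, of v] the_inv_into_into[of "(!) vs" "{..<n}" v "{..<n}"] bij that
    by (auto simp: bij_betw_def)
  have sum_V: "(\<Sum>v \<in> ?V. f v) = (\<Sum>i<n. f (vs ! i))" for f :: "'a \<Rightarrow> real"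
    using sum.reindex_bij_betw[OF bij, of f] by simp
  define A where "A = adjacency_matrix G"
  have A: "A \<in> carrier_mat n n" "\<And>i j. i < n \<Longrightarrow> j < n \<Longrightarrow> A $$ (i, j) = (if (vs ! i, vs ! j) \<in> parcs G then 1 else 0)"
    by (auto simp: A_def adjacency_matrix_def Let_def vs_def n_def)
  have sym: "\<forall>i<n. \<forall>j<n. A $$ (i, j) = A $$ (j, i)"
    using A(2) pair_graphD(2)[OF G] by auto
  define es where "es = rev (sorted_list_of_multiset (proots (char_poly A)))"
  have lam: "lam j = es ! j" for j by (simp add: lam_def graph_eigenvalue_def A_def es_def)
  note spec = symmetric_matrix_spectrum[OF A(1) sym, folded es_def]
  have len: "length es = n" by (rule spec(1))
  obtain q where q: "\<forall>j<n. \<forall>i<n. (\<Sum>l<n. A $$ (i, l) * q j l) = es ! j * q j i"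
    "\<forall>i<n. \<forall>j<n. i \<noteq> j \<longrightarrow> dot n (q i) (q j) = 0" "\<forall>j<n. 0 < dot n (q j) (q j)" "\<forall>y. in_span n n q y"
    using spec(2) by (elim exE conjE)
  define u where "u j v = q j (idx v)" for j v
  have vertex_inner_u: "vertex_inner G (u i) (u j) = dot n (q i) (q j)" for i j
    unfolding vertex_inner_def sum_V by (simp add: dot_def u_def idx_nth)
  show thesis
  proof (rule that[of u])
    show "eigenvector_of G (lam j) (u j)" if j: "j < n" for j
      unfolding eigenvector_of_def
    proof
      fix v assume v: "v \<in> ?V"
      have "(\<Sum>w | w \<in> ?V \<and> (v, w) \<in> parcs G. u j w) = (\<Sum>w \<in> ?V. if (v, w) \<in> parcs G then u j w else 0)"
        using fin by (simp add: sum.inter_filter)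
      also have "\<dots> = (\<Sum>l<n. if (v, vs ! l) \<in> parcs G then u j (vs ! l) else 0)" by (rule sum_V)
      also have "\<dots> = (\<Sum>l<n. A $$ (idx v, l) * q j l)"
        using A(2)[OF nth_idx(2)[OF v]] nth_idx(1)[OF v] by (intro sum.cong) (auto simp: u_def idx_nth)
      also have "\<dots> = lam j * u j v" using q(1) j nth_idx(2)[OF v] by (simp add: lam u_def)
      finally show "(\<Sum>w | w \<in> ?V \<and> (v, w) \<in> parcs G. u j w) = lam j * u j v" .
    qed
    show "vertex_inner G (u i) (u j) = 0" if "i < n" "j < n" "i \<noteq> j" for i j using q(2) that vertex_inner_u by simp
    show "0 < vertex_inner G (u j) (u j)" if "j < n" for j using q(3) that vertex_inner_u by simp
    show "\<exists>c. \<forall>v \<in> ?V. y v = (\<Sum>j<n. c j * u j v)" for y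
    proof -
      have "in_span n n q (\<lambda>i. y (vs ! i))" using q(4) by blast
      then obtain c where c: "\<forall>i<n. y (vs ! i) = (\<Sum>l<n. c l * q l i)" unfolding in_span_def by blast
      have "\<forall>v \<in> ?V. y v = (\<Sum>j<n. c j * u j v)"
      proof
        fix v assume v: "v \<in> ?V"
        have "y (vs ! idx v) = (\<Sum>l<n. c l * q l (idx v))" using c nth_idx(2)[OF v] by blast
        then show "y v = (\<Sum>j<n. c j * u j v)" unfolding nth_idx(1)[OF v] u_def .
      qed
      then show ?thesis by blast
    qed
    show "lam j \<le> lam i" if "i \<le> j" "j < n" for i j
    proof -
      have s: "sorted (rev es)" by (simp add: es_def)
      have "rev es ! (n - 1 - j) \<le> rev es ! (n - 1 - i)"
        by (rule sorted_nth_mono[OF s]) (use that len in auto)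
      moreover have "rev es ! (n - 1 - k) = es ! k" if "k < n" for k
        using that len by (subst rev_nth) auto
      ultimately show ?thesis using that by (simp add: lam)
    qed
  qed
qed

lemma adj_form_add_left: "adj_form G (\<lambda>v. x v + x' v) y = adj_form G x y + adj_form G x' y"
  by (simp add: adj_form_def distrib_right sum.distrib)

lemma adj_form_add_right: "adj_form G x (\<lambda>v. y v + y' v) = adj_form G x y + adj_form G x y'"
  by (simp add: adj_form_def distrib_left sum.distrib)

lemma adj_form_scale_left: "adj_form G (\<lambda>v. s * x v) y = s * adj_form G x y"
  by (simp add: adj_form_def sum_distrib_left mult.assoc)

lemma adj_form_scale_right: "adj_form G x (\<lambda>v. s * y v) = s * adj_form G x y"
  by (simp add: adj_form_def sum_distrib_left mult.left_commute)

lemma vertex_inner_add_left: "vertex_inner G (\<lambda>v. x v + x' v) y = vertex_inner G x y + vertex_inner G x' y"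
  by (simp add: vertex_inner_def distrib_right sum.distrib)

lemma vertex_inner_scale_left: "vertex_inner G (\<lambda>v. s * x v) y = s * vertex_inner G x y"
  by (simp add: vertex_inner_def sum_distrib_left mult.assoc)

lemma vertex_inner_commute: "vertex_inner G x y = vertex_inner G y x"
  by (simp add: vertex_inner_def mult.commute)

lemma vertex_inner_nonneg: "0 \<le> vertex_inner G x x"
  unfolding vertex_inner_def by (intro sum_nonneg) simp

lemma vertex_inner_pos: "finite (pverts G) \<Longrightarrow> v \<in> pverts G \<Longrightarrow> x v \<noteq> 0 \<Longrightarrow> 0 < vertex_inner G x x"
  unfolding vertex_inner_def by (intro sum_pos2[of _ v]) (auto simp: zero_less_mult_iff linorder_neq_iff)

lemma vertex_inner_cong: "(\<And>v. v \<in> pverts G \<Longrightarrow> x v = x' v) \<Longrightarrow> vertex_inner G x y = vertex_inner G x' y"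
  by (simp add: vertex_inner_def)

lemma adj_form_cong: "(\<And>v. v \<in> pverts G \<Longrightarrow> x v = x' v) \<Longrightarrow> (\<And>v. v \<in> pverts G \<Longrightarrow> y v = y' v) \<Longrightarrow> adj_form G x y = adj_form G x' y'"
  by (simp add: adj_form_def)

lemma adj_form_commute:
  assumes "pair_graph G"
  shows "adj_form G x y = adj_form G y x"
proof -
  have fin: "finite (pverts G)" using pair_graphD(1)[OF assms] .
  have sym: "(v, w) \<in> parcs G \<longleftrightarrow> (w, v) \<in> parcs G" for v w using pair_graphD(2)[OF assms] by blast
  have "adj_form G x y = (\<Sum>w \<in> pverts G. \<Sum>v | v \<in> pverts G \<and> (v, w) \<in> parcs G. x v * y w)"
    unfolding adj_form_def by (rule sum.swap_restrict[OF fin fin])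
  also have "\<dots> = adj_form G y x" unfolding adj_form_def by (intro sum.cong) (use sym in \<open>auto simp: mult.commute\<close>)
  finally show ?thesis .
qed

lemma adj_form_eigenvector: "eigenvector_of G l x \<Longrightarrow> adj_form G y x = l * vertex_inner G y x"
proof -
  assume x: "eigenvector_of G l x"
  have "adj_form G y x = (\<Sum>v \<in> pverts G. y v * (\<Sum>w | w \<in> pverts G \<and> (v, w) \<in> parcs G. x w))"
    by (simp add: adj_form_def sum_distrib_left)
  also have "\<dots> = (\<Sum>v \<in> pverts G. y v * (l * x v))"
    using x by (intro sum.cong) (auto simp: eigenvector_of_def)
  finally show ?thesis by (simp add: vertex_inner_def sum_distrib_left mult.left_commute)
qed

lemma vertex_inner_sum_left: "vertex_inner G (\<lambda>v. \<Sum>j<n. c j * u j v) y = (\<Sum>j<n. c j * vertex_inner G (u j) y)" for n :: nat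
  by (induction n) (simp_all add: vertex_inner_add_left vertex_inner_scale_left vertex_inner_def[of G "\<lambda>v. 0"])

lemma adj_form_sum_right: "adj_form G y (\<lambda>v. \<Sum>j<n. c j * u j v) = (\<Sum>j<n. c j * adj_form G y (u j))" for n :: nat
  by (induction n) (simp_all add: adj_form_add_right adj_form_scale_right adj_form_def[of G _ "\<lambda>v. 0"])

text \<open>In an orthogonal basis of eigenvectors both forms are diagonal, which gives the Rayleigh bounds.\<close>

lemma top_eigenvectors:
  fixes G :: "'a::linorder pair_pre_digraph"
  assumes G: "pair_graph G" and V: "pverts G \<noteq> {}"
  obtains u where "\<And>j. j < card (pverts G) \<Longrightarrow> eigenvector_of G (graph_eigenvalue (Suc j) G) (u j)"
    "\<And>j. j < card (pverts G) \<Longrightarrow> 0 < vertex_inner G (u j) (u j)"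
    "1 < card (pverts G) \<Longrightarrow> vertex_inner G (u 0) (u 1) = 0"
    "1 < card (pverts G) \<Longrightarrow> graph_eigenvalue 2 G \<le> graph_eigenvalue 1 G"
    "\<And>y. adj_form G y y \<le> graph_eigenvalue 1 G * vertex_inner G y y"
    "\<And>y. 1 < card (pverts G) \<Longrightarrow> vertex_inner G y (u 0) = 0 \<Longrightarrow> adj_form G y y \<le> graph_eigenvalue 2 G * vertex_inner G y y"
proof -
  define n where "n = card (pverts G)"
  have n: "0 < n" using V pair_graphD(1)[OF G] by (simp add: n_def card_gt_0_iff)
  define lam where "lam j = graph_eigenvalue (Suc j) G" for j
  obtain u where eig: "\<And>j. j < n \<Longrightarrow> eigenvector_of G (lam j) (u j)"
    and orth: "\<And>i j. i < n \<Longrightarrow> j < n \<Longrightarrow> i \<noteq> j \<Longrightarrow> vertex_inner G (u i) (u j) = 0"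
    and pos: "\<And>j. j < n \<Longrightarrow> 0 < vertex_inner G (u j) (u j)"
    and span: "\<And>y. \<exists>c. \<forall>v \<in> pverts G. y v = (\<Sum>j<n. c j * u j v)"
    and mono: "\<And>i j. i \<le> j \<Longrightarrow> j < n \<Longrightarrow> lam j \<le> lam i"
    unfolding n_def lam_def by (rule graph_spectrum[OF G]) blast
  have expand: "\<exists>c. (\<forall>j<n. vertex_inner G y (u j) = c j * vertex_inner G (u j) (u j)) \<and>
      vertex_inner G y y = (\<Sum>j<n. (c j)\<^sup>2 * vertex_inner G (u j) (u j)) \<and> adj_form G y y = (\<Sum>j<n. lam j * ((c j)\<^sup>2 * vertex_inner G (u j) (u j)))" for y
  proof -
    obtain c where c: "\<And>v. v \<in> pverts G \<Longrightarrow> y v = (\<Sum>j<n. c j * u j v)" using span by metis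
    have y_u: "vertex_inner G y (u j) = c j * vertex_inner G (u j) (u j)" if "j < n" for j
    proof -
      have "vertex_inner G y (u j) = (\<Sum>i<n. c i * vertex_inner G (u i) (u j))"
        by (rule trans[OF vertex_inner_cong[OF c] vertex_inner_sum_left])
      also have "\<dots> = (\<Sum>i<n. if i = j then c j * vertex_inner G (u j) (u j) else 0)"
        using orth that by (intro sum.cong) auto
      finally show ?thesis using that by simp
    qed
    have "vertex_inner G y y = (\<Sum>j<n. c j * vertex_inner G (u j) y)"
      by (rule trans[OF vertex_inner_cong[OF c] vertex_inner_sum_left])
    also have "\<dots> = (\<Sum>j<n. (c j)\<^sup>2 * vertex_inner G (u j) (u j))"
      using y_u by (intro sum.cong) (auto simp: vertex_inner_commute[of G _ y] power2_eq_square)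
    finally have yy: "vertex_inner G y y = (\<Sum>j<n. (c j)\<^sup>2 * vertex_inner G (u j) (u j))" .
    have "adj_form G y y = adj_form G y (\<lambda>v. \<Sum>j<n. c j * u j v)" using c by (intro adj_form_cong) auto
    also have "\<dots> = (\<Sum>j<n. c j * adj_form G y (u j))" by (rule adj_form_sum_right)
    also have "\<dots> = (\<Sum>j<n. lam j * ((c j)\<^sup>2 * vertex_inner G (u j) (u j)))"
      using y_u adj_form_eigenvector[OF eig] by (intro sum.cong) (auto simp: power2_eq_square)
    finally show ?thesis using y_u yy by blast
  qed
  show thesis
  proof (rule that[of u])
    show "adj_form G y y \<le> graph_eigenvalue 1 G * vertex_inner G y y" for y
    proof -
      obtain c where c: "vertex_inner G y y = (\<Sum>j<n. (c j)\<^sup>2 * vertex_inner G (u j) (u j))"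
        "adj_form G y y = (\<Sum>j<n. lam j * ((c j)\<^sup>2 * vertex_inner G (u j) (u j)))" using expand by blast
      have "adj_form G y y \<le> (\<Sum>j<n. lam 0 * ((c j)\<^sup>2 * vertex_inner G (u j) (u j)))"
        unfolding c using mono by (intro sum_mono mult_right_mono mult_nonneg_nonneg vertex_inner_nonneg) auto
      also have "\<dots> = lam 0 * vertex_inner G y y" by (simp add: c sum_distrib_left)
      finally show ?thesis by (simp add: lam_def)
    qed
    show "adj_form G y y \<le> graph_eigenvalue 2 G * vertex_inner G y y" if "1 < card (pverts G)" "vertex_inner G y (u 0) = 0" for y
    proof -
      obtain c where c: "vertex_inner G y y = (\<Sum>j<n. (c j)\<^sup>2 * vertex_inner G (u j) (u j))"
        "adj_form G y y = (\<Sum>j<n. lam j * ((c j)\<^sup>2 * vertex_inner G (u j) (u j)))"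
        "vertex_inner G y (u 0) = c 0 * vertex_inner G (u 0) (u 0)" using expand n by blast
      have c0: "c 0 = 0" using c(3) that(2) pos[OF n] by simp
      have "adj_form G y y \<le> (\<Sum>j<n. lam 1 * ((c j)\<^sup>2 * vertex_inner G (u j) (u j)))"
        unfolding c
      proof (intro sum_mono)
        fix j assume "j \<in> {..<n}"
        then show "lam j * ((c j)\<^sup>2 * vertex_inner G (u j) (u j)) \<le> lam 1 * ((c j)\<^sup>2 * vertex_inner G (u j) (u j))"
          using c0 mono[of 1 j] by (cases "j = 0") (auto intro!: mult_right_mono mult_nonneg_nonneg vertex_inner_nonneg)
      qed
      also have "\<dots> = lam 1 * vertex_inner G y y" by (simp add: c sum_distrib_left)
      finally show ?thesis by (simp add: lam_def numeral_2_eq_2)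
    qed
    show "graph_eigenvalue 2 G \<le> graph_eigenvalue 1 G" if "1 < card (pverts G)"
      using mono[of 0 1] that by (simp add: lam_def n_def numeral_2_eq_2)
  qed (use eig orth pos in \<open>auto simp: lam_def n_def\<close>)
qed

text \<open>Perturbing the single entry at \<open>v\<close> by \<open>t\<close> changes the difference of the two sides of the Rayleigh inequality by \<open>2 t (s - l x\<^sub>v) + O(t\<^sup>2)\<close>,
where \<open>s\<close> is the sum over the neighbours of \<open>v\<close>.\<close>

lemma maximiser_eigenvector:
  assumes G: "pair_graph G" and max: "\<And>y. adj_form G y y \<le> l * vertex_inner G y y" and eq: "adj_form G x x = l * vertex_inner G x x"
  shows "eigenvector_of G l x"
  unfolding eigenvector_of_def
proof
  fix v assume v: "v \<in> pverts G"
  note fin = pair_graphD(1)[OF G]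
  define d where "d w = (if w = v then 1 else 0 :: real)" for w
  define s where "s = (\<Sum>w | w \<in> pverts G \<and> (v, w) \<in> parcs G. x w)"
  have bdx: "adj_form G d x = s"
  proof -
    have "adj_form G d x = (\<Sum>u \<in> pverts G. if u = v then s else 0)"
      unfolding adj_form_def s_def by (intro sum.cong) (auto simp: d_def)
    then show ?thesis using fin v by simp
  qed
  have bdd: "adj_form G d d = 0"
    unfolding adj_form_def using pair_graphD(3)[OF G] by (intro sum.neutral ballI) (auto simp: d_def)
  have vdx: "vertex_inner G d x = x v" and vdd: "vertex_inner G d d = 1"
    using fin v by (simp_all add: vertex_inner_def d_def if_distrib[of "\<lambda>a. a * _"] cong: if_cong)
  have key: "2 * t * (s - l * x v) \<le> l * t\<^sup>2" for t
  proof -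
    have "adj_form G (\<lambda>w. x w + t * d w) (\<lambda>w. x w + t * d w) = adj_form G x x + 2 * t * s"
      using bdx bdd adj_form_commute[OF G, of x d]
      by (simp add: adj_form_add_left adj_form_add_right adj_form_scale_left adj_form_scale_right)
    moreover have "vertex_inner G (\<lambda>w. x w + t * d w) (\<lambda>w. x w + t * d w) = vertex_inner G x x + 2 * t * x v + t\<^sup>2"
    proof -
      have right: "vertex_inner G z (\<lambda>w. x w + t * d w) = vertex_inner G z x + t * vertex_inner G z d" for z
        by (metis vertex_inner_add_left vertex_inner_commute vertex_inner_scale_left)
      show ?thesis
        using vdx vdd vertex_inner_commute[of G x d]
        by (simp add: right vertex_inner_add_left vertex_inner_scale_left power2_eq_square algebra_simps)
    qed
    ultimately show ?thesis using max[of "\<lambda>w. x w + t * d w"] eq by (simp add: algebra_simps)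
  qed
  define r where "r = s - l * x v"
  have "r = 0"
  proof (rule ccontr)
    assume r: "r \<noteq> 0"
    \<comment> \<open>At \<open>t = r / k\<close> the linear term \<open>2 t r\<close> is \<open>2 k t\<^sup>2\<close>, which exceeds \<open>l t\<^sup>2\<close>.\<close>
    define k where "k = \<bar>l\<bar> + 1"
    have k: "0 < k" "l < 2 * k" by (auto simp: k_def)
    have "2 * (r / k) * r \<le> l * (r / k)\<^sup>2" using key[of "r / k"] by (simp add: r_def)
    then have "2 * k * (r / k)\<^sup>2 \<le> l * (r / k)\<^sup>2" using k by (simp add: power2_eq_square field_simps)
    moreover have "0 < (r / k)\<^sup>2" using r k by simp
    ultimately show False using k(2) by simp
  qed
  then show "(\<Sum>w | w \<in> pverts G \<and> (v, w) \<in> parcs G. x w) = l * x v" by (simp add: r_def s_def)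
qed

text \<open>Connectivity in the form that suits arguments about the support of a vector.\<close>

definition boundary_connected :: "'a pair_pre_digraph \<Rightarrow> bool" where
  "boundary_connected G \<longleftrightarrow> (\<forall>S. S \<subseteq> pverts G \<longrightarrow> S \<noteq> {} \<longrightarrow> S \<noteq> pverts G \<longrightarrow>
    (\<exists>u v. u \<in> S \<and> v \<in> pverts G - S \<and> (u, v) \<in> parcs G))"

text \<open>An arc leaving the support ends in a vertex with entry \<open>0\<close> but positive sum over its neighbours.\<close>

lemma nonneg_eigenvector_pos:
  assumes G: "pair_graph G" "boundary_connected G" and x: "eigenvector_of G l x" "\<And>v. v \<in> pverts G \<Longrightarrow> 0 \<le> x v"
    and nz: "\<exists>v \<in> pverts G. x v \<noteq> 0"
  shows "\<forall>v \<in> pverts G. 0 < x v"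
proof (rule ccontr)
  define S where "S = {v \<in> pverts G. 0 < x v}"
  assume "\<not> ?thesis"
  then have "S \<noteq> pverts G" "S \<subseteq> pverts G" "S \<noteq> {}"
    using nz x(2) by (auto simp: S_def less_eq_real_def)
  then obtain u v where uv: "u \<in> S" "v \<in> pverts G - S" "(u, v) \<in> parcs G"
    using G(2) unfolding boundary_connected_def by metis
  have "x v = 0" using uv(2) x(2)[of v] by (auto simp: S_def)
  then have "(\<Sum>w | w \<in> pverts G \<and> (v, w) \<in> parcs G. x w) = 0"
    using x(1) uv(2) by (simp add: eigenvector_of_def)
  moreover have "0 < (\<Sum>w | w \<in> pverts G \<and> (v, w) \<in> parcs G. x w)"
    using uv pair_graphD[OF G(1)] x(2) by (intro sum_pos2[of _ u]) (auto simp: S_def)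
  ultimately show False by simp
qed

text \<open>The modulus of a top eigenvector is again one, hence positive. A second eigenvector can be chosen orthogonal
to it and then takes both signs.\<close>

lemma second_eigenvector_signs:
  fixes G :: "'a::linorder pair_pre_digraph"
  assumes G: "pair_graph G" "boundary_connected G" and card: "1 < card (pverts G)"
  obtains x where "eigenvector_of G (graph_eigenvalue 2 G) x" "\<exists>v \<in> pverts G. 0 < x v" "\<exists>v \<in> pverts G. x v < 0"
proof -
  have V: "pverts G \<noteq> {}" using card by auto
  note fin = pair_graphD(1)[OF G(1)]
  obtain u where U: "\<And>j. j < card (pverts G) \<Longrightarrow> eigenvector_of G (graph_eigenvalue (Suc j) G) (u j)"
    "\<And>j. j < card (pverts G) \<Longrightarrow> 0 < vertex_inner G (u j) (u j)"
    "1 < card (pverts G) \<Longrightarrow> vertex_inner G (u 0) (u 1) = 0"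
    "1 < card (pverts G) \<Longrightarrow> graph_eigenvalue 2 G \<le> graph_eigenvalue 1 G"
    "\<And>y. adj_form G y y \<le> graph_eigenvalue 1 G * vertex_inner G y y"
    "\<And>y. 1 < card (pverts G) \<Longrightarrow> vertex_inner G y (u 0) = 0 \<Longrightarrow> adj_form G y y \<le> graph_eigenvalue 2 G * vertex_inner G y y"
    by (rule top_eigenvectors[OF G(1) V]) blast
  note u = U(1,2) U(3)[OF card] U(5)
  let ?l = "graph_eigenvalue 1 G" and ?l2 = "graph_eigenvalue 2 G"
  have e: "eigenvector_of G ?l (u 0)" "eigenvector_of G ?l2 (u 1)" "0 < vertex_inner G (u 0) (u 0)" "0 < vertex_inner G (u 1) (u 1)"
    using u(1,2)[of 0] u(1,2)[of 1] card by (auto simp: numeral_2_eq_2)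
  define w where "w v = \<bar>u 0 v\<bar>" for v
  have vw: "vertex_inner G w w = vertex_inner G (u 0) (u 0)" by (simp add: vertex_inner_def w_def abs_mult_self_eq)
  have "adj_form G (u 0) (u 0) \<le> adj_form G w w"
    unfolding adj_form_def w_def by (intro sum_mono) (simp flip: abs_mult)
  then have "adj_form G w w = ?l * vertex_inner G w w"
    using adj_form_eigenvector[OF e(1), of "u 0"] u(4)[of w] vw by simp
  then have w_eig: "eigenvector_of G ?l w" by (rule maximiser_eigenvector[OF G(1) u(4)])
  have w_pos: "\<forall>v \<in> pverts G. 0 < w v"
  proof (rule nonneg_eigenvector_pos[OF G w_eig])
    show "\<exists>v \<in> pverts G. w v \<noteq> 0"
    proof (rule ccontr)
      assume "\<not> ?thesis"
      then have "vertex_inner G w w = 0" by (simp add: vertex_inner_def)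
      then show False using vw e(3) by simp
    qed
  qed (simp add: w_def)
  have "\<exists>x. eigenvector_of G ?l2 x \<and> vertex_inner G x w = 0 \<and> 0 < vertex_inner G x x"
  proof (cases "vertex_inner G (u 1) w = 0")
    case True
    then show ?thesis using e by blast
  next
    case False
    have "?l * vertex_inner G (u 1) w = adj_form G (u 1) w" using adj_form_eigenvector[OF w_eig] by simp
    also have "\<dots> = adj_form G w (u 1)" by (rule adj_form_commute[OF G(1)])
    also have "\<dots> = ?l2 * vertex_inner G (u 1) w" using adj_form_eigenvector[OF e(2)] by (simp add: vertex_inner_commute)
    finally have l: "?l = ?l2" using False by simp
    define x where "x v = vertex_inner G (u 0) w * u 1 v + (- vertex_inner G (u 1) w) * u 0 v" for v
    have "eigenvector_of G ?l2 x"
      unfolding eigenvector_of_def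
    proof
      fix v assume v: "v \<in> pverts G"
      have "(\<Sum>w | w \<in> pverts G \<and> (v, w) \<in> parcs G. u 0 w) = ?l2 * u 0 v"
        "(\<Sum>w | w \<in> pverts G \<and> (v, w) \<in> parcs G. u 1 w) = ?l2 * u 1 v"
        using e v l by (simp_all add: eigenvector_of_def)
      then show "(\<Sum>w | w \<in> pverts G \<and> (v, w) \<in> parcs G. x w) = ?l2 * x v"
        unfolding x_def sum.distrib sum_distrib_left[symmetric] by (simp add: algebra_simps)
    qed
    moreover have "vertex_inner G x w = 0" unfolding x_def vertex_inner_add_left vertex_inner_scale_left by simp
    moreover have "0 < vertex_inner G x x"
    proof -
      have "vertex_inner G x (u 0) = - vertex_inner G (u 1) w * vertex_inner G (u 0) (u 0)"
        unfolding x_def vertex_inner_add_left vertex_inner_scale_left using u(3) by (simp add: vertex_inner_commute)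
      then have "vertex_inner G x (u 0) \<noteq> 0" using False e(3) by simp
      then obtain v where "v \<in> pverts G" "x v \<noteq> 0"
        unfolding vertex_inner_def by (metis (no_types, lifting) mult_zero_left sum.neutral)
      then show ?thesis using vertex_inner_pos[OF fin] by blast
    qed
    ultimately show ?thesis by blast
  qed
  then obtain x where x: "eigenvector_of G ?l2 x" "vertex_inner G x w = 0" "0 < vertex_inner G x x" by blast
  obtain v0 where v0: "v0 \<in> pverts G" "x v0 \<noteq> 0"
    using x(3) unfolding vertex_inner_def by (metis (no_types, lifting) less_irrefl mult_zero_left sum.neutral)
  have sign: "\<exists>v \<in> pverts G. 0 < s * x v" if s: "s = 1 \<or> s = -1" for s :: real
  proof (rule ccontr)
    assume neg: "\<not> ?thesis"
    have "0 < (\<Sum>v \<in> pverts G. (- s) * (x v * w v))"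
    proof (rule sum_pos2[of _ v0])
      have le: "0 \<le> - s * x v" if "v \<in> pverts G" for v using neg that by force
      show "0 \<le> - s * (x v * w v)" if "v \<in> pverts G" for v
        using mult_nonneg_nonneg[OF le[OF that], of "w v"] w_pos that by (simp add: less_imp_le mult.assoc)
      have "0 < - s * x v0" using le[OF v0(1)] v0(2) s by auto
      then show "0 < - s * (x v0 * w v0)"
        using mult_pos_pos[of "- s * x v0" "w v0"] w_pos v0 by (simp add: mult.assoc)
    qed (use fin v0 in auto)
    also have "\<dots> = - s * vertex_inner G x w" by (simp add: vertex_inner_def sum_distrib_left)
    finally show False using x(2) by simp
  qed
  show thesis using that[OF x(1)] sign[of 1] sign[of "-1"] by simp
qed

text \<open>Some nontrivial combination of the two test vectors is orthogonal to a top eigenvector, and the forms do not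
mix the two supports.\<close>

lemma second_eigenvalue_ge:
  fixes G :: "'a::linorder pair_pre_digraph"
  assumes G: "pair_graph G" and card: "1 < card (pverts G)"
    and S: "S \<subseteq> pverts G" "T \<subseteq> pverts G" "S \<inter> T = {}"
    and no_edge: "\<And>u v. u \<in> S \<Longrightarrow> v \<in> T \<Longrightarrow> (u, v) \<notin> parcs G"
    and supp: "\<And>v. v \<notin> S \<Longrightarrow> y v = 0" "\<And>v. v \<notin> T \<Longrightarrow> z v = 0"
    and ge: "l * vertex_inner G y y \<le> adj_form G y y" "l * vertex_inner G z z \<le> adj_form G z z" and pos: "0 < vertex_inner G y y" "0 < vertex_inner G z z"
  shows "l \<le> graph_eigenvalue 2 G"
proof -
  have V: "pverts G \<noteq> {}" using card by auto
  obtain u where U: "\<And>j. j < card (pverts G) \<Longrightarrow> eigenvector_of G (graph_eigenvalue (Suc j) G) (u j)"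
    "\<And>j. j < card (pverts G) \<Longrightarrow> 0 < vertex_inner G (u j) (u j)"
    "1 < card (pverts G) \<Longrightarrow> vertex_inner G (u 0) (u 1) = 0"
    "1 < card (pverts G) \<Longrightarrow> graph_eigenvalue 2 G \<le> graph_eigenvalue 1 G"
    "\<And>y. adj_form G y y \<le> graph_eigenvalue 1 G * vertex_inner G y y"
    "\<And>y. 1 < card (pverts G) \<Longrightarrow> vertex_inner G y (u 0) = 0 \<Longrightarrow> adj_form G y y \<le> graph_eigenvalue 2 G * vertex_inner G y y"
    by (rule top_eigenvectors[OF G V]) blast
  note u = U(6)[OF card]
  obtain a b :: real where ab: "a * vertex_inner G y (u 0) + b * vertex_inner G z (u 0) = 0" "a \<noteq> 0 \<or> b \<noteq> 0"
  proof (cases "vertex_inner G y (u 0) = 0")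
    case True
    then show ?thesis using that[of 1 0] by simp
  next
    case False
    then show ?thesis using that[of "vertex_inner G z (u 0)" "- vertex_inner G y (u 0)"] by simp
  qed
  define x where "x v = a * y v + b * z v" for v
  have yz: "vertex_inner G y z = 0" unfolding vertex_inner_def using supp S(3) by (intro sum.neutral) (metis disjoint_iff mult_eq_0_iff)
  have byz: "adj_form G y z = 0" unfolding adj_form_def using supp no_edge by (intro sum.neutral ballI) (metis (no_types, lifting) mem_Collect_eq mult_eq_0_iff)
  have vx: "vertex_inner G x x = a\<^sup>2 * vertex_inner G y y + b\<^sup>2 * vertex_inner G z z"
  proof -
    have right: "vertex_inner G t x = a * vertex_inner G t y + b * vertex_inner G t z" for t
      unfolding x_def by (metis vertex_inner_add_left vertex_inner_commute vertex_inner_scale_left)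
    have "vertex_inner G x x = a * vertex_inner G y x + b * vertex_inner G z x"
      unfolding x_def by (simp add: vertex_inner_add_left vertex_inner_scale_left)
    then show ?thesis using yz vertex_inner_commute[of G y z] by (simp add: right power2_eq_square)
  qed
  have bx: "adj_form G x x = a\<^sup>2 * adj_form G y y + b\<^sup>2 * adj_form G z z"
    unfolding x_def using byz adj_form_commute[OF G, of y z]
    by (simp add: adj_form_add_left adj_form_add_right adj_form_scale_left adj_form_scale_right power2_eq_square)
  have "vertex_inner G x (u 0) = 0" unfolding x_def using ab(1) by (simp add: vertex_inner_add_left vertex_inner_scale_left)
  then have "adj_form G x x \<le> graph_eigenvalue 2 G * vertex_inner G x x" by (rule u)
  moreover have "l * vertex_inner G x x \<le> adj_form G x x"
    unfolding vx bx using mult_left_mono[OF ge(1), of "a\<^sup>2"] mult_left_mono[OF ge(2), of "b\<^sup>2"]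
    by (simp add: algebra_simps)
  moreover have "0 < vertex_inner G x x"
  proof -
    have "0 \<le> a\<^sup>2 * vertex_inner G y y" "0 \<le> b\<^sup>2 * vertex_inner G z z" using pos by simp_all
    moreover have "0 < a\<^sup>2 * vertex_inner G y y \<or> 0 < b\<^sup>2 * vertex_inner G z z" using ab(2) pos by auto
    ultimately show ?thesis unfolding vx by linarith
  qed
  ultimately show ?thesis by (meson dual_order.trans mult_le_cancel_right_pos)
qed

section \<open>Connectivity\<close>

lemma connected_iff_boundary_arc:
  "Digraph_Component.connected H \<longleftrightarrow> verts H \<noteq> {} \<and> (\<forall>S. S \<subseteq> verts H \<longrightarrow> S \<noteq> {} \<longrightarrow> S \<noteq> verts H \<longrightarrow>
    (\<exists>u v. u \<in> S \<and> v \<in> verts H - S \<and> (\<exists>e \<in> arcs H. (tail H e, head H e) \<in> {(u, v), (v, u)})))"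
proof -
  define r where "r = parcs (mk_symmetric H)"
  have r: "(u, v) \<in> r \<longleftrightarrow> (\<exists>e \<in> arcs H. (tail H e, head H e) \<in> {(u, v), (v, u)})" for u v
    unfolding r_def mk_symmetric_def by auto
  have pv: "pverts (mk_symmetric H) = verts H" by (simp add: mk_symmetric_def)
  have conn: "Digraph_Component.connected H \<longleftrightarrow>
      verts H \<noteq> {} \<and> (\<forall>u \<in> verts H. \<forall>v \<in> verts H. (u, v) \<in> rtrancl_on (verts H) r)"
    unfolding Digraph_Component.connected_def strongly_connected_def reachable_def with_proj_simps pv r_def ..
  show ?thesis
    unfolding conn r[symmetric]
  proof (intro conj_cong refl iffI allI impI ballI)
    fix S assume all: "\<forall>u \<in> verts H. \<forall>v \<in> verts H. (u, v) \<in> rtrancl_on (verts H) r"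
      and S: "S \<subseteq> verts H" "S \<noteq> {}" "S \<noteq> verts H"
    obtain a b where ab: "a \<in> S" "b \<in> verts H - S" using S by blast
    show "\<exists>u v. u \<in> S \<and> v \<in> verts H - S \<and> (u, v) \<in> r"
    proof (rule ccontr)
      assume neg: "\<not> ?thesis"
      have "(a, b) \<in> rtrancl_on (verts H) r" using all ab S by blast
      then have "b \<in> S"
        by (induction rule: rtrancl_on_induct) (use neg ab in auto)
      then show False using ab by simp
    qed
  next
    fix u v assume all: "\<forall>S. S \<subseteq> verts H \<longrightarrow> S \<noteq> {} \<longrightarrow> S \<noteq> verts H \<longrightarrow> (\<exists>u v. u \<in> S \<and> v \<in> verts H - S \<and> (u, v) \<in> r)"
      and uv: "u \<in> verts H" "v \<in> verts H"
    define S where "S = {w \<in> verts H. (u, w) \<in> rtrancl_on (verts H) r}"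
    have "u \<in> S" using uv(1) by (simp add: S_def rtrancl_on_refl)
    have "S = verts H"
    proof (rule ccontr)
      assume "S \<noteq> verts H"
      moreover have "S \<subseteq> verts H" "S \<noteq> {}" using \<open>u \<in> S\<close> by (auto simp: S_def)
      ultimately have "\<exists>a b. a \<in> S \<and> b \<in> verts H - S \<and> (a, b) \<in> r" using all by metis
      then obtain a b where ab: "a \<in> S" "b \<in> verts H - S" "(a, b) \<in> r" by metis
      then have "(u, b) \<in> rtrancl_on (verts H) r"
        using rtrancl_on_into_rtrancl_on[of u a "verts H" r b] by (simp add: S_def)
      then show False using ab(2) by (simp add: S_def)
    qed
    then show "(u, v) \<in> rtrancl_on (verts H) r" using uv(2) by (auto simp: S_def)
  qed
qed

lemma connected_pair_graph_iff:
  assumes "pair_graph G"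
  shows "Digraph_Component.connected (with_proj G) \<longleftrightarrow> pverts G \<noteq> {} \<and> boundary_connected G"
proof -
  have "(\<exists>e \<in> parcs G. (fst e, snd e) \<in> {(u, v), (v, u)}) \<longleftrightarrow> (u, v) \<in> parcs G" for u v
    using pair_graphD(2)[OF assms] by auto
  then show ?thesis
    unfolding connected_iff_boundary_arc boundary_connected_def with_proj_simps by simp
qed

section \<open>A class of outerplanar graphs\<close>

definition parabola :: "nat \<Rightarrow> complex" where
  "parabola i = Complex (real i) ((real i)\<^sup>2)"

lemma parabola_chord:
  assumes "z \<in> closed_segment (parabola i) (parabola j)" "i < j"
  shows "real i \<le> Re z" "Re z \<le> real j" "Im z - (Re z)\<^sup>2 = (Re z - real i) * (real j - Re z)"
proof -
  obtain u where u: "0 \<le> u" "u \<le> 1" "z = (1 - u) *\<^sub>R parabola i + u *\<^sub>R parabola j"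
    using assms(1) unfolding closed_segment_def by blast
  have re: "Re z = real i + u * (real j - real i)" unfolding u(3) by (simp add: parabola_def algebra_simps)
  have im: "Im z = (real i)\<^sup>2 + u * ((real j)\<^sup>2 - (real i)\<^sup>2)"
    unfolding u(3) by (simp add: parabola_def algebra_simps)
  show "real i \<le> Re z" using re u assms(2) by simp
  have "u * (real j - real i) \<le> 1 * (real j - real i)" using u assms(2) by (intro mult_right_mono) auto
  then show "Re z \<le> real j" using re by simp
  show "Im z - (Re z)\<^sup>2 = (Re z - real i) * (real j - Re z)"
    unfolding re im by (simp add: power2_eq_square algebra_simps)
qed

lemma parabola_eqI: "Re z = real k \<Longrightarrow> Im z - (Re z)\<^sup>2 = 0 \<Longrightarrow> z = parabola k"
  by (simp add: parabola_def complex_eq_iff)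

text \<open>The height of the chord from \<open>i\<close> to \<open>j\<close> over the parabola at \<open>t\<close> is \<open>(t - i) (j - t)\<close>; of two nested chords the outer
one therefore runs strictly above the inner one, except at common endpoints.\<close>

lemma nested_chords_meet:
  assumes z: "z \<in> closed_segment (parabola i) (parabola j)" "z \<in> closed_segment (parabola k) (parabola l)"
    and ij: "i < j" "k < l" "i \<le> k" "l \<le> j" "(i, j) \<noteq> (k, l)"
  shows "z \<in> parabola ` ({i, j} \<inter> {k, l})"
proof -
  note 1 = parabola_chord[OF z(1) ij(1)] and 2 = parabola_chord[OF z(2) ij(2)]
  define t where "t = Re z"
  have eq: "(t - real i) * (real j - t) = (t - real k) * (real l - t)" using 1(3) 2(3) by (simp add: t_def)
  have b: "real k \<le> t" "t \<le> real l" "real i \<le> real k" "real l \<le> real j" using 2 ij by (auto simp: t_def)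
  consider "t = real k" | "t = real l" | "real k < t" "t < real l" using b by linarith
  then show ?thesis
  proof cases
    case 1
    then have "(real k - real i) * (real j - real k) = 0" using eq by simp
    then have "k = i \<or> k = j" by auto
    moreover have "z = parabola k" using 1 2(3) by (intro parabola_eqI) (simp_all add: t_def)
    ultimately show ?thesis by auto
  next
    case 2
    then have "(real l - real i) * (real j - real l) = 0" using eq by simp
    then have "l = i \<or> l = j" by auto
    moreover have "z = parabola l" using 2 1(3) eq by (intro parabola_eqI) (simp_all add: t_def)
    ultimately show ?thesis by auto
  next
    case 3
    have "(real k - real i) * (real j - t) + (t - real k) * (real j - real l) = 0"
      using eq by (simp add: algebra_simps)
    moreover have "0 \<le> (real k - real i) * (real j - t)" "0 \<le> (t - real k) * (real j - real l)"
      using 3 b by (auto intro!: mult_nonneg_nonneg)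
    ultimately have "(real k - real i) * (real j - t) = 0" "(t - real k) * (real j - real l) = 0" by linarith+
    then have "k = i" "j = l" using 3 b by auto
    then show ?thesis using ij(5) by simp
  qed
qed

lemma noninterlacing_chords_meet:
  assumes z: "z \<in> closed_segment (parabola i) (parabola j)" "z \<in> closed_segment (parabola k) (parabola l)"
    and ij: "i < j" "k < l" "(i, j) \<noteq> (k, l)" and "\<not> (i < k \<and> k < j \<and> j < l)" "\<not> (k < i \<and> i < l \<and> l < j)"
  shows "z \<in> parabola ` ({i, j} \<inter> {k, l})"
proof -
  note 1 = parabola_chord[OF z(1) ij(1)] and 2 = parabola_chord[OF z(2) ij(2)]
  consider "j \<le> k" | "l \<le> i" | "i \<le> k" "l \<le> j" | "k \<le> i" "j \<le> l" using assms(6,7) by linarith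
  then show ?thesis
  proof cases
    case c: 1
    then have "Re z = real j" "k = j" using 1(2) 2(1) by linarith+
    then have "z = parabola j" using 1(3) by (intro parabola_eqI) simp_all
    then show ?thesis using \<open>k = j\<close> by auto
  next
    case c: 2
    then have "Re z = real l" "l = i" using 1(1) 2(2) by linarith+
    then have "z = parabola l" using 2(3) by (intro parabola_eqI) simp_all
    then show ?thesis using \<open>l = i\<close> by auto
  next
    case 3
    then show ?thesis by (rule nested_chords_meet[OF z ij(1,2) _ _ ij(3)])
  next
    case 4
    then show ?thesis using nested_chords_meet[OF z(2,1) ij(2,1)] ij(3) by auto
  qed
qed

lemma convex_above_parabola: "convex {z. (Re z)\<^sup>2 \<le> Im z}"
proof (rule convexI)
  fix x y :: complex and u v :: real
  assume xy: "x \<in> {z. (Re z)\<^sup>2 \<le> Im z}" "y \<in> {z. (Re z)\<^sup>2 \<le> Im z}" and uv: "0 \<le> u" "0 \<le> v" "u + v = 1"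
  have "(u * Re x + v * Re y)\<^sup>2 = u * (Re x)\<^sup>2 + v * (Re y)\<^sup>2 - u * v * (Re x - Re y)\<^sup>2"
  proof -
    have v: "v = 1 - u" using uv(3) by simp
    show ?thesis unfolding v by (simp add: power2_eq_square algebra_simps)
  qed
  also have "\<dots> \<le> u * (Re x)\<^sup>2 + v * (Re y)\<^sup>2" using uv by simp
  also have "\<dots> \<le> u * Im x + v * Im y" using xy uv by (intro add_mono mult_left_mono) auto
  finally show "u *\<^sub>R x + v *\<^sub>R y \<in> {z. (Re z)\<^sup>2 \<le> Im z}" by simp
qed

text \<open>The vertices are placed on a parabola and the edges drawn as chords. The drawing stays in the convex region above
the parabola, whose complement belongs to the outer face and touches every vertex.\<close>

theorem outerplanar_if_noninterlacing:
  fixes G :: "nat pair_pre_digraph"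
  assumes G: "pair_graph G"
    and ni: "\<And>i j k l. (i, j) \<in> parcs G \<Longrightarrow> (k, l) \<in> parcs G \<Longrightarrow> i < k \<Longrightarrow> k < j \<Longrightarrow> j < l \<Longrightarrow> False"
  shows "outerplanar G"
proof -
  define c where "c e = linepath (parabola (Min e)) (parabola (Max e))" for e
  let ?K = "{z. (Re z)\<^sup>2 \<le> Im z}"
  note sym = pair_graphD(2)[OF G]
  have inj: "parabola i = parabola j \<longleftrightarrow> i = j" for i j by (auto simp: parabola_def)
  have edge: "\<exists>i j. i < j \<and> {u, v} = {i, j} \<and> (i, j) \<in> parcs G" if "(u, v) \<in> parcs G" for u v
  proof -
    have "u \<noteq> v" using that pair_graphD(3)[OF G] by auto
    then have "u < v \<or> v < u" by linarith
    then show ?thesis using that sym by (auto intro: exI[of _ u] exI[of _ v])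
  qed
  have c: "c {i, j} = linepath (parabola i) (parabola j)" if "i < j" for i j :: nat
    using that by (simp add: c_def)
  have in_K: "closed_segment (parabola i) (parabola j) \<subseteq> ?K" if "i < j" for i j
  proof
    fix z assume "z \<in> closed_segment (parabola i) (parabola j)"
    note z = parabola_chord[OF this that]
    have "0 \<le> (Re z - real i) * (real j - Re z)" using z(1,2) by simp
    then show "z \<in> ?K" using z(3) by simp
  qed
  have on_chord: "k = i \<or> k = j" if "parabola k \<in> closed_segment (parabola i) (parabola j)" "i < j" for i j k
    using parabola_chord(3)[OF that] by (auto simp: parabola_def)
  have drawing: "plane_drawing G parabola c"
    unfolding plane_drawing_def
  proof (intro conjI ballI, goal_cases)
    case 1
    then show ?case by (auto simp: inj_on_def inj)
  next
    case (2 e)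
    obtain u v where e: "e = (u, v)" by (cases e)
    obtain i j where ij: "i < j" "{u, v} = {i, j}" "(i, j) \<in> parcs G" using edge 2 e by blast
    have V: "i \<in> pverts G" "j \<in> pverts G" using ij(3) pair_graphD(4,5)[OF G] by auto
    have img: "{parabola u, parabola v} = {parabola i, parabola j}" using ij(2) by (metis image_empty image_insert)
    have "closed_segment (parabola i) (parabola j) \<inter> parabola ` pverts G = {parabola i, parabola j}"
      using on_chord[OF _ ij(1)] V by auto
    then show ?case
      unfolding e prod.case ij(2) img c[OF ij(1)] using ij(1) inj[of i j] by simp
  next
    case (3 e)
    obtain u v where e: "e = (u, v)" by (cases e)
    obtain i j where ij: "i < j" "{u, v} = {i, j}" "(i, j) \<in> parcs G" using edge 3 e by blast
    show ?case
      unfolding e prod.case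
    proof (intro ballI, clarify)
      fix x y z assume xy: "(x, y) \<in> parcs G" and ne: "{u, v} \<noteq> {x, y}"
        and z: "z \<in> path_image (c {u, v})" "z \<in> path_image (c {x, y})"
      obtain k l where kl: "k < l" "{x, y} = {k, l}" "(k, l) \<in> parcs G" using edge xy by blast
      have "z \<in> parabola ` ({i, j} \<inter> {k, l})"
      proof (rule noninterlacing_chords_meet)
        show "z \<in> closed_segment (parabola i) (parabola j)" "z \<in> closed_segment (parabola k) (parabola l)"
          using z unfolding ij(2) kl(2) c[OF ij(1)] c[OF kl(1)] by simp_all
        show "(i, j) \<noteq> (k, l)" using ne ij(2) kl(2) by auto
      qed (use ij kl ni in blast)+
      then show "z \<in> parabola ` ({u, v} \<inter> {x, y})" using ij(2) kl(2) by simp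
    qed
  qed
  let ?D = "drawing_points G parabola c"
  have "?D \<subseteq> ?K"
  proof -
    have "path_image (c {u, v}) \<subseteq> ?K" if "(u, v) \<in> parcs G" for u v
    proof -
      obtain i j where ij: "i < j" "{u, v} = {i, j}" "(i, j) \<in> parcs G" using edge \<open>(u, v) \<in> parcs G\<close> by blast
      show ?thesis unfolding ij(2) c[OF ij(1)] using in_K[OF ij(1)] by simp
    qed
    then show ?thesis unfolding drawing_points_def by (auto simp: parabola_def)
  qed
  then have out: "- ?K \<subseteq> outside ?D" by (rule outside_subset_convex[OF convex_above_parabola])
  have "parabola v \<in> frontier (outside ?D)" if "v \<in> pverts G" for v
  proof -
    have "parabola v \<in> ?D" using that by (simp add: drawing_points_def)
    then have "parabola v \<notin> outside ?D" using outside_no_overlap[of ?D] by blast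
    then have "parabola v \<notin> interior (outside ?D)" using interior_subset by blast
    moreover have "parabola v \<in> closure (outside ?D)"
      unfolding closure_approachable
    proof (intro allI impI)
      fix e :: real assume e: "0 < e"
      have "parabola v - Complex 0 (e / 2) \<in> - ?K" using e by (simp add: parabola_def)
      moreover have "dist (parabola v - Complex 0 (e / 2)) (parabola v) < e"
        using e by (simp add: dist_norm norm_minus_commute cmod_def)
      ultimately show "\<exists>y \<in> outside ?D. dist y (parabola v) < e" using out by blast
    qed
    ultimately show ?thesis by (simp add: frontier_def)
  qed
  then show ?thesis unfolding outerplanar_def using drawing by blast
qed

section \<open>Fans and the double fan\<close>

lemma pair_graphI:
  assumes "finite (pverts G)" "\<And>u v. (u, v) \<in> parcs G \<Longrightarrow> u \<in> pverts G \<and> v \<in> pverts G \<and> u \<noteq> v \<and> (v, u) \<in> parcs G"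
  shows "pair_graph G"
proof
  show "finite (parcs G)"
    by (rule finite_subset[of _ "pverts G \<times> pverts G"]) (use assms in auto)
  show "symmetric (with_proj G)" using assms(2) by (auto simp: symmetric_def intro!: symI)
qed (use assms in auto)

lemma pverts_fan_graph: "pverts (fan_graph m) = {..m}"
  by (auto simp: fan_graph_def path_graph_def)

lemma pair_graph_fan: "pair_graph (fan_graph m)"
  by (rule pair_graphI) (auto simp: pverts_fan_graph fan_graph_arcs)

lemma boundary_connected_fan: "boundary_connected (fan_graph m)"
  unfolding boundary_connected_def pverts_fan_graph
proof (intro allI impI)
  fix S assume S: "S \<subseteq> {..m}" "S \<noteq> {}" "S \<noteq> {..m}"
  show "\<exists>u v. u \<in> S \<and> v \<in> {..m} - S \<and> (u, v) \<in> parcs (fan_graph m)"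
  proof (cases "m \<in> S")
    case True
    obtain v where v: "v \<in> {..m} - S" using S by blast
    then have "v < m" using True by (cases "v = m") auto
    then show ?thesis using True v by (intro exI[of _ m] exI[of _ v]) (auto simp: fan_graph_arcs)
  next
    case False
    obtain u where u: "u \<in> S" using S by blast
    then have "u < m" using False S(1) by (cases "u = m") auto
    then show ?thesis using False u by (intro exI[of _ u] exI[of _ m]) (auto simp: fan_graph_arcs)
  qed
qed

lemma adj_form_arcs:
  assumes "pair_graph G"
  shows "adj_form G x y = (\<Sum>(u, v) \<in> parcs G. x u * y v)"
proof -
  note fin = pair_graphD(1)[OF assms]
  have "adj_form G x y = (\<Sum>(u, v) \<in> Sigma (pverts G) (\<lambda>u. {v \<in> pverts G. (u, v) \<in> parcs G}). x u * y v)"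
    unfolding adj_form_def using fin by (subst sum.Sigma) auto
  also have "Sigma (pverts G) (\<lambda>u. {v \<in> pverts G. (u, v) \<in> parcs G}) = parcs G"
    using pair_graphD(4,5)[OF assms] by auto
  finally show ?thesis .
qed

abbreviation fan_radius :: "nat \<Rightarrow> real" where
  "fan_radius m \<equiv> graph_eigenvalue 1 (fan_graph m)"

lemma vertex_inner_fan: "vertex_inner (fan_graph m) y y = (\<Sum>i \<le> m. (y i)\<^sup>2)"
  by (simp add: vertex_inner_def pverts_fan_graph power2_eq_square)

lemma fan_eigenvalue_max:
  "fan_form m y \<le> fan_radius m * (\<Sum>i \<le> m. (y i)\<^sup>2)"
proof -
  have "pverts (fan_graph m) \<noteq> {}" by (auto simp: pverts_fan_graph)
  from top_eigenvectors[OF pair_graph_fan this]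
  have "adj_form (fan_graph m) y y \<le> fan_radius m * vertex_inner (fan_graph m) y y" by blast
  then show ?thesis unfolding adj_form_arcs[OF pair_graph_fan] vertex_inner_fan .
qed

lemma fan_maximiser_pos:
  assumes "\<And>i. 0 \<le> y i" "\<exists>i \<le> m. y i \<noteq> 0"
    and "fan_form m y = fan_radius m * (\<Sum>i \<le> m. (y i)\<^sup>2)"
  shows "\<forall>i \<le> m. 0 < y i"
proof -
  have "eigenvector_of (fan_graph m) (fan_radius m) y"
    by (rule maximiser_eigenvector[OF pair_graph_fan])
      (unfold adj_form_arcs[OF pair_graph_fan] vertex_inner_fan, rule fan_eigenvalue_max, rule assms(3))
  from nonneg_eigenvector_pos[OF pair_graph_fan boundary_connected_fan this] assms(1,2)
  show ?thesis by (auto simp: pverts_fan_graph)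
qed

text \<open>The test vector is the top eigenvector of the star: \<open>\<surd>m\<close> on the hub and \<open>1\<close> elsewhere.\<close>

lemma fan_eigenvalue_ge: "sqrt (real m) \<le> fan_radius m"
proof (cases "m = 0")
  case True
  have "0 \<le> (\<Sum>(i, j) \<in> parcs (fan_graph 0). 1 :: real)" by (intro sum_nonneg) auto
  then show ?thesis using True fan_eigenvalue_max[of "\<lambda>_. 1" 0] by simp
next
  case False
  define y where "y i = (if i = m then sqrt (real m) else 1)" for i
  let ?B = "{m} \<times> {..<m} \<union> {..<m} \<times> {m}"
  have fin: "finite (parcs (fan_graph m))"
    by (rule finite_subset[of _ "{..m} \<times> {..m}"]) (auto simp: fan_graph_arcs)
  have "(\<Sum>(i, j) \<in> ?B. y i * y j) = (\<Sum>(i, j) \<in> ?B. sqrt (real m))"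
    by (intro sum.cong) (auto simp: y_def)
  also have "\<dots> = real (card ?B) * sqrt (real m)" by (simp add: case_prod_unfold)
  also have "card ?B = m + m" by (subst card_Un_disjoint) auto
  finally have "2 * real m * sqrt (real m) = (\<Sum>(i, j) \<in> ?B. y i * y j)" by simp
  also have "\<dots> \<le> fan_form m y"
    using fin by (intro sum_mono2) (auto simp: fan_graph_arcs y_def)
  also have "\<dots> \<le> fan_radius m * (\<Sum>i \<le> m. (y i)\<^sup>2)"
    by (rule fan_eigenvalue_max[of y])
  also have "(\<Sum>i \<le> m. (y i)\<^sup>2) = 2 * real m"
  proof -
    have "(\<Sum>i \<le> m. (y i)\<^sup>2) = (\<Sum>i<m. (y i)\<^sup>2) + (y m)\<^sup>2" by (simp add: lessThan_Suc_atMost[symmetric])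
    also have "(\<Sum>i<m. (y i)\<^sup>2) = (\<Sum>i<m. 1)" by (intro sum.cong) (auto simp: y_def)
    finally show ?thesis by (simp add: y_def)
  qed
  finally have "2 * real m * sqrt (real m) \<le> 2 * real m * fan_radius m"
    by (simp add: mult_ac)
  then show ?thesis using False by simp
qed

text \<open>The path \<open>0, \<dots>, 2 q\<close> with all edges from \<open>0\<close> to vertices up to \<open>q\<close> and all edges from \<open>q + 1\<close> to later vertices. Deleting
\<open>q\<close> leaves a fan with hub \<open>0\<close> and a fan with hub \<open>q + 1\<close>; the numbering has no interlacing edges.\<close>

definition double_fan :: "nat \<Rightarrow> nat pair_pre_digraph" where
  "double_fan q = \<lparr> pverts = {..2 * q}, parcs = {(i, j). i \<le> 2 * q \<and> j \<le> 2 * q \<and>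
     (j = Suc i \<or> i = Suc j \<or> i = 0 \<and> 0 < j \<and> j \<le> q \<or> j = 0 \<and> 0 < i \<and> i \<le> q \<or> i = Suc q \<and> Suc q < j \<or> j = Suc q \<and> Suc q < i)} \<rparr>"

lemma pair_graph_double_fan: "pair_graph (double_fan q)"
  by (rule pair_graphI) (auto simp: double_fan_def)

lemma double_fan_connected_outerplanar: "connected_outerplanar_graph (2 * q + 1) (double_fan q)"
proof -
  have "boundary_connected (double_fan q)"
    unfolding boundary_connected_def
  proof (intro allI impI)
    fix S assume S: "S \<subseteq> pverts (double_fan q)" "S \<noteq> {}" "S \<noteq> pverts (double_fan q)"
    show "\<exists>u v. u \<in> S \<and> v \<in> pverts (double_fan q) - S \<and> (u, v) \<in> parcs (double_fan q)"
    proof (rule ccontr)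
      assume neg: "\<not> ?thesis"
      have step: "i \<in> S \<longleftrightarrow> Suc i \<in> S" if "Suc i \<le> 2 * q" for i
      proof -
        have "(i, Suc i) \<in> parcs (double_fan q)" "(Suc i, i) \<in> parcs (double_fan q)"
          "i \<in> pverts (double_fan q)" "Suc i \<in> pverts (double_fan q)"
          using that by (auto simp: double_fan_def)
        then show ?thesis using neg by blast
      qed
      have all: "i \<in> S \<longleftrightarrow> 0 \<in> S" if "i \<le> 2 * q" for i
        using that by (induction i) (use step in auto)
      obtain a b where "a \<in> S" "a \<le> 2 * q" "b \<notin> S" "b \<le> 2 * q" using S by (auto simp: double_fan_def)
      then show False using all by blast
    qed
  qed
  moreover have "outerplanar (double_fan q)"
  proof (rule outerplanar_if_noninterlacing[OF pair_graph_double_fan])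
    fix i j k l assume "(i, j) \<in> parcs (double_fan q)" "(k, l) \<in> parcs (double_fan q)" "i < k" "k < j" "j < l"
    then show False by (simp add: double_fan_def) linarith
  qed
  ultimately show ?thesis
    unfolding connected_outerplanar_graph_def
    using connected_pair_graph_iff[OF pair_graph_double_fan] pair_graph_double_fan
    by (auto simp: double_fan_def)
qed

text \<open>A vector is moved along an isomorphism onto an induced subgraph and extended by zero.\<close>

lemma forms_transport:
  fixes y :: "'b \<Rightarrow> real"
  assumes bij: "bij_betw f S (pverts F)" and S: "S \<subseteq> pverts G" "finite (pverts G)"
    and adj: "\<forall>u \<in> S. \<forall>v \<in> S. (u, v) \<in> parcs G \<longleftrightarrow> (f u, f v) \<in> parcs F"
  defines "x \<equiv> \<lambda>v. if v \<in> S then y (f v) else 0"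
  shows "vertex_inner G x x = vertex_inner F y y" "adj_form G x x = adj_form F y y"
proof -
  have "vertex_inner G x x = (\<Sum>v \<in> S. y (f v) * y (f v))"
    unfolding vertex_inner_def using S by (intro sum.mono_neutral_cong_right) (auto simp: x_def)
  also have "\<dots> = vertex_inner F y y" unfolding vertex_inner_def by (rule sum.reindex_bij_betw[OF bij])
  finally show "vertex_inner G x x = vertex_inner F y y" .
  have finS: "finite S" using S finite_subset by blast
  have "adj_form G x x = (\<Sum>v \<in> S. \<Sum>w | w \<in> S \<and> (v, w) \<in> parcs G. x v * x w)"
  proof -
    have "adj_form G x x = (\<Sum>v \<in> S. \<Sum>w | w \<in> pverts G \<and> (v, w) \<in> parcs G. x v * x w)"
      unfolding adj_form_def using S by (intro sum.mono_neutral_right) (auto simp: x_def)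
    also have "\<dots> = (\<Sum>v \<in> S. \<Sum>w | w \<in> S \<and> (v, w) \<in> parcs G. x v * x w)"
      using S by (intro sum.cong refl sum.mono_neutral_right) (auto simp: x_def)
    finally show ?thesis .
  qed
  also have "\<dots> = (\<Sum>v \<in> S. \<Sum>w \<in> S. if (f v, f w) \<in> parcs F then y (f v) * y (f w) else 0)"
    using adj finS by (simp add: sum.inter_filter x_def cong: if_cong)
  also have "\<dots> = (\<Sum>v \<in> S. \<Sum>j \<in> pverts F. if (f v, j) \<in> parcs F then y (f v) * y j else 0)"
    using sum.reindex_bij_betw[OF bij] by (intro sum.cong refl) fastforce
  also have "\<dots> = (\<Sum>i \<in> pverts F. \<Sum>j \<in> pverts F. if (i, j) \<in> parcs F then y i * y j else 0)"
    by (rule sum.reindex_bij_betw[OF bij])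
  also have "\<dots> = adj_form F y y"
    unfolding adj_form_def using bij_betw_finite[OF bij] finS by (simp add: sum.inter_filter)
  finally show "adj_form G x x = adj_form F y y" .
qed

lemma double_fan_second_eigenvalue:
  "fan_radius m \<le> graph_eigenvalue 2 (double_fan (Suc m))"
proof -
  let ?F = "fan_graph m" and ?G = "double_fan (Suc m)" and ?l = "fan_radius m"
  have ne: "pverts ?F \<noteq> {}" by (auto simp: pverts_fan_graph)
  have "\<exists>y. eigenvector_of ?F ?l y \<and> 0 < vertex_inner ?F y y"
    by (rule top_eigenvectors[OF pair_graph_fan ne]) (fastforce simp: pverts_fan_graph)
  then obtain y where y: "eigenvector_of ?F ?l y" "0 < vertex_inner ?F y y" by blast
  have yy: "adj_form ?F y y = ?l * vertex_inner ?F y y" by (rule adj_form_eigenvector[OF y(1)])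
  define S where "S = {..m}"
  define T where "T = {m + 2..2 * m + 2}"
  define f where "f i = (if i = 0 then m else i - 1)" for i :: nat
  define g where "g i = (if i = m + 2 then m else i - (m + 3))" for i
  have f: "bij_betw f S (pverts ?F)"
    by (rule bij_betw_byWitness[where f' = "\<lambda>i. if i = m then 0 else Suc i"])
      (auto simp: f_def S_def pverts_fan_graph)
  have g: "bij_betw g T (pverts ?F)"
    by (rule bij_betw_byWitness[where f' = "\<lambda>i. if i = m then m + 2 else i + (m + 3)"])
      (auto simp: g_def T_def pverts_fan_graph)
  have adjf: "\<forall>u \<in> S. \<forall>v \<in> S. (u, v) \<in> parcs ?G \<longleftrightarrow> (f u, f v) \<in> parcs ?F"
  proof (intro ballI)
    fix u v assume "u \<in> S" "v \<in> S"
    then show "(u, v) \<in> parcs ?G \<longleftrightarrow> (f u, f v) \<in> parcs ?F"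
      by (cases u; cases v) (auto simp: f_def S_def double_fan_def fan_graph_arcs)
  qed
  have adjg: "\<forall>u \<in> T. \<forall>v \<in> T. (u, v) \<in> parcs ?G \<longleftrightarrow> (g u, g v) \<in> parcs ?F"
  proof (intro ballI)
    fix u v assume "u \<in> T" "v \<in> T"
    obtain a b where "u = m + 2 + a" "v = m + 2 + b" "a \<le> m" "b \<le> m"
    proof
      show "u = m + 2 + (u - (m + 2))" "v = m + 2 + (v - (m + 2))" "u - (m + 2) \<le> m" "v - (m + 2) \<le> m"
        using \<open>u \<in> T\<close> \<open>v \<in> T\<close> by (auto simp: T_def)
    qed
    then show "(u, v) \<in> parcs ?G \<longleftrightarrow> (g u, g v) \<in> parcs ?F"
      by (cases a; cases b) (auto simp: g_def double_fan_def fan_graph_arcs)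
  qed
  have sub: "S \<subseteq> pverts ?G" "T \<subseteq> pverts ?G" by (auto simp: S_def T_def double_fan_def)
  note fin = pair_graphD(1)[OF pair_graph_double_fan]
  note ff = forms_transport[where y = y, OF f sub(1) fin adjf] and gg = forms_transport[where y = y, OF g sub(2) fin adjg]
  show ?thesis
  proof (rule second_eigenvalue_ge[OF pair_graph_double_fan, of "Suc m" S T])
    show "(u, v) \<notin> parcs ?G" if "u \<in> S" "v \<in> T" for u v
      using that by (auto simp: S_def T_def double_fan_def)
    show "?l * vertex_inner ?G (\<lambda>v. if v \<in> S then y (f v) else 0) (\<lambda>v. if v \<in> S then y (f v) else 0)
        \<le> adj_form ?G (\<lambda>v. if v \<in> S then y (f v) else 0) (\<lambda>v. if v \<in> S then y (f v) else 0)"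
      unfolding ff using yy by simp
    show "?l * vertex_inner ?G (\<lambda>v. if v \<in> T then y (g v) else 0) (\<lambda>v. if v \<in> T then y (g v) else 0)
        \<le> adj_form ?G (\<lambda>v. if v \<in> T then y (g v) else 0) (\<lambda>v. if v \<in> T then y (g v) else 0)"
      unfolding gg using yy by simp
    show "0 < vertex_inner ?G (\<lambda>v. if v \<in> S then y (f v) else 0) (\<lambda>v. if v \<in> S then y (f v) else 0)"
      "0 < vertex_inner ?G (\<lambda>v. if v \<in> T then y (g v) else 0) (\<lambda>v. if v \<in> T then y (g v) else 0)"
      unfolding ff gg using y(2) by simp_all
  qed (use sub in \<open>auto simp: S_def T_def double_fan_def\<close>)
qed

section \<open>Graphs with the largest second eigenvalue\<close>

lemma outerplanar_graph_relation:
  assumes "pair_graph G" "outerplanar G"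
  shows "outerplanar_relation (adj G)"
proof
  show "adj G u v \<Longrightarrow> adj G v u" "\<not> adj G v v" for u v
    using pair_graphD(2,3)[OF assms(1)] by auto
  show "distinct [a, b, x, y, z] \<Longrightarrow> adj G a x \<Longrightarrow> adj G a y \<Longrightarrow> adj G a z \<Longrightarrow>
      adj G x b \<Longrightarrow> adj G y b \<Longrightarrow> adj G z b \<Longrightarrow> False" for a b x y z
    by (rule outerplanar_no_K23[OF assms])
  show "distinct ([v1] @ l1 @ [v2] @ l2 @ [v3] @ l3 @ [v4]) \<Longrightarrow>
      successively (adj G) ([v1] @ l1 @ [v2] @ l2 @ [v3] @ l3 @ [v4]) \<Longrightarrow>
      adj G v4 v1 \<Longrightarrow> adj G v1 v3 \<Longrightarrow> adj G v2 v4 \<Longrightarrow> False" for v1 l1 v2 l2 v3 l3 v4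
    by (rule outerplanar_no_crossing_chords[OF assms])
qed

text \<open>On the vertices where an eigenvector is positive its restriction satisfies the eigenvalue inequality, since the
neighbours that are left out contribute nonpositive terms. An edge to a negative vertex makes the inequality strict at
its end, and the restriction would exceed the largest Rayleigh quotient of the fan.\<close>

lemma positive_part_is_fan:
  fixes G :: "'a pair_pre_digraph" and x :: "'a \<Rightarrow> real" and m :: nat
  assumes G: "pair_graph G" "outerplanar G" and eig: "eigenvector_of G l x"
  defines "P \<equiv> {v \<in> pverts G. 0 < x v}" and "mu \<equiv> fan_radius m"
  assumes ne: "P \<noteq> {}" and card: "card P \<le> Suc m" and large: "137 \<le> mu" "mu \<le> l"
  shows "l = mu"
    "\<exists>f. bij_betw f P {..m} \<and> (\<forall>u \<in> P. \<forall>w \<in> P. adj G u w \<longleftrightarrow> (f u, f w) \<in> parcs (fan_graph m))"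
    "\<And>u v. u \<in> P \<Longrightarrow> v \<in> pverts G \<Longrightarrow> x v < 0 \<Longrightarrow> \<not> adj G u v"
proof -
  interpret outerplanar_relation "adj G" by (rule outerplanar_graph_relation[OF G])
  note fin = pair_graphD(1)[OF G(1)]
  have PV: "P \<subseteq> pverts G" and finP: "finite P" using fin by (auto simp: P_def)
  define xP where "xP v = (if v \<in> P then x v else 0)" for v
  have le: "x v \<le> xP v" if "v \<in> pverts G" for v using that by (auto simp: xP_def P_def)
  define s where "s v = (\<Sum>w | w \<in> pverts G \<and> adj G v w. xP w)" for v
  have s_P: "s v = (\<Sum>w | w \<in> P \<and> adj G v w. x w)" for v
    unfolding s_def using fin PV by (intro sum.mono_neutral_cong_right) (auto simp: xP_def)
  have s_ge: "l * x v \<le> s v" if "v \<in> P" for v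
  proof -
    have "l * x v = (\<Sum>w | w \<in> pverts G \<and> adj G v w. x w)"
      using eig that PV by (auto simp: eigenvector_of_def)
    also have "\<dots> \<le> s v" unfolding s_def using le by (intro sum_mono) auto
    finally show ?thesis .
  qed
  have m: "real m \<le> mu\<^sup>2"
  proof -
    have "(sqrt (real m))\<^sup>2 \<le> mu\<^sup>2" unfolding mu_def by (intro power_mono fan_eigenvalue_ge) simp
    then show ?thesis by simp
  qed
  have ext: "l = mu" "\<exists>f. bij_betw f P {..m} \<and> (\<forall>u \<in> P. \<forall>w \<in> P. adj G u w \<longleftrightarrow> (f u, f w) \<in> parcs (fan_graph m))"
  proof -
    have nonneg: "\<And>v. v \<in> P \<Longrightarrow> 0 \<le> x v" and nz: "\<exists>v \<in> P. x v \<noteq> 0" using ne by (auto simp: P_def)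
    have sub: "\<And>v. v \<in> P \<Longrightarrow> l * x v \<le> (\<Sum>w | w \<in> P \<and> adj G v w. x w)" using s_ge s_P by simp
    have fan_le: "\<And>y. fan_form m y \<le> mu * (\<Sum>i \<le> m. (y i)\<^sup>2)"
      unfolding mu_def by (rule fan_eigenvalue_max)
    have fan_pos: "\<And>y. (\<And>i. 0 \<le> y i) \<Longrightarrow> (\<exists>i \<le> m. y i \<noteq> 0) \<Longrightarrow>
      fan_form m y = mu * (\<Sum>i \<le> m. (y i)\<^sup>2) \<Longrightarrow> \<forall>i \<le> m. 0 < y i"
      unfolding mu_def by (rule fan_maximiser_pos)
    note facts = finP card nonneg nz sub large(1) m large(2) fan_le fan_pos
    show "l = mu" by (rule fan_extremal(1); fact facts)
    show "\<exists>f. bij_betw f P {..m} \<and> (\<forall>u \<in> P. \<forall>w \<in> P. adj G u w \<longleftrightarrow> (f u, f w) \<in> parcs (fan_graph m))"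
      by (rule fan_extremal(3); fact facts)
  qed
  then show "l = mu" "\<exists>f. bij_betw f P {..m} \<and> (\<forall>u \<in> P. \<forall>w \<in> P. adj G u w \<longleftrightarrow> (f u, f w) \<in> parcs (fan_graph m))"
    by blast+
  obtain f where f: "bij_betw f P {..m}" "\<forall>u \<in> P. \<forall>w \<in> P. adj G u w \<longleftrightarrow> (f u, f w) \<in> parcs (fan_graph m)"
    using ext(2) by blast
  define y where "y = x \<circ> the_inv_into P f"
  have y: "y (f v) = x v" if "v \<in> P" for v
    using that f(1) by (simp add: y_def bij_betw_def the_inv_into_f_f)
  have xP: "(\<lambda>v. if v \<in> P then y (f v) else 0) = xP" using y by (auto simp: xP_def)
  have f': "bij_betw f P (pverts (fan_graph m))" using f(1) by (simp add: pverts_fan_graph)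
  note tr = forms_transport[where y = y, OF f' PV fin f(2), unfolded xP]
  have "adj_form (fan_graph m) y y \<le> mu * vertex_inner (fan_graph m) y y"
    unfolding adj_form_arcs[OF pair_graph_fan] vertex_inner_fan mu_def by (rule fan_eigenvalue_max)
  then have up: "adj_form G xP xP \<le> l * vertex_inner G xP xP" using tr ext(1) by simp
  fix u v assume u: "u \<in> P" and v: "v \<in> pverts G" "x v < 0"
  show "\<not> adj G u v"
  proof
    assume uv: "adj G u v"
    have "l * x u = (\<Sum>w | w \<in> pverts G \<and> adj G u w. x w)"
      using eig u PV by (auto simp: eigenvector_of_def)
    also have "\<dots> < s u"
      unfolding s_def
    proof (rule sum_strict_mono_ex1)
      show "\<exists>w \<in> {w \<in> pverts G. adj G u w}. x w < xP w"
        using v uv by (intro bexI[of _ v]) (auto simp: xP_def P_def)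
    qed (use fin le in auto)
    finally have strict: "l * x u < s u" .
    have "l * vertex_inner G xP xP = (\<Sum>v \<in> P. x v * (l * x v))"
      unfolding vertex_inner_def sum_distrib_left using fin PV
      by (intro sum.mono_neutral_cong_right) (auto simp: xP_def)
    also have "\<dots> < (\<Sum>v \<in> P. x v * s v)"
    proof (rule sum_strict_mono_ex1[OF finP])
      show "\<forall>v \<in> P. x v * (l * x v) \<le> x v * s v"
        using s_ge by (auto simp: P_def intro: mult_left_mono)
      show "\<exists>v \<in> P. x v * (l * x v) < x v * s v"
        using u strict by (intro bexI[of _ u]) (auto simp: P_def)
    qed
    also have "\<dots> = adj_form G xP xP"
    proof -
      have "adj_form G xP xP = (\<Sum>v \<in> pverts G. xP v * s v)"
        unfolding adj_form_def s_def by (simp add: sum_distrib_left)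
      also have "\<dots> = (\<Sum>v \<in> P. x v * s v)"
        using fin PV by (intro sum.mono_neutral_cong_right) (auto simp: xP_def)
      finally show ?thesis by simp
    qed
    finally show False using up by simp
  qed
qed

lemma disjoint_union_simps:
  "pverts (disjoint_union G H) = Inl ` pverts G \<union> Inr ` pverts H"
  "(Inl a, Inl b) \<in> parcs (disjoint_union G H) \<longleftrightarrow> (a, b) \<in> parcs G"
  "(Inr c, Inr d) \<in> parcs (disjoint_union G H) \<longleftrightarrow> (c, d) \<in> parcs H"
  "(Inl a, Inr c) \<notin> parcs (disjoint_union G H)" "(Inr c, Inl a) \<notin> parcs (disjoint_union G H)"
  by (auto simp: disjoint_union_def)

lemma del_vert_with_proj:
  "verts (pre_digraph.del_vert (with_proj G) u) = pverts G - {u}"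
  "arcs (pre_digraph.del_vert (with_proj G) u) = {e \<in> parcs G. fst e \<noteq> u \<and> snd e \<noteq> u}"
  "tail (pre_digraph.del_vert (with_proj G) u) = fst"
  "head (pre_digraph.del_vert (with_proj G) u) = snd"
  by (auto simp: pre_digraph.del_vert_def)

text \<open>The isomorphism is used only through the sizes of the two sides and the absence of arcs between them.\<close>

lemma split_of_iso:
  assumes "pair_graph G"
    and "digraph_iso (pre_digraph.del_vert (with_proj G) u) (with_proj (disjoint_union F H))"
  obtains S T where "S \<union> T = pverts G - {u}" "S \<inter> T = {}" "card S = card (pverts F)" "card T = card (pverts H)"
    "\<And>v w. v \<in> S \<Longrightarrow> w \<in> T \<Longrightarrow> (v, w) \<notin> parcs G"
proof -
  let ?D = "pre_digraph.del_vert (with_proj G) u" and ?U = "disjoint_union F H"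
  obtain h where h: "pre_digraph.digraph_isomorphism ?D h" "with_proj ?U = app_iso h ?D"
    using assms(2) unfolding digraph_iso_def by blast
  let ?v = "iso_verts h"
  have inj: "inj_on ?v (pverts G - {u})"
    and ends: "\<And>e. e \<in> parcs G \<Longrightarrow> fst e \<noteq> u \<Longrightarrow> snd e \<noteq> u \<Longrightarrow>
      ?v (fst e) = iso_tail h (iso_arcs h e) \<and> ?v (snd e) = iso_head h (iso_arcs h e)"
    using h(1) unfolding pre_digraph.digraph_isomorphism_def del_vert_with_proj by auto
  have verts: "pverts ?U = ?v ` (pverts G - {u})"
    using arg_cong[OF h(2), of verts] by (simp add: del_vert_with_proj)
  have arcs: "parcs ?U = iso_arcs h ` {e \<in> parcs G. fst e \<noteq> u \<and> snd e \<noteq> u}"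
    using arg_cong[OF h(2), of arcs] by (simp add: del_vert_with_proj)
  have th: "iso_tail h = fst" "iso_head h = snd"
    using arg_cong[OF h(2), of tail] arg_cong[OF h(2), of head] by simp_all
  have arc: "(?v a, ?v b) \<in> parcs ?U" if "(a, b) \<in> parcs G" "a \<noteq> u" "b \<noteq> u" for a b
  proof -
    have "iso_arcs h (a, b) \<in> parcs ?U" unfolding arcs using that by auto
    moreover have "iso_arcs h (a, b) = (?v a, ?v b)"
      using ends[of "(a, b)"] that th by (simp add: prod_eq_iff)
    ultimately show ?thesis by simp
  qed
  define S where "S = {v \<in> pverts G - {u}. ?v v \<in> range Inl}"
  define T where "T = {v \<in> pverts G - {u}. ?v v \<in> range Inr}"
  have cover: "?v v \<in> range Inl \<union> range Inr" for v by (metis UNIV_I UNIV_sum)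
  have "?v ` S = pverts ?U \<inter> range Inl" "?v ` T = pverts ?U \<inter> range Inr"
    unfolding verts S_def T_def by blast+
  then have imS: "?v ` S = Inl ` pverts F" and imT: "?v ` T = Inr ` pverts H"
    unfolding disjoint_union_simps by auto
  show thesis
  proof (rule that[of S T])
    show "S \<union> T = pverts G - {u}" unfolding S_def T_def using cover by blast
    show "S \<inter> T = {}" by (auto simp: S_def T_def)
    have "card (?v ` S) = card S" "card (?v ` T) = card T"
      by (rule card_image, rule inj_on_subset[OF inj], auto simp: S_def T_def)+
    then show "card S = card (pverts F)" "card T = card (pverts H)"
      unfolding imS imT by (simp_all add: card_image)
    show "(v, w) \<notin> parcs G" if vw: "v \<in> S" "w \<in> T" for v w
    proof
      assume "(v, w) \<in> parcs G"
      then have "(?v v, ?v w) \<in> parcs ?U" using arc vw by (auto simp: S_def T_def)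
      then show False using vw by (auto simp: S_def T_def disjoint_union_simps)
    qed
  qed
qed

abbreviation leaves_two_fans :: "nat \<Rightarrow> 'a pair_pre_digraph \<Rightarrow> 'a \<Rightarrow> bool" where
  "leaves_two_fans m G u \<equiv> digraph_iso (pre_digraph.del_vert (with_proj G) u)
     (with_proj (disjoint_union (fan_graph m) (fan_graph m)))"

lemma two_fans_cut_vertex:
  fixes m :: nat
  assumes G: "pair_graph G" "boundary_connected G" and card: "card (pverts G) = 2 * Suc m + 1"
    and PN: "P \<subseteq> pverts G" "N \<subseteq> pverts G" "P \<inter> N = {}"
    and no_arc: "\<And>a b. a \<in> P \<Longrightarrow> b \<in> N \<Longrightarrow> (a, b) \<notin> parcs G"
    and f: "bij_betw f P {..m}" "\<And>a b. a \<in> P \<Longrightarrow> b \<in> P \<Longrightarrow> (a, b) \<in> parcs G \<longleftrightarrow> (f a, f b) \<in> parcs (fan_graph m)"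
    and g: "bij_betw g N {..m}" "\<And>a b. a \<in> N \<Longrightarrow> b \<in> N \<Longrightarrow> (a, b) \<in> parcs G \<longleftrightarrow> (g a, g b) \<in> parcs (fan_graph m)"
  shows "\<exists>!u. cut_vertex G u \<and> leaves_two_fans m G u"
proof -
  note fin = pair_graphD(1)[OF G(1)] and sym = pair_graphD(2)[OF G(1)] and in_V = pair_graphD(4,5)[OF G(1)]
  let ?F = "fan_graph m"
  have finPN: "finite P" "finite N" using PN fin finite_subset by blast+
  have cardPN: "card P = Suc m" "card N = Suc m"
    using bij_betw_same_card[OF f(1)] bij_betw_same_card[OF g(1)] by simp_all
  have "card (pverts G - (P \<union> N)) = 1"
    using PN finPN card cardPN by (simp add: card_Diff_subset card_Un_disjoint)
  then obtain u where u: "pverts G - (P \<union> N) = {u}" by (auto simp: card_1_singleton_iff)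
  have V: "pverts G = insert u (P \<union> N)" and uPN: "u \<notin> P" "u \<notin> N" and uV: "u \<in> pverts G" using u PN by auto
  have Vu: "pverts G - {u} = P \<union> N" using V uPN by auto
  have no_arc': "(b, a) \<notin> parcs G" if "a \<in> P" "b \<in> N" for a b using no_arc that sym by blast
  have nePN: "P \<noteq> {}" "N \<noteq> {}" using cardPN by auto
  let ?D = "pre_digraph.del_vert (with_proj G) u"
  define h where "h v = (if v \<in> P then Inl (f v) else Inr (g v))" for v
  have hP: "h v = Inl (f v)" if "v \<in> P" for v using that by (simp add: h_def)
  have hN: "h v = Inr (g v)" if "v \<in> N" for v using that PN(3) by (auto simp: h_def)
  have injh: "inj_on h (P \<union> N)"
    using f(1) g(1) PN(3) by (auto simp: inj_on_def h_def bij_betw_def)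
  have imh: "h ` (P \<union> N) = pverts (disjoint_union ?F ?F)"
  proof -
    have "h ` P = Inl ` f ` P" "h ` N = Inr ` g ` N" using hP hN by (auto simp: image_image)
    then show ?thesis
      using f(1) g(1) by (simp add: image_Un bij_betw_def disjoint_union_simps pverts_fan_graph)
  qed
  have arch: "(a, b) \<in> parcs G \<longleftrightarrow> (h a, h b) \<in> parcs (disjoint_union ?F ?F)" if "a \<in> P \<union> N" "b \<in> P \<union> N" for a b
    using that hP hN f(2) g(2) no_arc no_arc' by (auto simp: disjoint_union_simps)
  have arcsD: "{e \<in> parcs G. fst e \<noteq> u \<and> snd e \<noteq> u} = parcs G \<inter> (P \<union> N) \<times> (P \<union> N)"
  proof -
    have "a \<in> insert u (P \<union> N) \<and> b \<in> insert u (P \<union> N)" if "(a, b) \<in> parcs G" for a b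
      using in_V[OF that] unfolding V by simp
    then show ?thesis using uPN by fastforce
  qed
  have imarcs: "map_prod h h ` (parcs G \<inter> (P \<union> N) \<times> (P \<union> N)) = parcs (disjoint_union ?F ?F)"
  proof
    show "map_prod h h ` (parcs G \<inter> (P \<union> N) \<times> (P \<union> N)) \<subseteq> parcs (disjoint_union ?F ?F)" using arch by auto
    show "parcs (disjoint_union ?F ?F) \<subseteq> map_prod h h ` (parcs G \<inter> (P \<union> N) \<times> (P \<union> N))"
    proof
      fix e assume e: "e \<in> parcs (disjoint_union ?F ?F)"
      then have "fst e \<in> h ` (P \<union> N) \<and> snd e \<in> h ` (P \<union> N)"
        unfolding imh disjoint_union_def pverts_fan_graph by (auto simp: fan_graph_arcs)
      then obtain a b where ab: "a \<in> P \<union> N" "b \<in> P \<union> N" "e = (h a, h b)" by (metis imageE prod.collapse)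
      then show "e \<in> map_prod h h ` (parcs G \<inter> (P \<union> N) \<times> (P \<union> N))" using arch e by auto
    qed
  qed
  have iso: "digraph_iso ?D (with_proj (disjoint_union ?F ?F))"
    unfolding digraph_iso_def
  proof (intro exI conjI)
    let ?h = "\<lparr> iso_verts = h, iso_arcs = map_prod h h, iso_head = snd, iso_tail = fst \<rparr>"
    show "pre_digraph.digraph_isomorphism ?D ?h"
      unfolding pre_digraph.digraph_isomorphism_def del_vert_with_proj digraph_isomorphism.simps Vu arcsD
    proof (intro conjI ballI)
      show "wf_digraph ?D" by (rule wf_digraph.intro) (auto simp: del_vert_with_proj in_V)
      show "inj_on h (P \<union> N)" by (rule injh)
      show "inj_on (map_prod h h) (parcs G \<inter> (P \<union> N) \<times> (P \<union> N))"
        by (rule inj_on_subset[OF map_prod_inj_on[OF injh injh]]) auto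
    qed auto
    show "with_proj (disjoint_union ?F ?F) = app_iso ?h ?D"
      unfolding app_iso_def with_proj_def del_vert_with_proj[unfolded with_proj_def] digraph_isomorphism.simps
        Vu arcsD imh imarcs ..
  qed
  have cut: "cut_vertex G u"
    unfolding cut_vertex_def
  proof (intro conjI)
    show "Digraph_Component.connected (with_proj G)"
      using connected_pair_graph_iff[OF G(1)] G(2) uV by auto
    show "pverts G \<noteq> {u}" using nePN PN uPN by auto
    show "\<not> Digraph_Component.connected ?D"
    proof
      assume "Digraph_Component.connected ?D"
      note boundary = this[unfolded connected_iff_boundary_arc del_vert_with_proj Vu arcsD, THEN conjunct2, rule_format, of P]
      have "\<exists>a b. a \<in> P \<and> b \<in> P \<union> N - P \<and> (\<exists>e \<in> parcs G \<inter> (P \<union> N) \<times> (P \<union> N). (fst e, snd e) \<in> {(a, b), (b, a)})"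
        by (rule boundary) (use nePN PN(3) in auto)
      then show False using no_arc no_arc' by auto
    qed
  qed (rule uV)
  \<comment> \<open>Deleting another vertex leaves \<open>u\<close> together with a whole fan in one component, which has more than \<open>m + 1\<close> vertices.\<close>
  have unique: "u' = u" if u': "cut_vertex G u'" "leaves_two_fans m G u'" for u'
  proof (rule ccontr)
    assume ne: "u' \<noteq> u"
    obtain S T where ST': "S \<union> T = pverts G - {u'}" "S \<inter> T = {}" "card S = card (pverts ?F)" "card T = card (pverts ?F)"
      "\<And>v w. v \<in> S \<Longrightarrow> w \<in> T \<Longrightarrow> (v, w) \<notin> parcs G"
      by (rule split_of_iso[OF G(1) u'(2)]) blast
    note ST = ST'(1,2) ST'(3,4)[unfolded pverts_fan_graph card_atMost] ST'(5)
    have "finite (S \<union> T)" using fin unfolding ST(1) by simp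
    then have finST: "finite S" "finite T" by simp_all
    have big: False if Q: "Q \<subseteq> pverts G" "Q \<noteq> {}" "card Q = Suc m" "u \<notin> Q" "u' \<notin> Q"
      and hub: "z \<in> Q" "\<And>v. v \<in> Q \<Longrightarrow> v = z \<or> (v, z) \<in> parcs G"
      and only: "\<And>v w. v \<in> Q \<Longrightarrow> w \<in> pverts G - Q \<Longrightarrow> (v, w) \<in> parcs G \<Longrightarrow> w = u" for Q z
    proof -
      have "Q \<noteq> pverts G" using Q(4) uV by auto
      then obtain v w where "v \<in> Q" "w \<in> pverts G - Q" "(v, w) \<in> parcs G"
        using G(2) Q(1,2) unfolding boundary_connected_def by metis
      then have v: "v \<in> Q" "(v, u) \<in> parcs G" using only by auto
      have same: False if "A \<union> B = pverts G - {u'}" "card A = Suc m" "finite A" "u \<in> A"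
        "\<And>v w. v \<in> A \<Longrightarrow> w \<in> B \<Longrightarrow> (v, w) \<notin> parcs G" for A B
      proof -
        have AB: "w \<in> A" if "v \<in> A" "(v, w) \<in> parcs G" "w \<in> Q" for v w
          using \<open>A \<union> B = _\<close> \<open>\<And>v w. v \<in> A \<Longrightarrow> w \<in> B \<Longrightarrow> (v, w) \<notin> parcs G\<close>[OF that(1)] that(2,3) Q(1,5) by blast
        have "v \<in> A" using AB[OF \<open>u \<in> A\<close> sym[OF v(2)] v(1)] .
        then have zA: "z \<in> A" using hub(2)[OF v(1)] AB[OF _ _ hub(1)] by blast
        have "Q \<subseteq> A"
        proof
          fix w assume w: "w \<in> Q"
          show "w \<in> A" using hub(2)[OF w] AB[OF zA _ w] zA sym by blast
        qed
        then have "card (insert u Q) \<le> card A" using \<open>u \<in> A\<close> \<open>finite A\<close> by (intro card_mono) auto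
        moreover have "finite Q" using Q(1) fin finite_subset by blast
        ultimately show False using Q(3,4) \<open>card A = Suc m\<close> by simp
      qed
      have "u \<in> S \<or> u \<in> T" using ST(1) uV ne by blast
      then show False
      proof
        assume "u \<in> S"
        show False by (rule same[OF ST(1,3) finST(1) \<open>u \<in> S\<close> ST(5)])
      next
        assume "u \<in> T"
        have "T \<union> S = pverts G - {u'}" using ST(1) by blast
        moreover have "(v, w) \<notin> parcs G" if "v \<in> T" "w \<in> S" for v w using ST(5) that sym by blast
        ultimately show False by (rule same[OF _ ST(4) finST(2) \<open>u \<in> T\<close>])
      qed
    qed
    have hub: "\<exists>z \<in> Q. \<forall>v \<in> Q. v = z \<or> (v, z) \<in> parcs G"
      if k: "bij_betw k Q {..m}" "\<And>a b. a \<in> Q \<Longrightarrow> b \<in> Q \<Longrightarrow> (a, b) \<in> parcs G \<longleftrightarrow> (k a, k b) \<in> parcs ?F" for Q k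
    proof -
      obtain z where z: "z \<in> Q" "k z = m" using k(1) by (metis atMost_iff bij_betw_iff_bijections order_refl)
      have "v = z \<or> (v, z) \<in> parcs G" if v: "v \<in> Q" for v
      proof (cases "v = z")
        case False
        then have "k v \<noteq> m" "k v \<le> m" using k(1) z v by (auto simp: bij_betw_def inj_on_def)
        then show ?thesis using k(2)[OF v z(1)] z(2) by (simp add: fan_graph_arcs)
      qed simp
      then show ?thesis using z(1) by blast
    qed
    have "u' \<notin> N \<or> u' \<notin> P" using PN(3) by blast
    then show False
    proof
      assume "u' \<notin> N"
      obtain z where z: "z \<in> N" "\<And>v. v \<in> N \<Longrightarrow> v = z \<or> (v, z) \<in> parcs G" using hub[OF g] by blast
      show False by (rule big[OF PN(2) nePN(2) cardPN(2) uPN(2) \<open>u' \<notin> N\<close> z]) (use V no_arc' in blast)+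
    next
      assume "u' \<notin> P"
      obtain z where z: "z \<in> P" "\<And>v. v \<in> P \<Longrightarrow> v = z \<or> (v, z) \<in> parcs G" using hub[OF f] by blast
      show False by (rule big[OF PN(1) nePN(1) cardPN(1) uPN(1) \<open>u' \<notin> P\<close> z]) (use V no_arc in blast)+
    qed
  qed
  show ?thesis using cut iso unique by blast
qed

lemma max_second_eigenvalue_structure:
  fixes G :: "nat pair_pre_digraph" and m :: nat
  assumes m: "137\<^sup>2 \<le> m"
    and G: "connected_outerplanar_graph (2 * Suc m + 1) G"
    and ge: "fan_radius m \<le> graph_eigenvalue 2 G"
  shows "graph_eigenvalue 2 G = fan_radius m"
    "\<exists>!u. cut_vertex G u \<and> leaves_two_fans m G u"
proof -
  let ?mu = "fan_radius m" and ?l = "graph_eigenvalue 2 G"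
  have G': "pair_graph G" "card (pverts G) = 2 * Suc m + 1" "boundary_connected G" "outerplanar G"
    using G connected_pair_graph_iff unfolding connected_outerplanar_graph_def by blast+
  note fin = pair_graphD(1)[OF G'(1)]
  have large: "137 \<le> ?mu"
  proof -
    have "137\<^sup>2 \<le> real m" using of_nat_mono[OF m, where 'a = real] by simp
    then have "137 \<le> sqrt (real m)" by (rule real_le_rsqrt)
    then show ?thesis using fan_eigenvalue_ge[of m] by linarith
  qed
  obtain x where x: "eigenvector_of G ?l x" "\<exists>v \<in> pverts G. 0 < x v" "\<exists>v \<in> pverts G. x v < 0"
    using second_eigenvector_signs[OF G'(1,3)] G'(2) by auto
  \<comment> \<open>One sign class has at most \<open>m + 1\<close> vertices; up to the sign of the eigenvector it is the positive one.\<close>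
  have "\<exists>x. eigenvector_of G ?l x \<and> (\<exists>v \<in> pverts G. 0 < x v) \<and> (\<exists>v \<in> pverts G. x v < 0) \<and>
    card {v \<in> pverts G. 0 < x v} \<le> Suc m"
  proof -
    have neg: "eigenvector_of G ?l (\<lambda>v. - x v)"
      using x(1) by (simp add: eigenvector_of_def sum_negf)
    have "card ({v \<in> pverts G. 0 < x v} \<union> {v \<in> pverts G. x v < 0}) \<le> card (pverts G)"
      using fin by (intro card_mono) auto
    moreover have "card ({v \<in> pverts G. 0 < x v} \<union> {v \<in> pverts G. x v < 0}) =
        card {v \<in> pverts G. 0 < x v} + card {v \<in> pverts G. x v < 0}"
      using fin by (intro card_Un_disjoint) auto
    ultimately have "card {v \<in> pverts G. 0 < x v} \<le> Suc m \<or> card {v \<in> pverts G. 0 < - x v} \<le> Suc m"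
      using G'(2) by auto
    then show ?thesis
    proof
      assume "card {v \<in> pverts G. 0 < x v} \<le> Suc m"
      then show ?thesis using x by blast
    next
      assume "card {v \<in> pverts G. 0 < - x v} \<le> Suc m"
      then show ?thesis using neg x(2,3) by (intro exI[of _ "\<lambda>v. - x v"]) auto
    qed
  qed
  then obtain x where x: "eigenvector_of G ?l x" "\<exists>v \<in> pverts G. 0 < x v" "\<exists>v \<in> pverts G. x v < 0"
    and small: "card {v \<in> pverts G. 0 < x v} \<le> Suc m" by blast
  define P where "P = {v \<in> pverts G. 0 < x v}"
  define N where "N = {v \<in> pverts G. x v < 0}"
  have ne: "P \<noteq> {}" "N \<noteq> {}" using x(2,3) by (auto simp: P_def N_def)
  have PN: "P \<subseteq> pverts G" "N \<subseteq> pverts G" "P \<inter> N = {}" by (auto simp: P_def N_def)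
  have finPN: "finite P" "finite N" using PN fin finite_subset by blast+
  note pos = positive_part_is_fan[OF G'(1,4) x(1), of m, folded P_def, OF ne(1) small[folded P_def] large ge]
  show "?l = ?mu" by (rule pos(1))
  obtain f where f: "bij_betw f P {..m}" "\<And>a b. a \<in> P \<Longrightarrow> b \<in> P \<Longrightarrow> (a, b) \<in> parcs G \<longleftrightarrow> (f a, f b) \<in> parcs (fan_graph m)"
    using pos(2) by blast
  have no_arc: "(a, b) \<notin> parcs G" if "a \<in> P" "b \<in> N" for a b using pos(3) that by (simp add: N_def)
  have cardP: "card P = Suc m" using bij_betw_same_card[OF f(1)] by simp
  \<comment> \<open>Otherwise \<open>P\<close> and \<open>N\<close> exhaust the vertices and the graph is disconnected.\<close>
  have card_le: "card N \<le> Suc m"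
  proof (rule ccontr)
    assume "\<not> card N \<le> Suc m"
    then have "card (pverts G) \<le> card (P \<union> N)" using G'(2) cardP finPN PN(3) by (simp add: card_Un_disjoint)
    then have "P \<union> N = pverts G" using PN fin by (intro card_seteq) auto
    then have "pverts G - P = N" using PN by blast
    moreover have "P \<noteq> pverts G" using ne PN by blast
    ultimately have "\<exists>a b. a \<in> P \<and> b \<in> N \<and> (a, b) \<in> parcs G"
      using G'(3) PN(1) ne(1) unfolding boundary_connected_def by blast
    then show False using no_arc by blast
  qed
  have neg: "eigenvector_of G ?l (\<lambda>v. - x v)" using x(1) by (simp add: eigenvector_of_def sum_negf)
  have N': "{v \<in> pverts G. 0 < - x v} = N" by (simp add: N_def)
  note negpart = positive_part_is_fan[OF G'(1,4) neg, of m, unfolded N', OF ne(2) card_le large ge]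
  obtain g where g: "bij_betw g N {..m}" "\<And>a b. a \<in> N \<Longrightarrow> b \<in> N \<Longrightarrow> (a, b) \<in> parcs G \<longleftrightarrow> (g a, g b) \<in> parcs (fan_graph m)"
    using negpart(2) by blast
  show "\<exists>!u. cut_vertex G u \<and> leaves_two_fans m G u"
    by (rule two_fans_cut_vertex[OF G'(1,3,2) PN no_arc f g])
qed

theorem theorem3:
  shows "\<exists>N. \<forall>n q. n \<ge> N \<and> n = 2 * q + 1 \<longrightarrow>
    (\<forall>G :: nat pair_pre_digraph.
       is_arg_max (graph_eigenvalue 2) (connected_outerplanar_graph n) G \<longrightarrow>
         (\<exists>!u. cut_vertex G u \<and>
            digraph_iso (pre_digraph.del_vert (with_proj G) u)
              (with_proj (disjoint_union (fan_graph (q - 1)) (fan_graph (q - 1))))) \<and>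
         graph_eigenvalue 2 G = graph_eigenvalue 1 (fan_graph (q - 1)))"
proof (intro exI[of _ "2 * Suc (137\<^sup>2) + 1"] allI impI)
  fix n q :: nat and G :: "nat pair_pre_digraph"
  assume n: "2 * Suc (137\<^sup>2) + 1 \<le> n \<and> n = 2 * q + 1"
    and max: "is_arg_max (graph_eigenvalue 2) (connected_outerplanar_graph n) G"
  define m where "m = q - 1"
  have q: "q = Suc m" and m: "137\<^sup>2 \<le> m" using n by (auto simp: m_def)
  have G: "connected_outerplanar_graph (2 * Suc m + 1) G" using max n q by (simp add: is_arg_max_def)
  have "\<not> graph_eigenvalue 2 G < graph_eigenvalue 2 (double_fan q)"
    using max double_fan_connected_outerplanar[of q] n unfolding is_arg_max_def by blast
  then have ge: "graph_eigenvalue 1 (fan_graph m) \<le> graph_eigenvalue 2 G"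
    using double_fan_second_eigenvalue[of m] unfolding q by linarith
  show "(\<exists>!u. cut_vertex G u \<and> digraph_iso (pre_digraph.del_vert (with_proj G) u)
      (with_proj (disjoint_union (fan_graph (q - 1)) (fan_graph (q - 1))))) \<and>
      graph_eigenvalue 2 G = graph_eigenvalue 1 (fan_graph (q - 1))"
    unfolding m_def[symmetric] using max_second_eigenvalue_structure[OF m G ge] by (intro conjI)
qed

end
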